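(* Let $G$ be an amenable locally compact group equipped with a normalized Borel measurable 2-cocycle $\sigma\colon G\times G\to\mathbb{T}$. Let $\pi\colon G\to \mathrm{B}(X)$ be a continuous $\sigma$-projective representation of $G$ on a separable Banach space $X$ which is uniformly bounded, with $$M=\sup\{\|\pi_s\|_{X\to X}:s\in G\}<\infty.$$ Suppose that $1\leq p<\infty$. Then for any function $f\in \mathrm{L}^1(G)$ we have $$\Big\|\int_Gf(s)\pi_s\,d\mu_G(s)\Big\|_{X\to X}\leq M^2\,\|C_{f,\sigma}\|_{\mathrm{L}^p(G,X)\to \mathrm{L}^p(G,X)},$$ where $C_{f,\sigma}\colon g\mapsto f*_\sigma g$ is the twisted convolution operator on the Bochner space $\mathrm{L}^p(G,X)$.
   Context: $\mu_G$ is a left Haar measure on $G$ and $\mathbb{T}=\{z\in\mathbb{C}:|z|=1\}$. A Borel measurable 2-cocycle is a Borel map $\sigma\colon G\times G\to\mathbb{T}$ with $\sigma(s,t)\sigma(st,r)=\sigma(s,tr)\sigma(t,r)$ for all $s,t,r\in G$; it is normalized if $\sigma(s,s^{-1})=1$ for all $s\in G$. A continuous $\sigma$-projective representation on a Banach space $X$ is a map $\pi\colon G\to \mathrm{B}(X)$ such that $s\mapsto\pi_sx$ is continuous for each $x\in X$ and $\pi_s\pi_t=\sigma(s,t)\pi_{st}$ for all $s,t\in G$. The operator $\int_Gf(s)\pi_s\,d\mu_G(s)$ is defined by $x\mapsto\int_Gf(s)\pi_sx\,d\mu_G(s)$ (weak integral). The twisted convolution of $f\colon G\to\mathbb{C}$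 and $g\colon G\to X$ is $$(f*_\sigma g)(t)=\int_G\sigma(s,s^{-1}t)f(s)g(s^{-1}t)\,d\mu_G(s).$$ *)

theory Defs
  imports "HOL-Analysis.Analysis"
begin

text \<open>
  Groups are written additively, following the library class \<open>topological_group_add\<close>, which
  does not assume commutativity: \<open>s + t\<close>, \<open>- s\<close> and \<open>0\<close> stand for
  $st$, $s^{-1}$ and $e$.
\<close>

class complex_banach = banach +
  fixes scaleC :: "complex \<Rightarrow> 'a \<Rightarrow> 'a"  (infixr "*\<^sub>C" 75)
  assumes scaleC_add_right: "c *\<^sub>C (x + y) = c *\<^sub>C x + c *\<^sub>C y"
    and scaleC_add_left: "(c + d) *\<^sub>C x = c *\<^sub>C x + d *\<^sub>C x"
    and scaleC_scaleC: "c *\<^sub>C d *\<^sub>C x = (c * d) *\<^sub>C x"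
    and scaleC_of_real: "complex_of_real r *\<^sub>C x = r *\<^sub>R x"
    and norm_scaleC: "norm (c *\<^sub>C x) = cmod c * norm x"

instantiation complex :: complex_banach
begin

definition scaleC_complex :: "complex \<Rightarrow> complex \<Rightarrow> complex"
  where "scaleC_complex c z = c * z"

instance
  by standard
    (simp_all add: scaleC_complex_def algebra_simps norm_mult scaleR_conv_of_real)

end

definition bounded_clinear :: "('a::complex_banach \<Rightarrow> 'b::complex_banach) \<Rightarrow> bool"
  where "bounded_clinear T \<longleftrightarrow> bounded_linear T \<and> (\<forall>c x. T (c *\<^sub>C x) = c *\<^sub>C T x)"

text \<open>The groups are not assumed second countable or \<open>\<sigma>\<close>-compact, so regularity has to be
  required explicitly.\<close>

definition left_haar_measure :: "'g::{topological_group_add, t2_space} measure \<Rightarrow> bool"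
  where "left_haar_measure \<mu> \<longleftrightarrow>
    sets \<mu> = sets borel \<and>
    emeasure \<mu> UNIV \<noteq> 0 \<and>
    (\<forall>K. compact K \<longrightarrow> emeasure \<mu> K < \<infinity>) \<and>
    (\<forall>A\<in>sets borel. emeasure \<mu> A = (INF U\<in>{U. open U \<and> A \<subseteq> U}. emeasure \<mu> U)) \<and>
    (\<forall>U. open U \<longrightarrow> emeasure \<mu> U = (SUP K\<in>{K. compact K \<and> K \<subseteq> U}. emeasure \<mu> K)) \<and>
    (\<forall>s. \<forall>A\<in>sets borel. emeasure \<mu> ((+) s ` A) = emeasure \<mu> A)"

text \<open>For groups that are not \<open>\<sigma>\<close>-compact, $L^\infty(G)$ is formed modulo locally null sets.\<close>

definition locally_AE :: "'g::topological_space measure \<Rightarrow> ('g \<Rightarrow> bool) \<Rightarrow> bool"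
  where "locally_AE \<mu> P \<longleftrightarrow> (\<forall>K. compact K \<longrightarrow> (AE t in \<mu>. t \<in> K \<longrightarrow> P t))"

definition Linfty :: "'g::topological_space measure \<Rightarrow> ('g \<Rightarrow> real) set"
  where "Linfty \<mu> = {\<phi> \<in> borel_measurable \<mu>. \<exists>B. locally_AE \<mu> (\<lambda>t. \<bar>\<phi> t\<bar> \<le> B)}"

text \<open>A mean is given on representatives; by linearity, positivity with respect to
  \<open>locally_AE\<close> forces it to agree on functions that are equal locally almost everywhere, so it
  is a functional on the (real) quotient space $L^\infty(G)$.\<close>

definition left_invariant_mean ::
    "'g::{topological_group_add, t2_space} measure \<Rightarrow> (('g \<Rightarrow> real) \<Rightarrow> real) \<Rightarrow> bool"
  where "left_invariant_mean \<mu> m \<longleftrightarrow>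
    (\<forall>\<phi>\<in>Linfty \<mu>. \<forall>\<psi>\<in>Linfty \<mu>. m (\<lambda>t. \<phi> t + \<psi> t) = m \<phi> + m \<psi>) \<and>
    (\<forall>\<phi>\<in>Linfty \<mu>. \<forall>c. m (\<lambda>t. c * \<phi> t) = c * m \<phi>) \<and>
    (\<forall>\<phi>\<in>Linfty \<mu>. locally_AE \<mu> (\<lambda>t. 0 \<le> \<phi> t) \<longrightarrow> 0 \<le> m \<phi>) \<and>
    m (\<lambda>t. 1) = 1 \<and>
    (\<forall>\<phi>\<in>Linfty \<mu>. \<forall>s. m (\<lambda>t. \<phi> (- s + t)) = m \<phi>)"

definition amenable :: "'g::{topological_group_add, t2_space} measure \<Rightarrow> bool"
  where "amenable \<mu> \<longleftrightarrow> (\<exists>m. left_invariant_mean \<mu> m)"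

text \<open>Measurability is with respect to the Borel sets of the product topology, which in general
  form a larger \<open>\<sigma>\<close>-algebra than the product of the two Borel \<open>\<sigma>\<close>-algebras.\<close>

definition borel_cocycle :: "('g::topological_group_add \<Rightarrow> 'g \<Rightarrow> complex) \<Rightarrow> bool"
  where "borel_cocycle \<sigma> \<longleftrightarrow>
    (\<lambda>(s, t). \<sigma> s t) \<in> borel_measurable (borel :: ('g \<times> 'g) measure) \<and>
    (\<forall>s t. cmod (\<sigma> s t) = 1) \<and>
    (\<forall>s t r. \<sigma> s t * \<sigma> (s + t) r = \<sigma> s (t + r) * \<sigma> t r)"

definition normalized_cocycle :: "('g::topological_group_add \<Rightarrow> 'g \<Rightarrow> complex) \<Rightarrow> bool"
  where "normalized_cocycle \<sigma> \<longleftrightarrow> (\<forall>s. \<sigma> s (- s) = 1)"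

definition continuous_projective_rep ::
    "('g::topological_group_add \<Rightarrow> 'g \<Rightarrow> complex) \<Rightarrow> ('g \<Rightarrow> 'x::complex_banach \<Rightarrow> 'x) \<Rightarrow> bool"
  where "continuous_projective_rep \<sigma> \<pi> \<longleftrightarrow>
    (\<forall>s. bounded_clinear (\<pi> s)) \<and>
    (\<forall>x. continuous_on UNIV (\<lambda>s. \<pi> s x)) \<and>
    (\<forall>s t x. \<pi> s (\<pi> t x) = \<sigma> s t *\<^sub>C \<pi> (s + t) x)"

definition has_weak_integral :: "'a measure \<Rightarrow> ('a \<Rightarrow> 'x::complex_banach) \<Rightarrow> 'x \<Rightarrow> bool"
  where "has_weak_integral \<mu> h y \<longleftrightarrow>
    (\<forall>\<phi> :: 'x \<Rightarrow> complex. bounded_clinear \<phi> \<longrightarrow>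
      integrable \<mu> (\<lambda>s. \<phi> (h s)) \<and> \<phi> y = (\<integral>s. \<phi> (h s) \<partial>\<mu>))"

definition weak_integral :: "'a measure \<Rightarrow> ('a \<Rightarrow> 'x::complex_banach) \<Rightarrow> 'x"
  where "weak_integral \<mu> h = (THE y. has_weak_integral \<mu> h y)"

definition integrated_rep ::
    "'g measure \<Rightarrow> ('g \<Rightarrow> 'x::complex_banach \<Rightarrow> 'x) \<Rightarrow> ('g \<Rightarrow> complex) \<Rightarrow> 'x \<Rightarrow> 'x"
  where "integrated_rep \<mu> \<pi> f x = weak_integral \<mu> (\<lambda>s. f s *\<^sub>C \<pi> s x)"

definition twisted_convolution ::
    "'g::topological_group_add measure \<Rightarrow> ('g \<Rightarrow> 'g \<Rightarrow> complex) \<Rightarrow> ('g \<Rightarrow> complex) \<Rightarrow>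
      ('g \<Rightarrow> 'x::{complex_banach, second_countable_topology}) \<Rightarrow> 'g \<Rightarrow> 'x"
  where "twisted_convolution \<mu> \<sigma> f g t =
    (\<integral>s. (\<sigma> s (- s + t) * f s) *\<^sub>C g (- s + t) \<partial>\<mu>)"

text \<open>Elements of the Bochner space are handled through representatives. As the value space is
  separable, Borel measurability is strong measurability.\<close>

definition Lp_space ::
    "'g measure \<Rightarrow> real \<Rightarrow> ('g \<Rightarrow> 'x::{real_normed_vector, second_countable_topology}) set"
  where "Lp_space \<mu> p = {g \<in> borel_measurable \<mu>. integrable \<mu> (\<lambda>t. norm (g t) powr p)}"

definition Lp_norm :: "'g measure \<Rightarrow> real \<Rightarrow> ('g \<Rightarrow> 'x::real_normed_vector) \<Rightarrow> real"
  where "Lp_norm \<mu> p g = (\<integral>t. norm (g t) powr p \<partial>\<mu>) powr (1 / p)"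

text \<open>The operator norm takes values in $[0, \infty]$; it is \<open>\<infinity>\<close> exactly when \<open>C\<close> fails to
  map \<open>Lp_space\<close> boundedly into itself.\<close>

definition Lp_operator_norm ::
    "'g measure \<Rightarrow> real \<Rightarrow>
      (('g \<Rightarrow> 'x::{real_normed_vector, second_countable_topology}) \<Rightarrow> 'g \<Rightarrow> 'x) \<Rightarrow> ennreal"
  where "Lp_operator_norm \<mu> p C =
    Inf {ennreal K | K. 0 \<le> K \<and>
      (\<forall>g\<in>Lp_space \<mu> p. C g \<in> Lp_space \<mu> p \<and> Lp_norm \<mu> p (C g) \<le> K * Lp_norm \<mu> p g)}"

end

theory Submission
  imports Defs "HOL-Library.Function_Algebras"
begin

text \<open>
  This is Coifman--Weiss transference. For a nonnegative \<open>h\<close> of integral one put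
  \<open>g t = h t powr (1 / p) *\<^sub>R \<pi> (- t) x\<close>. The cocycle identity and the normalization give
  \<open>\<sigma> s (- s + t) = \<sigma> (- t) s\<close>, so the twisted convolution of \<open>f\<close> and \<open>g\<close> at \<open>t\<close> equals
  \<open>h t powr (1 / p) *\<^sub>R \<pi> (- t) y\<close>, with \<open>y\<close> the integrated representation at \<open>x\<close>, up to an error
  controlled by the integral of \<open>cmod (f s) * \<bar>h (- s + t) - h t\<bar>\<close>. Amenability makes this error small
  (Reiter's condition); comparing norms costs one factor \<open>M\<close> for \<open>g\<close> and one for \<open>y\<close>.

  Reiter's condition comes from the invariant mean by Hahn--Banach separation. To avoid the
  duality between $L^1$ and $L^\infty$, which is delicate when \<open>\<mu>\<close> is not \<open>\<sigma>\<close>-finite, the separating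
  functional is evaluated along the normalized right translates of one bump function; this gives
  a bounded continuous function on the group, to which the mean applies. Right translation
  invariance of the average then forces it to depend only on the integral of the bump, by
  uniqueness of the Haar functional.
\<close>

section \<open>Hahn--Banach separation\<close>

text \<open>The exponent \<open>1 / p\<close> gives \<open>g\<close> a p-norm of at most
  \<open>M * norm x\<close>; and since the p-th power of a difference of p-th roots is at most the
  difference of the original numbers, almost invariance of \<open>h\<close> in L^1 is all that the
  error needs. The error is split off by convexity instead of the triangle inequality in L^p: a
  parameter \<eta> costs the factor \<open>(1 - \<eta>) powr (1 - p)\<close>, which tends to 1. Two
  obstacles shape the rest. A left Haar measure need not be right invariant, so right translates are
  divided by a modular function, itself obtained from uniqueness of the Haar functional; that
  uniqueness is proved for signed functionals, because a separating functional has no sign. And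
  \<open>f\<close> is merely integrable, while separation handles finitely many group elements at a
  time: the candidate densities share a modulus of continuity, which leads to compact sets, and the
  tail of \<open>f\<close> off a compact set is estimated by the trivial bound 2. This uses that
  \<open>f\<close> is carried, up to a null set, by a sigma-compact set, which regularity
  supplies.\<close>

instantiation "fun" :: (type, real_vector) real_vector
begin

definition "scaleR_fun c f = (\<lambda>x. c *\<^sub>R f x)"

instance
  by standard (auto simp: scaleR_fun_def fun_eq_iff algebra_simps)

end

lemma scaleR_fun_apply [simp]: "(c *\<^sub>R f) x = c *\<^sub>R f x"
  by (simp add: scaleR_fun_def)

definition linear_form_on :: "'v::real_vector set \<Rightarrow> ('v \<Rightarrow> real) \<Rightarrow> bool"
  where "linear_form_on V l \<longleftrightarrow>
    (\<forall>u\<in>V. \<forall>v\<in>V. l (u + v) = l u + l v) \<and> (\<forall>c. \<forall>v\<in>V. l (c *\<^sub>R v) = c * l v)"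

definition sublinear_on :: "'v::real_vector set \<Rightarrow> ('v \<Rightarrow> real) \<Rightarrow> bool"
  where "sublinear_on V p \<longleftrightarrow>
    (\<forall>u\<in>V. \<forall>v\<in>V. p (u + v) \<le> p u + p v) \<and> (\<forall>c>0. \<forall>v\<in>V. p (c *\<^sub>R v) \<le> c * p v)"

lemma sublinear_on_scaleR:
  assumes "subspace V" "sublinear_on V p" "c > 0" "v \<in> V"
  shows "p (c *\<^sub>R v) = c * p v"
proof (rule antisym)
  show "p (c *\<^sub>R v) \<le> c * p v"
    using assms by (auto simp: sublinear_on_def)
  have "c *\<^sub>R v \<in> V"
    using assms by (simp add: subspace_scale)
  then have "p (inverse c *\<^sub>R (c *\<^sub>R v)) \<le> inverse c * p (c *\<^sub>R v)"
    using assms(2,3) by (metis sublinear_on_def positive_imp_inverse_positive)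
  then show "c * p v \<le> p (c *\<^sub>R v)"
    using assms(3) by (simp add: field_simps)
qed

lemma sublinear_on_0:
  assumes "subspace V" "sublinear_on V p"
  shows "p 0 = 0"
  using sublinear_on_scaleR[OF assms, of 2 0] subspace_0[OF assms(1)] by simp

lemma sublinear_on_neg:
  assumes "subspace V" "sublinear_on V p" "v \<in> V"
  shows "- p (- v) \<le> p v"
proof -
  have "p (v + - v) \<le> p v + p (- v)"
    using assms subspace_neg[OF assms(1,3)] unfolding sublinear_on_def by blast
  then show ?thesis
    using sublinear_on_0[OF assms(1,2)] by simp
qed

text \<open>In a chain, any two members \<open>r\<close> and \<open>s\<close> lie above a common
  member \<open>q\<close>, so \<open>q (u + v) \<le> r u + s v\<close>; the infima over
  \<open>r\<close> and over \<open>s\<close> can then be taken independently. For an arbitrary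
  family this argument breaks down.\<close>

lemma sublinear_on_Inf_chain:
  assumes V: "subspace V" and "C \<noteq> {}"
    and sub: "\<And>r. r \<in> C \<Longrightarrow> sublinear_on V r"
    and chain: "\<And>r s. r \<in> C \<Longrightarrow> s \<in> C \<Longrightarrow> r \<le> s \<or> s \<le> r"
    and bdd: "\<And>v. v \<in> V \<Longrightarrow> bdd_below ((\<lambda>r. r v) ` C)"
  shows "sublinear_on V (\<lambda>v. INF r\<in>C. r v)"
  unfolding sublinear_on_def
proof (intro conjI ballI allI impI)
  fix u v assume uv: "u \<in> V" "v \<in> V"
  have uv': "u + v \<in> V" using uv V by (simp add: subspace_add)
  have le: "(INF r\<in>C. r (u + v)) - s v \<le> r u" if rs: "r \<in> C" "s \<in> C" for r s
  proof -
    obtain q where q: "q \<in> C" "q \<le> r" "q \<le> s"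
      using chain[OF rs] rs by blast
    have "(INF r\<in>C. r (u + v)) \<le> q (u + v)"
      using bdd[OF uv'] q(1) by (intro cINF_lower)
    also have "\<dots> \<le> q u + q v"
      using sub[OF q(1)] uv by (auto simp: sublinear_on_def)
    also have "\<dots> \<le> r u + s v"
      using q by (auto simp: le_fun_def intro: add_mono)
    finally show ?thesis by simp
  qed
  have "(INF r\<in>C. r (u + v)) - s v \<le> (INF r\<in>C. r u)" if "s \<in> C" for s
    using \<open>C \<noteq> {}\<close> le that by (intro cINF_greatest) auto
  then have "(INF r\<in>C. r (u + v)) - (INF r\<in>C. r u) \<le> s v" if "s \<in> C" for s
    using that by (simp add: algebra_simps)
  then have "(INF r\<in>C. r (u + v)) - (INF r\<in>C. r u) \<le> (INF r\<in>C. r v)"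
    using \<open>C \<noteq> {}\<close> by (intro cINF_greatest) auto
  then show "(INF r\<in>C. r (u + v)) \<le> (INF r\<in>C. r u) + (INF r\<in>C. r v)" by simp
next
  fix c :: real and v assume c: "0 < c" and v: "v \<in> V"
  have "(INF r\<in>C. r (c *\<^sub>R v)) / c \<le> r v" if "r \<in> C" for r
  proof -
    have "(INF r\<in>C. r (c *\<^sub>R v)) \<le> r (c *\<^sub>R v)"
      using bdd[of "c *\<^sub>R v"] that v V by (intro cINF_lower) (auto simp: subspace_scale)
    also have "\<dots> = c * r v"
      using sublinear_on_scaleR[OF V sub[OF that] c v] .
    finally show ?thesis using c by (simp add: field_simps)
  qed
  then have "(INF r\<in>C. r (c *\<^sub>R v)) / c \<le> (INF r\<in>C. r v)"
    using \<open>C \<noteq> {}\<close> by (intro cINF_greatest)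
  then show "(INF r\<in>C. r (c *\<^sub>R v)) \<le> c * (INF r\<in>C. r v)"
    using c by (simp add: field_simps)
qed

text \<open>The parameter \<open>t = 0\<close> gives the bound by \<open>r v\<close>, and
  \<open>t = 1\<close> the bound by \<open>r (v + y) - r y\<close>. Subadditivity comes from adding
  parameters, and \<open>- r (- v)\<close> is a lower bound that keeps the infimum finite.\<close>

lemma sublinear_on_reduce:
  assumes V: "subspace V" and r: "sublinear_on V r" and y: "y \<in> V"
  defines "s \<equiv> \<lambda>v. INF t\<in>{0..}. r (v + t *\<^sub>R y) - t * r y"
  shows "sublinear_on V s" and "\<And>v. v \<in> V \<Longrightarrow> s v \<le> r v" and "\<And>v. v \<in> V \<Longrightarrow> s v \<le> r (v + y) - r y"
proof -
  have s_eq: "s v = (INF t\<in>{0..}. r (v + t *\<^sub>R y) - t * r y)" for v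
    by (simp add: s_def)
  have bdd: "bdd_below ((\<lambda>t. r (v + t *\<^sub>R y) - t * r y) ` {0..})" if v: "v \<in> V" for v
  proof (rule bdd_belowI2)
    fix t :: real assume "t \<in> {0..}"
    have "r (t *\<^sub>R y) = t * r y"
      using \<open>t \<in> {0..}\<close> sublinear_on_scaleR[OF V r _ y, of t] sublinear_on_0[OF V r]
      by (cases "t = 0") auto
    moreover have "r ((v + t *\<^sub>R y) + - v) \<le> r (v + t *\<^sub>R y) + r (- v)"
      using r V v y unfolding sublinear_on_def
      by (blast intro: subspace_add subspace_scale subspace_neg)
    ultimately show "- r (- v) \<le> r (v + t *\<^sub>R y) - t * r y" by simp
  qed
  have le: "s v \<le> r (v + t *\<^sub>R y) - t * r y" if "v \<in> V" "t \<ge> 0" for v t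
    unfolding s_def using bdd[OF that(1)] that(2) by (intro cINF_lower) auto
  show "\<And>v. v \<in> V \<Longrightarrow> s v \<le> r v" using le[of _ 0] by simp
  show "\<And>v. v \<in> V \<Longrightarrow> s v \<le> r (v + y) - r y" using le[of _ 1] by simp
  show "sublinear_on V s"
    unfolding sublinear_on_def
  proof (intro conjI ballI allI impI)
    fix u v assume uv: "u \<in> V" "v \<in> V"
    have le2: "s (u + v) - (r (v + t' *\<^sub>R y) - t' * r y) \<le> r (u + t *\<^sub>R y) - t * r y"
      if "t \<ge> 0" "t' \<ge> 0" for t t'
    proof -
      have "s (u + v) \<le> r ((u + v) + (t + t') *\<^sub>R y) - (t + t') * r y"
        using le[of "u + v" "t + t'"] uv V that by (auto simp: subspace_add)
      also have "(u + v) + (t + t') *\<^sub>R y = (u + t *\<^sub>R y) + (v + t' *\<^sub>R y)"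
        by (simp add: algebra_simps)
      also have "r \<dots> \<le> r (u + t *\<^sub>R y) + r (v + t' *\<^sub>R y)"
        using r V uv y unfolding sublinear_on_def by (blast intro: subspace_add subspace_scale)
      finally show ?thesis by (simp add: algebra_simps)
    qed
    have "s (u + v) - (r (v + t' *\<^sub>R y) - t' * r y) \<le> s u" if "t' \<ge> 0" for t'
      unfolding s_eq[of u] using le2 that by (intro cINF_greatest) auto
    then have "s (u + v) - s u \<le> r (v + t' *\<^sub>R y) - t' * r y" if "t' \<ge> 0" for t'
      using that by (simp add: algebra_simps)
    then have "s (u + v) - s u \<le> s v"
      unfolding s_eq[of v] by (intro cINF_greatest) auto
    then show "s (u + v) \<le> s u + s v" by simp
  next
    fix c :: real and v assume c: "0 < c" and v: "v \<in> V"
    have "s (c *\<^sub>R v) / c \<le> r (v + t *\<^sub>R y) - t * r y" if "t \<ge> 0" for t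
    proof -
      have "s (c *\<^sub>R v) \<le> r (c *\<^sub>R v + (c * t) *\<^sub>R y) - (c * t) * r y"
        using le[of "c *\<^sub>R v" "c * t"] v V c that by (simp add: subspace_scale)
      also have "c *\<^sub>R v + (c * t) *\<^sub>R y = c *\<^sub>R (v + t *\<^sub>R y)"
        by (simp add: algebra_simps)
      also have "r \<dots> = c * r (v + t *\<^sub>R y)"
        using V v y by (intro sublinear_on_scaleR[OF V r c] subspace_add subspace_scale)
      finally show ?thesis using c by (simp add: field_simps)
    qed
    then have "s (c *\<^sub>R v) / c \<le> s v"
      unfolding s_eq[of v] by (intro cINF_greatest) auto
    then show "s (c *\<^sub>R v) \<le> c * s v"
      using c by (simp add: field_simps)
  qed
qed

text \<open>A minimal sublinear functional is additive, because it cannot be lowered by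
  \<open>sublinear_on_reduce\<close>.\<close>

theorem Hahn_Banach_sublinear:
  fixes V :: "'v::real_vector set"
  assumes V: "subspace V" and p: "sublinear_on V p"
  obtains l where "linear_form_on V l" "\<And>v. v \<in> V \<Longrightarrow> l v \<le> p v"
proof -
  \<comment> \<open>Members vanish off \<open>V\<close>, so that the pointwise order on the whole
    type compares them on \<open>V\<close> alone.\<close>
  define A where "A = {r. sublinear_on V r \<and> (\<forall>v\<in>V. r v \<le> p v) \<and> (\<forall>v. v \<notin> V \<longrightarrow> r v = 0)}"
  have cong: "sublinear_on V r' \<longleftrightarrow> sublinear_on V r" if "\<And>v. v \<in> V \<Longrightarrow> r' v = r v" for r r' :: "'v \<Rightarrow> real"
    using that subspace_add[OF V] subspace_scale[OF V] unfolding sublinear_on_def by simp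
  have pA: "(\<lambda>v. if v \<in> V then p v else 0) \<in> A"
    unfolding A_def using p cong[of "\<lambda>v. if v \<in> V then p v else 0" p] by auto
  have "\<exists>m\<in>A. \<forall>a\<in>A. a \<le> m \<longrightarrow> a = m"
  proof (rule predicate_Zorn)
    \<comment> \<open>The order is reversed: the element found by Zorn's lemma is a minimal
      functional.\<close>
    show "partial_order_on A (relation_of (\<lambda>x y. y \<le> x) A)"
      by (rule partial_order_on_relation_ofI) auto
    fix C assume "C \<in> Chains (relation_of (\<lambda>x y. y \<le> x) A)"
    then have CA: "C \<subseteq> A" and chain: "\<And>r s. r \<in> C \<Longrightarrow> s \<in> C \<Longrightarrow> r \<le> s \<or> s \<le> r"
      by (auto simp: Chains_def relation_of_def)
    show "\<exists>u\<in>A. \<forall>a\<in>C. u \<le> a"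
    proof (cases "C = {}")
      case True
      then show ?thesis using pA by auto
    next
      case False
      define u where "u = (\<lambda>v. INF r\<in>C. r v)"
      have sub: "sublinear_on V r" and le: "\<And>v. v \<in> V \<Longrightarrow> r v \<le> p v"
        and off: "\<And>v. v \<notin> V \<Longrightarrow> r v = 0" if "r \<in> C" for r
        using that CA by (auto simp: A_def)
      have bdd: "bdd_below ((\<lambda>r. r v) ` C)" for v
      proof (cases "v \<in> V")
        case True
        \<comment> \<open>A minorant common to the whole chain:
          \<open>- p (- v) \<le> - r (- v) \<le> r v\<close>.\<close>
        have "- p (- v) \<le> r v" if "r \<in> C" for r
          using sublinear_on_neg[OF V sub[OF that] True] le[OF that, of "- v"] True V
          by (simp add: subspace_neg)
        then show ?thesis by (rule bdd_belowI2)
      next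
        case False
        then show ?thesis by (intro bdd_belowI2[of _ 0]) (metis off order_refl)
      qed
      have lower: "u v \<le> r v" if "r \<in> C" for r v
        unfolding u_def using bdd that by (rule cINF_lower)
      have "u \<in> A"
        unfolding A_def
      proof (safe)
        show "sublinear_on V u"
          unfolding u_def using V False sub chain bdd by (rule sublinear_on_Inf_chain)
        fix v assume "v \<in> V"
        obtain r where "r \<in> C" using False by blast
        then show "u v \<le> p v" using lower[of r v] le[of r v] \<open>v \<in> V\<close> by linarith
      next
        fix v assume "v \<notin> V"
        then have "(\<lambda>r. r v) ` C = {0}" using off False by force
        then show "u v = 0" unfolding u_def by simp
      qed
      then show ?thesis using lower by (auto simp: le_fun_def)
    qed
  qed
  then obtain r where r: "r \<in> A" and min: "\<And>a. a \<in> A \<Longrightarrow> a \<le> r \<Longrightarrow> a = r" by blast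
  have sub: "sublinear_on V r" and rp: "\<And>v. v \<in> V \<Longrightarrow> r v \<le> p v" and off: "\<And>v. v \<notin> V \<Longrightarrow> r v = 0"
    using r by (auto simp: A_def)
  have add: "r (v + y) = r v + r y" if v: "v \<in> V" and y: "y \<in> V" for v y
  proof -
    define s where "s = (\<lambda>v. INF t\<in>{0..}. r (v + t *\<^sub>R y) - t * r y)"
    define s' where "s' = (\<lambda>v. if v \<in> V then s v else 0)"
    have red: "sublinear_on V s" "\<And>v. v \<in> V \<Longrightarrow> s v \<le> r v" "\<And>v. v \<in> V \<Longrightarrow> s v \<le> r (v + y) - r y"
      using sublinear_on_reduce[OF V sub y] by (simp_all add: s_def)
    have "s v \<le> p v" if "v \<in> V" for v
      using red(2) rp that order_trans by blast
    moreover have "sublinear_on V s'"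
      using red(1) cong[of s' s] by (simp add: s'_def)
    ultimately have "s' \<in> A"
      by (auto simp: A_def s'_def)
    moreover have "s' \<le> r"
      using red(2) off by (auto simp: s'_def le_fun_def)
    ultimately have "s' = r" by (rule min)
    then have "r v \<le> r (v + y) - r y"
      using red(3)[OF v] v by (auto simp: s'_def)
    moreover have "r (v + y) \<le> r v + r y"
      using sub v y by (auto simp: sublinear_on_def)
    ultimately show ?thesis by simp
  qed
  have neg: "r (- v) = - r v" if "v \<in> V" for v
    using add[OF that, of "- v"] that V sublinear_on_0[OF V sub] by (simp add: subspace_neg)
  have "r (c *\<^sub>R v) = c * r v" if v: "v \<in> V" for c v
  proof -
    consider "c > 0" | "c = 0" | "- c > 0" by linarith
    then show ?thesis
    proof cases
      case 3
      then have "r (- c *\<^sub>R v) = - c * r v" by (rule sublinear_on_scaleR[OF V sub _ v])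
      then show ?thesis using neg[of "c *\<^sub>R v"] v V by (simp add: subspace_scale)
    qed (use sublinear_on_scaleR[OF V sub _ v] sublinear_on_0[OF V sub] in auto)
  qed
  then have "linear_form_on V r"
    using add by (auto simp: linear_form_on_def)
  then show thesis using rp that by blast
qed

text \<open>A form dominated by the infimum of \<open>q (v + t *\<^sub>R c) - t * \<delta>\<close>
  over \<open>t \<ge> 0\<close> and \<open>c \<in> C\<close> has both properties:
  \<open>t = 0\<close> bounds it by \<open>q\<close>, and \<open>v = - c\<close> with
  \<open>t = 1\<close> gives \<open>l (- c) \<le> - \<delta>\<close>. Convexity of \<open>C\<close>
  makes this infimum sublinear, and \<open>\<delta> \<le> q c\<close> makes it finite.\<close>

theorem Hahn_Banach_separation:
  fixes V :: "'v::real_vector set"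
  assumes V: "subspace V" and q: "sublinear_on V q" and q_neg: "\<And>v. v \<in> V \<Longrightarrow> q (- v) = q v"
    and C: "convex C" "C \<subseteq> V" "C \<noteq> {}" and \<delta>: "\<And>c. c \<in> C \<Longrightarrow> \<delta> \<le> q c"
  obtains l where "linear_form_on V l" "\<And>v. v \<in> V \<Longrightarrow> \<bar>l v\<bar> \<le> q v" "\<And>c. c \<in> C \<Longrightarrow> \<delta> \<le> l c"
proof -
  define P where "P = {0::real..} \<times> C"
  define F where "F = (\<lambda>v (t, c). q (v + t *\<^sub>R c) - t * \<delta>)"
  define p where "p = (\<lambda>v. INF x\<in>P. F v x)"
 have p_eq: "p v = (INF x\<in>P. F v x)" for v
    by (simp add: p_def)
  have Pne: "P \<noteq> {}" using C(3) by (auto simp: P_def)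
  have tc: "t *\<^sub>R c \<in> V" if "c \<in> C" for t c
    using that C(2) V by (auto intro: subspace_scale)
  have bdd: "bdd_below (F v ` P)" if v: "v \<in> V" for v
  proof (rule bdd_belowI2)
    fix x assume "x \<in> P"
    then obtain t c where x: "x = (t, c)" "t \<ge> 0" "c \<in> C" by (auto simp: P_def)
    have "t * \<delta> \<le> t * q c" using \<delta> x by (simp add: mult_left_mono)
    also have "\<dots> = q (t *\<^sub>R c)"
      using x C(2) sublinear_on_scaleR[OF V q, of t c] sublinear_on_0[OF V q] by (cases "t = 0") auto
    also have "\<dots> = q ((v + t *\<^sub>R c) + - v)" by simp
    also have "\<dots> \<le> q (v + t *\<^sub>R c) + q (- v)"
      using q V v tc[OF x(3)] unfolding sublinear_on_def by (blast intro: subspace_add subspace_neg)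
    finally show "- q v \<le> F v x" using q_neg[OF v] by (simp add: F_def x)
  qed
  have lower: "p v \<le> q (v + t *\<^sub>R c) - t * \<delta>" if "v \<in> V" "t \<ge> 0" "c \<in> C" for v t c
  proof -
    have "p v \<le> F v (t, c)"
      unfolding p_def using bdd[OF that(1)] that by (intro cINF_lower) (auto simp: P_def)
    then show ?thesis by (simp add: F_def)
  qed
  have "sublinear_on V p"
    unfolding sublinear_on_def
  proof (intro conjI ballI allI impI)
    fix u v assume uv: "u \<in> V" "v \<in> V"
    have *: "p (u + v) - F v y \<le> F u x" if "x \<in> P" "y \<in> P" for x y
    proof -
      obtain t c where x: "x = (t, c)" "t \<ge> 0" "c \<in> C" using \<open>x \<in> P\<close> by (auto simp: P_def)
      obtain t' c' where y: "y = (t', c')" "t' \<ge> 0" "c' \<in> C" using \<open>y \<in> P\<close> by (auto simp: P_def)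
      \<comment> \<open>The weighted mean of \<open>c\<close> and \<open>c'\<close> merges two pairs
        of \<open>P\<close> into one. If both weights vanish, any point of \<open>C\<close>
        serves.\<close>
      obtain d where d: "d \<in> C" "(t + t') *\<^sub>R d = t *\<^sub>R c + t' *\<^sub>R c'"
      proof (cases "t + t' = 0")
        case True
        then have "t = 0" "t' = 0" using x y by auto
        then show thesis using x y that[of c] by simp
      next
        case False
        define d where "d = (t / (t + t')) *\<^sub>R c + (t' / (t + t')) *\<^sub>R c'"
        have "d \<in> C" unfolding d_def
          using C(1) x y False by (intro convexD) (auto simp flip: add_divide_distrib)
        moreover have "(t + t') *\<^sub>R d = t *\<^sub>R c + t' *\<^sub>R c'"
          using False by (simp add: d_def scaleR_add_right)
        ultimately show thesis using that by blast
      qed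
      have "p (u + v) \<le> q ((u + v) + (t + t') *\<^sub>R d) - (t + t') * \<delta>"
        using uv V x y d by (intro lower) (auto simp: subspace_add)
      also have "(u + v) + (t + t') *\<^sub>R d = (u + t *\<^sub>R c) + (v + t' *\<^sub>R c')"
        unfolding d(2) by simp
      also have "q \<dots> \<le> q (u + t *\<^sub>R c) + q (v + t' *\<^sub>R c')"
        using q V uv tc x y unfolding sublinear_on_def by (blast intro: subspace_add)
      finally show ?thesis by (simp add: F_def x y algebra_simps)
    qed
    have "p (u + v) - F v y \<le> p u" if "y \<in> P" for y
      unfolding p_eq[of u] using * that Pne by (intro cINF_greatest) auto
    then have "p (u + v) - p u \<le> F v y" if "y \<in> P" for y
      using that by (simp add: algebra_simps)
    then have "p (u + v) - p u \<le> p v"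
      unfolding p_eq[of v] using Pne by (intro cINF_greatest) auto
    then show "p (u + v) \<le> p u + p v" by simp
  next
    fix k :: real and v assume k: "0 < k" and v: "v \<in> V"
    have "p (k *\<^sub>R v) / k \<le> F v x" if "x \<in> P" for x
    proof -
      obtain t c where x: "x = (t, c)" "t \<ge> 0" "c \<in> C" using \<open>x \<in> P\<close> by (auto simp: P_def)
      have "p (k *\<^sub>R v) \<le> q (k *\<^sub>R v + (k * t) *\<^sub>R c) - (k * t) * \<delta>"
        using v V k x by (intro lower) (auto simp: subspace_scale)
      also have "k *\<^sub>R v + (k * t) *\<^sub>R c = k *\<^sub>R (v + t *\<^sub>R c)" by (simp add: algebra_simps)
      also have "q \<dots> = k * q (v + t *\<^sub>R c)"
        using V v tc x by (intro sublinear_on_scaleR[OF V q k] subspace_add) auto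
      finally show ?thesis using k by (simp add: F_def x field_simps)
    qed
    then have "p (k *\<^sub>R v) / k \<le> p v"
      unfolding p_eq[of v] using Pne by (intro cINF_greatest) auto
    then show "p (k *\<^sub>R v) \<le> k * p v" using k by (simp add: field_simps)
  qed
  then obtain l where l: "linear_form_on V l" and lp: "\<And>v. v \<in> V \<Longrightarrow> l v \<le> p v"
    using Hahn_Banach_sublinear[OF V] by blast
  have neg: "l (- v) = - l v" if "v \<in> V" for v
    using l that unfolding linear_form_on_def
    by (metis mult_minus1 scaleR_minus1_left)
  obtain c0 where c0: "c0 \<in> C" using C(3) by blast
  have lq: "l v \<le> q v" if "v \<in> V" for v
    using lp[OF that] lower[OF that, of 0 c0] c0 by simp
  have "\<bar>l v\<bar> \<le> q v" if "v \<in> V" for v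
    using lq[OF that] lq[of "- v"] neg[OF that] q_neg[OF that] that V by (simp add: subspace_neg abs_le_iff)
  moreover have "\<delta> \<le> l c" if "c \<in> C" for c
  proof -
    have c: "c \<in> V" using that C(2) by blast
    have "- l c \<le> p (- c)" using lp[of "- c"] neg[OF c] c V by (simp add: subspace_neg)
    also have "\<dots> \<le> - \<delta>"
      using lower[of "- c" 1 c] c V that sublinear_on_0[OF V q] by (simp add: subspace_neg)
    finally show ?thesis by simp
  qed
  ultimately show thesis using l that by blast
qed

section \<open>Complex scalars and separation by complex functionals\<close>

lemma scaleC_scaleR_commute: "c *\<^sub>C r *\<^sub>R (x::'a::complex_banach) = r *\<^sub>R c *\<^sub>C x"
  by (metis mult.commute scaleC_of_real scaleC_scaleC)

lemma scaleC_minus_left: "(- c) *\<^sub>C (x::'a::complex_banach) = - (c *\<^sub>C x)"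
  by (metis mult_minus1 of_real_1 of_real_minus scaleC_of_real scaleC_scaleC scaleR_minus1_left)

lemma scaleC_one [simp]: "1 *\<^sub>C (x::'x::complex_banach) = x"
  using scaleC_of_real[of 1 x] by simp

lemma scaleC_Re_Im: "c *\<^sub>C (x::'x::complex_banach) = Re c *\<^sub>R x + Im c *\<^sub>R \<i> *\<^sub>C x"
  by (metis complex_eq mult.commute scaleC_add_left scaleC_of_real scaleC_scaleC)

text \<open>Complex functionals separate points, which makes weak integrals unique. A real
  functional with \<open>norm y \<le> l y\<close> is turned into a complex one by the
  Bohnenblust--Sobczyk formula: complex linearity forces the imaginary part at \<open>x\<close> to
  be \<open>- l (\<i> *\<^sub>C x)\<close>.\<close>

lemma complex_separation:
  fixes y :: "'x::complex_banach"
  assumes "y \<noteq> 0"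
  obtains \<phi> :: "'x \<Rightarrow> complex" where "bounded_clinear \<phi>" "\<phi> y \<noteq> 0"
proof -
  have "sublinear_on UNIV (norm :: 'x \<Rightarrow> real)"
    by (auto simp: sublinear_on_def norm_triangle_ineq)
  from Hahn_Banach_separation[OF subspace_UNIV this, of "{y}" "norm y"]
  obtain l where l: "linear_form_on UNIV l" "\<And>v::'x. \<bar>l v\<bar> \<le> norm v"
      and ly: "\<And>c. c \<in> {y} \<Longrightarrow> norm y \<le> l c"
    by auto
  define \<phi> where "\<phi> = (\<lambda>x. Complex (l x) (- l (\<i> *\<^sub>C x)))"
  have add: "l (u + v) = l u + l v" and sc: "l (r *\<^sub>R v) = r * l v" for u v r
    using l(1) by (auto simp: linear_form_on_def)
  have minus: "l (- v) = - l v" for v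
    using sc[of "-1" v] by simp
  have i2: "\<i> *\<^sub>C \<i> *\<^sub>C x = - x" for x :: 'x
    using scaleC_minus_left[of 1 x] scaleC_of_real[of 1 x] by (simp add: scaleC_scaleC)
  have "bounded_linear \<phi>"
  proof (rule bounded_linear_intro)
    show "\<phi> (x + z) = \<phi> x + \<phi> z" for x z
      by (simp add: \<phi>_def add scaleC_add_right complex_eq_iff)
    show "\<phi> (r *\<^sub>R x) = r *\<^sub>R \<phi> x" for r x
      by (simp add: \<phi>_def sc scaleC_scaleR_commute complex_eq_iff)
    \<comment> \<open>The factor 2 comes from bounding real and imaginary parts separately; only
      boundedness matters here.\<close>
    show "norm (\<phi> x) \<le> norm x * 2" for x
    proof -
      have "norm (\<phi> x) \<le> \<bar>l x\<bar> + \<bar>l (\<i> *\<^sub>C x)\<bar>"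
        using cmod_le[of "\<phi> x"] by (simp add: \<phi>_def)
      also have "\<dots> \<le> norm x + norm (\<i> *\<^sub>C x)"
        using l(2) by (intro add_mono)
      finally show ?thesis by (simp add: norm_scaleC)
    qed
  qed
  moreover have "\<phi> (c *\<^sub>C x) = c *\<^sub>C \<phi> x" for c x
  proof -
    have "\<i> *\<^sub>C c *\<^sub>C x = Re c *\<^sub>R \<i> *\<^sub>C x + Im c *\<^sub>R (- x)"
      by (simp add: scaleC_Re_Im[of c x] scaleC_add_right scaleC_scaleR_commute i2)
    then have "l (\<i> *\<^sub>C c *\<^sub>C x) = Re c * l (\<i> *\<^sub>C x) - Im c * l x"
      using add[of "Re c *\<^sub>R \<i> *\<^sub>C x" "Im c *\<^sub>R (- x)"] sc[of "Im c" "- x"] by (simp add: sc minus)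
    then show ?thesis
      by (simp add: \<phi>_def scaleC_Re_Im[of c x] add sc scaleC_complex_def complex_eq_iff)
  qed
  moreover have "\<phi> y \<noteq> 0"
  proof -
    have "0 < l y"
      using ly[of y] assms by (simp add: less_le_trans[of 0 "norm y"])
    then show ?thesis by (simp add: \<phi>_def complex_eq_iff)
  qed
  ultimately show thesis
    using that by (auto simp: bounded_clinear_def)
qed

section \<open>Continuous functions with compact support\<close>

lemma compact_uminus_image:
  fixes K :: "'g::topological_group_add set"
  shows "compact K \<Longrightarrow> compact (uminus ` K)"
  by (rule compact_continuous_image) (intro continuous_intros)

lemma compact_sum_image:
  fixes K L :: "'g::topological_group_add set"
  assumes "compact K" "compact L"
  shows "compact ((\<lambda>(x, y). x + y) ` (K \<times> L))"
  by (rule compact_continuous_image)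
     (auto simp: split_beta intro!: continuous_intros compact_Times assms)

definition Cc :: "('g::topological_space \<Rightarrow> real) set"
  where "Cc = {v. continuous_on UNIV v \<and> (\<exists>K. compact K \<and> (\<forall>t. t \<notin> K \<longrightarrow> v t = 0))}"

lemma CcI: "continuous_on UNIV v \<Longrightarrow> compact K \<Longrightarrow> (\<And>t. t \<notin> K \<Longrightarrow> v t = 0) \<Longrightarrow> v \<in> Cc"
  by (auto simp: Cc_def)

lemma CcE:
  assumes "v \<in> Cc"
  obtains K where "compact K" "\<And>t. t \<notin> K \<Longrightarrow> v t = 0"
  using assms by (auto simp: Cc_def)

lemma Cc_continuous: "v \<in> Cc \<Longrightarrow> continuous_on UNIV v"
  by (simp add: Cc_def)

lemma Cc_bounded:
  assumes "v \<in> Cc"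
  obtains B where "0 < B" "\<And>t. \<bar>v t\<bar> \<le> B"
proof -
  obtain K where K: "compact K" "\<And>t. t \<notin> K \<Longrightarrow> v t = 0" using assms by (rule CcE) blast
  have "compact (v ` K)"
    using K(1) Cc_continuous[OF assms] by (blast intro: compact_continuous_image continuous_on_subset)
  then obtain B where B: "0 < B" "\<And>t. t \<in> K \<Longrightarrow> \<bar>v t\<bar> \<le> B"
    using compact_imp_bounded[of "v ` K"] by (auto simp: bounded_pos)
  then have "\<bar>v t\<bar> \<le> B" for t using K(2)[of t] by (cases "t \<in> K") auto
  then show thesis using B(1) that by blast
qed

lemma Cc_zero: "(\<lambda>_. 0) \<in> Cc"
  by (rule CcI[of _ "{}"]) auto

lemma Cc_mult:
  assumes "v \<in> Cc" "continuous_on UNIV w"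
  shows "(\<lambda>t. w t * v t) \<in> Cc"
proof -
  obtain K where K: "compact K" "\<And>t. t \<notin> K \<Longrightarrow> v t = 0" using assms(1) by (rule CcE) blast
  show ?thesis
    by (rule CcI[OF _ K(1)]) (auto intro!: continuous_intros assms(2) Cc_continuous[OF assms(1)] simp: K)
qed

lemma Cc_scale: "v \<in> Cc \<Longrightarrow> (\<lambda>t. c * v t) \<in> Cc"
  by (rule Cc_mult) auto

lemma Cc_add:
  assumes "v \<in> Cc" "w \<in> Cc"
  shows "(\<lambda>t. v t + w t) \<in> Cc"
proof -
  obtain K where K: "compact K" "\<And>t. t \<notin> K \<Longrightarrow> v t = 0" using assms(1) by (rule CcE) blast
  obtain L where L: "compact L" "\<And>t. t \<notin> L \<Longrightarrow> w t = 0" using assms(2) by (rule CcE) blast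
  show ?thesis
    by (rule CcI[OF _ compact_Un[OF K(1) L(1)]])
       (auto intro!: continuous_intros assms[THEN Cc_continuous] simp: K L)
qed

lemma Cc_diff: "v \<in> Cc \<Longrightarrow> w \<in> Cc \<Longrightarrow> (\<lambda>t. v t - w t) \<in> Cc"
  using Cc_add[OF _ Cc_scale[of w "-1"]] by simp

lemma Cc_sum: "(\<And>i. i \<in> I \<Longrightarrow> v i \<in> Cc) \<Longrightarrow> (\<lambda>t. \<Sum>i\<in>I. v i t) \<in> Cc"
  by (induction I rule: infinite_finite_induct) (auto intro: Cc_zero Cc_add)

lemma Cc_abs: 
  assumes "v \<in> Cc" shows "(\<lambda>t. \<bar>v t\<bar>) \<in> Cc"
proof -
  obtain K where K: "compact K" "\<And>t. t \<notin> K \<Longrightarrow> v t = 0" using assms(1) by (rule CcE) blast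
  show ?thesis
    by (rule CcI[OF _ K(1)]) (auto intro!: continuous_intros assms[THEN Cc_continuous] simp: K)
qed

lemma Cc_compose:
  assumes v: "v \<in> Cc" and g: "continuous_on UNIV g" "continuous_on UNIV h" "\<And>t. h (g t) = t"
  shows "(\<lambda>t. v (g t)) \<in> Cc"
proof -
  obtain K where K: "compact K" "\<And>t. t \<notin> K \<Longrightarrow> v t = 0" using v by (rule CcE) blast
  have "compact (h ` K)"
    using K(1) g(2) by (blast intro: compact_continuous_image continuous_on_subset)
  moreover have "continuous_on UNIV (\<lambda>t. v (g t))"
    by (rule continuous_on_compose2[OF Cc_continuous[OF v] g(1)]) auto
  moreover have "v (g t) = 0" if "t \<notin> h ` K" for t
    using that g(3)[of t] K(2)[of "g t"] by (metis image_eqI)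
  ultimately show ?thesis by (intro CcI)
qed

lemma Cc_translate_left:
  fixes v :: "'g::topological_group_add \<Rightarrow> real"
  shows "v \<in> Cc \<Longrightarrow> (\<lambda>t. v (s + t)) \<in> Cc"
  by (rule Cc_compose[where h = "\<lambda>t. - s + t"]) (auto intro!: continuous_intros simp: add.assoc[symmetric])

lemma Cc_translate_right:
  fixes v :: "'g::topological_group_add \<Rightarrow> real"
  shows "v \<in> Cc \<Longrightarrow> (\<lambda>t. v (t + s)) \<in> Cc"
  by (rule Cc_compose[where h = "\<lambda>t. t - s"]) (auto intro!: continuous_intros)

lemma Cc_reflect:
  fixes v :: "'g::topological_group_add \<Rightarrow> real"
  shows "v \<in> Cc \<Longrightarrow> (\<lambda>t. v (- t)) \<in> Cc"
  by (rule Cc_compose[where h = "\<lambda>t. - t"]) (auto intro!: continuous_intros)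

section \<open>Uniformity over compact sets and finite Borel partitions\<close>

text \<open>A tube lemma: joint continuity is uniform along the compact set \<open>L\<close>, and
  off \<open>L\<close> both values vanish.\<close>

lemma uniformly_small_near:
  fixes F :: "'a::topological_space \<Rightarrow> 'b::topological_space \<Rightarrow> real"
  assumes F: "continuous_on UNIV (\<lambda>(s, t). F s t)"
    and N: "open N" "s0 \<in> N" and L: "compact L"
    and supp: "\<And>s t. s \<in> N \<Longrightarrow> t \<notin> L \<Longrightarrow> F s t = 0" and e: "0 < e"
  obtains U where "open U" "s0 \<in> U" "U \<subseteq> N" "\<And>s t. s \<in> U \<Longrightarrow> \<bar>F s t - F s0 t\<bar> \<le> e"
proof -
  obtain X where X: "s0 \<in> X" "open X"
      "\<forall>s\<in>X \<inter> UNIV. \<forall>t\<in>L. dist (case (s, t) of (s, t) \<Rightarrow> F s t) (case (s0, t) of (s, t) \<Rightarrow> F s t) \<le> e"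
    by (rule continuous_on_prod_compactE[OF continuous_on_subset[OF F] L, of UNIV s0 e]) (use e in auto)
  have "\<bar>F s t - F s0 t\<bar> \<le> e" if "s \<in> X \<inter> N" for s t
    using X(3) that e supp[of s t] supp[of s0 t] N(2) by (cases "t \<in> L") (auto simp: dist_real_def)
  then show thesis
    using that[of "X \<inter> N"] X N by auto
qed

text \<open>A finite subcover is made disjoint. The partition carries Riemann sums that stand in for
  product measures. The point \<open>x i\<close> need not belong to \<open>A i\<close>; it only
  labels the neighbourhood containing \<open>A i\<close>.\<close>

lemma compact_Borel_partition:
  fixes K :: "'a::t2_space set"
  assumes K: "compact K" and U: "\<And>x. x \<in> K \<Longrightarrow> open (U x) \<and> x \<in> U x"
  obtains n :: nat and x A where "\<And>i. i < n \<Longrightarrow> x i \<in> K" "\<And>i. i < n \<Longrightarrow> A i \<in> sets borel"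
    "\<And>i. i < n \<Longrightarrow> A i \<subseteq> U (x i)" "disjoint_family_on A {..<n}" "(\<Union>i<n. A i) = K"
proof -
  obtain F where F: "finite F" "F \<subseteq> K" "K \<subseteq> (\<Union>x\<in>F. U x)"
  proof (rule compactE_image[OF K, of K U])
    show "open (U x)" if "x \<in> K" for x using U that by blast
    show "K \<subseteq> (\<Union>x\<in>K. U x)" using U by blast
  qed
  obtain x where x: "F = x ` {..<card F}" "inj_on x {..<card F}"
    using ex_bij_betw_nat_finite[OF F(1)] by (auto simp: bij_betw_def atLeast0LessThan)
  define B where "B i = (if i < card F then U (x i) \<inter> K else {})" for i
  have B: "B i \<in> sets borel" for i
  proof (cases "i < card F")
    case True
    then have "x i \<in> F" by (subst x(1)) simp
    then have "open (U (x i))" using U F(2) by blast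
    then show ?thesis using compact_imp_closed[OF K] by (auto simp: B_def)
  qed (auto simp: B_def)
  have dis: "disjointed B i \<subseteq> B i" for i by (rule disjointed_subset)
  have "(\<Union>i<card F. disjointed B i) = K"
  proof
    show "(\<Union>i<card F. disjointed B i) \<subseteq> K"
    proof
      fix y assume "y \<in> (\<Union>i<card F. disjointed B i)"
      then obtain i where "i < card F" "y \<in> B i" using dis by blast
      then show "y \<in> K" by (simp add: B_def)
    qed
    have "K \<subseteq> (\<Union>i. B i)"
    proof
      fix y assume y: "y \<in> K"
      then have "y \<in> (\<Union>z\<in>x ` {..<card F}. U z)" using F(3) x(1) by auto
      then obtain i where "i < card F" "y \<in> U (x i)" by blast
      then show "y \<in> (\<Union>i. B i)" using y by (auto simp: B_def intro!: exI[of _ i])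
    qed
    also have "\<dots> = (\<Union>i. disjointed B i)" by (rule UN_disjointed_eq[symmetric])
    also have "\<dots> \<subseteq> (\<Union>i<card F. disjointed B i)"
    proof
      fix y assume "y \<in> (\<Union>i. disjointed B i)"
      then obtain i where i: "y \<in> disjointed B i" by blast
      then have "y \<in> B i" using dis by blast
      then have "i < card F" by (simp add: B_def split: if_splits)
      then show "y \<in> (\<Union>i<card F. disjointed B i)" using i by blast
    qed
    finally show "K \<subseteq> (\<Union>i<card F. disjointed B i)" .
  qed
  moreover have "disjointed B i \<in> sets borel" for i
    using sets.range_disjointed_sets[of B borel] B by auto
  moreover have "disjointed B i \<subseteq> U (x i)" if "i < card F" for i
    using dis[of i] that by (auto simp: B_def)
  moreover have "disjoint_family_on (disjointed B) {..<card F}"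
    using disjoint_family_disjointed[of B] by (auto simp: disjoint_family_on_def)
  moreover have "x i \<in> K" if "i < card F" for i proof -
    have "x i \<in> F" using that by (subst x(1)) simp
    then show ?thesis using F(2) by blast
  qed
  ultimately show thesis by (intro that[of "card F" x "disjointed B"])
qed

lemma Hausdorff_space_t2: "Hausdorff_space (euclidean :: 'a::t2_space topology)"
  unfolding Hausdorff_space_def disjnt_def
proof (intro allI impI)
  fix x y :: 'a
  assume "x \<in> topspace euclidean \<and> y \<in> topspace euclidean \<and> x \<noteq> y"
  then show "\<exists>U V. openin euclidean U \<and> openin euclidean V \<and> x \<in> U \<and> y \<in> V \<and> U \<inter> V = {}"
    using hausdorff[of x y] by (simp flip: open_openin)
qed

lemma continuous_realI:
  fixes g :: "'a::topological_space \<Rightarrow> real"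
  assumes C: "0 \<le> C" and g: "\<And>x e. 0 < e \<Longrightarrow> \<exists>U. open U \<and> x \<in> U \<and> (\<forall>y\<in>U. \<bar>g y - g x\<bar> \<le> C * e)"
  shows "continuous_on UNIV g"
  unfolding continuous_on_def
proof (intro ballI tendstoI)
  fix x and e :: real assume e: "0 < e"
  \<comment> \<open>The \<open>+ 1\<close> keeps the denominator positive for \<open>C = 0\<close>
    and makes \<open>C * d < e\<close> strict.\<close>
  define d where "d = e / (C + 1)"
  have "0 < d" using e C by (simp add: d_def)
  then obtain U where U: "open U" "x \<in> U" "\<forall>y\<in>U. \<bar>g y - g x\<bar> \<le> C * d"
    using g by blast
  have "C * d < e" using C e by (simp add: d_def field_simps)
  then have "dist (g y) (g x) < e" if "y \<in> U" for y
    using bspec[OF U(3) that] by (simp add: dist_real_def)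
  then show "\<forall>\<^sub>F y in at x within UNIV. dist (g y) (g x) < e"
    unfolding eventually_at_topological using U(1,2) by blast
qed

lemma eq_zero_if_abs_le_mult:
  fixes x C :: real
  assumes "\<And>e. 0 < e \<Longrightarrow> \<bar>x\<bar> \<le> C * e"
  shows "x = 0"
proof (rule ccontr)
  assume "x \<noteq> 0"
  define e where "e = \<bar>x\<bar> / (2 * (\<bar>C\<bar> + 1))"
  have e: "0 < e" using \<open>x \<noteq> 0\<close> by (simp add: e_def)
  have "\<bar>x\<bar> \<le> C * e" using e by (rule assms)
  also have "\<dots> \<le> (\<bar>C\<bar> + 1) * e" using e by (intro mult_right_mono) auto
  also have "\<dots> = \<bar>x\<bar> / 2" by (simp add: e_def field_simps)
  finally show False using \<open>x \<noteq> 0\<close> by simp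
qed

section \<open>Bump functions on locally compact Hausdorff spaces\<close>

lemma locally_compact_nhd:
  fixes x :: "'g::t2_space"
  assumes "locally_compact_space (euclidean :: 'g topology)" "open W" "x \<in> W"
  obtains U K where "open U" "compact K" "x \<in> U" "U \<subseteq> K" "K \<subseteq> W"
proof -
  have *: "neighbourhood_base_of (\<lambda>C. compactin euclidean C \<and> closedin euclidean C) (euclidean :: 'g topology)"
    using assms(1) by (subst locally_compact_space_neighbourhood_base_closedin[symmetric]) (auto simp: Hausdorff_space_t2)
  have "\<exists>U V. openin euclidean U \<and> (compactin euclidean V \<and> closedin euclidean V) \<and> x \<in> U \<and> U \<subseteq> V \<and> V \<subseteq> W"
    by (rule *[unfolded neighbourhood_base_of, rule_format]) (use assms(2,3) in auto)
  then obtain U K where "openin euclidean U" "compactin euclidean K" "x \<in> U" "U \<subseteq> K" "K \<subseteq> W"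
    by blast
  then show thesis
    using that by simp
qed

text \<open>Complete regularity separates \<open>x\<close> from the complement of an open
  \<open>U\<close> contained in a compact \<open>K\<close>; one minus the separating function is the
  bump.\<close>

lemma locally_compact_bump:
  fixes x :: "'g::t2_space"
  assumes lc: "locally_compact_space (euclidean :: 'g topology)" and W: "open W" "x \<in> W"
  obtains u K where "u \<in> Cc" "\<And>t. 0 \<le> u t" "u x = 1" "compact K" "K \<subseteq> W" "\<And>t. t \<notin> K \<Longrightarrow> u t = 0"
proof -
  obtain U K where UK: "open U" "compact K" "x \<in> U" "U \<subseteq> K" "K \<subseteq> W"
    using locally_compact_nhd[OF lc W] .
  have "completely_regular_space (euclidean :: 'g topology)"
    using lc by (intro locally_compact_regular_imp_completely_regular_space) (auto simp: Hausdorff_space_t2)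
  moreover have "closedin (euclidean :: 'g topology) (- U)" "x \<in> topspace euclidean - (- U)"
    using UK by auto
  ultimately obtain f :: "'g \<Rightarrow> real" where f: "continuous_map euclidean (top_of_set {0..1}) f" "f x = 0" "f ` (- U) \<subseteq> {1}"
    unfolding completely_regular_space_def by meson
  have cont: "continuous_on UNIV f" and rng: "\<And>t. f t \<in> {0..1}"
    using f(1) by (auto simp: continuous_map_in_subtopology)
  have zero: "1 - f t = 0" if "t \<notin> K" for t
    using f(3) that UK(4) by auto
  have "(\<lambda>t. 1 - f t) \<in> Cc"
    using UK(2) zero by (intro CcI[of _ K]) (auto intro!: continuous_intros cont)
  then show thesis
    using that[of "\<lambda>t. 1 - f t" K] rng UK f(2) zero by auto
qed

lemma locally_compact_symmetric_bump:
  fixes W :: "'g::{topological_group_add, t2_space} set"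
  assumes lc: "locally_compact_space (euclidean :: 'g topology)" and W: "open W" "0 \<in> W"
  obtains u K where "u \<in> Cc" "\<And>t. 0 \<le> u t" "u 0 = 1" "compact K" "K \<subseteq> W" "\<And>t. t \<notin> K \<Longrightarrow> u t = 0"
    "\<And>t. u (- t) = u t"
proof -
  obtain u K where u: "u \<in> Cc" "\<And>t. 0 \<le> u t" "u 0 = 1" "compact K" "K \<subseteq> W" "\<And>t. t \<notin> K \<Longrightarrow> u t = 0"
    by (rule locally_compact_bump[OF lc W]) blast
  \<comment> \<open>Multiplying by the reflection symmetrizes the bump without enlarging the set
    \<open>K\<close> off which it vanishes, and keeps the value 1 at \<open>0\<close>.\<close>
  have "(\<lambda>t. u (- t) * u t) \<in> Cc"
    using u(1) by (intro Cc_mult Cc_continuous[OF Cc_reflect])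
  then show thesis
    using that[of "\<lambda>t. u (- t) * u t" K] u by (auto simp: mult.commute)
qed

section \<open>Uniqueness of the Haar functional\<close>

text \<open>These are the signed Radon measures, viewed as linear functionals on \<open>Cc\<close>
  that are continuous for the inductive limit topology: the bound may depend on the compact set
  \<open>L\<close>.\<close>

definition local_functional :: "(('g::topological_space \<Rightarrow> real) \<Rightarrow> real) \<Rightarrow> bool"
  where "local_functional J \<longleftrightarrow>
    (\<forall>u\<in>Cc. \<forall>v\<in>Cc. J (\<lambda>t. u t + v t) = J u + J v) \<and>
    (\<forall>c. \<forall>u\<in>Cc. J (\<lambda>t. c * u t) = c * J u) \<and>
    (\<forall>L. compact L \<longrightarrow> (\<exists>C\<ge>0. \<forall>u B. continuous_on UNIV u \<longrightarrow>
      (\<forall>t. t \<notin> L \<longrightarrow> u t = 0) \<longrightarrow> (\<forall>t. \<bar>u t\<bar> \<le> B) \<longrightarrow> \<bar>J u\<bar> \<le> C * B))"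

lemma local_functional_add: "local_functional J \<Longrightarrow> u \<in> Cc \<Longrightarrow> v \<in> Cc \<Longrightarrow> J (\<lambda>t. u t + v t) = J u + J v"
  and local_functional_scale: "local_functional J \<Longrightarrow> u \<in> Cc \<Longrightarrow> J (\<lambda>t. c * u t) = c * J u"
  by (auto simp: local_functional_def)

lemma local_functional_diff:
  assumes "local_functional J" "u \<in> Cc" "v \<in> Cc"
  shows "J (\<lambda>t. u t - v t) = J u - J v"
  using local_functional_add[OF assms(1,2) Cc_scale[OF assms(3), of "-1"]]
    local_functional_scale[OF assms(1,3), of "-1"] by simp

lemma local_functional_sum:
  assumes "local_functional J" "\<And>i. i \<in> I \<Longrightarrow> u i \<in> Cc"
  shows "J (\<lambda>t. \<Sum>i\<in>I. c i * u i t) = (\<Sum>i\<in>I. c i * J (u i))"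
  using assms(2)
proof (induction I rule: infinite_finite_induct)
  case (insert i I)
  then show ?case
    using local_functional_add[OF assms(1) Cc_scale[of "u i" "c i"] Cc_sum[of I "\<lambda>j t. c j * u j t"]]
    by (simp add: local_functional_scale[OF assms(1)] Cc_scale)
qed (use local_functional_scale[OF assms(1) Cc_zero, of 0] in simp_all)

lemma local_functional_bound:
  assumes "local_functional J" "compact L"
  obtains C where "0 \<le> C" "\<And>u B. continuous_on UNIV u \<Longrightarrow> (\<And>t. t \<notin> L \<Longrightarrow> u t = 0) \<Longrightarrow>
    (\<And>t. \<bar>u t\<bar> \<le> B) \<Longrightarrow> \<bar>J u\<bar> \<le> C * B"
proof -
  obtain C where "0 \<le> C" "\<forall>u B. continuous_on UNIV u \<longrightarrow>
      (\<forall>t. t \<notin> L \<longrightarrow> u t = 0) \<longrightarrow> (\<forall>t. \<bar>u t\<bar> \<le> B) \<longrightarrow> \<bar>J u\<bar> \<le> C * B"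
    using assms unfolding local_functional_def by blast
  then show thesis using that by blast
qed

locale haar_measure =
  fixes \<mu> :: "'g::{topological_group_add, t2_space} measure"
  assumes haar: "left_haar_measure \<mu>"
    and locally_compact: "locally_compact_space (euclidean :: 'g topology)"
begin

lemma sets_haar [measurable_cong, simp]: "sets \<mu> = sets borel"
  using haar by (simp add: left_haar_measure_def)

lemma space_haar [simp]: "space \<mu> = UNIV"
  using sets_eq_imp_space_eq[OF sets_haar] by simp

lemma borel_measurable_haar [simp]: "borel_measurable \<mu> = borel_measurable borel"
  by (rule measurable_cong_sets) simp_all

lemma emeasure_compact: "compact K \<Longrightarrow> emeasure \<mu> K < \<infinity>"
  using haar by (simp add: left_haar_measure_def)

lemma borel_compact: "compact K \<Longrightarrow> K \<in> sets (borel :: 'g measure)"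
  by (simp add: borel_closed compact_imp_closed)

lemma measurable_translate [measurable]: "(+) s \<in> borel_measurable (borel :: 'g measure)"
  by (intro borel_measurable_continuous_onI continuous_intros)

lemma distr_translate: "distr \<mu> \<mu> ((+) s) = \<mu>"
proof (rule measure_eqI)
  fix A assume "A \<in> sets (distr \<mu> \<mu> ((+) s))"
  then have A: "A \<in> sets borel" by simp
  have "(+) s -` A = (+) (- s) ` A"
  proof
    show "(+) s -` A \<subseteq> (+) (- s) ` A"
    proof
      fix x assume "x \<in> (+) s -` A"
      then show "x \<in> (+) (- s) ` A" by (intro image_eqI[of _ _ "s + x"]) (auto simp: add.assoc[symmetric])
    qed
  qed (auto simp: add.assoc[symmetric])
  then have "emeasure \<mu> ((+) s -` A) = emeasure \<mu> A"
    using haar A by (simp add: left_haar_measure_def)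
  then show "emeasure (distr \<mu> \<mu> ((+) s)) A = emeasure \<mu> A"
    using A by (subst emeasure_distr) auto
qed simp

lemma integral_translate:
  fixes f :: "'g \<Rightarrow> real"
  assumes "f \<in> borel_measurable borel"
  shows "(\<integral>t. f (s + t) \<partial>\<mu>) = (\<integral>t. f t \<partial>\<mu>)"
  using assms by (subst (2) distr_translate[of s, symmetric], subst integral_distr) simp_all

lemma Cc_measurable: "v \<in> Cc \<Longrightarrow> v \<in> borel_measurable (borel :: 'g measure)"
  by (intro borel_measurable_continuous_onI Cc_continuous)

lemma integrable_indicator_compact: "compact K \<Longrightarrow> integrable \<mu> (indicator K :: 'g \<Rightarrow> real)"
  by (auto intro!: integrable_real_indicator borel_compact emeasure_compact)

lemma integral_abs_le:
  fixes v :: "'g \<Rightarrow> real"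
  assumes K: "compact K" and v: "v \<in> borel_measurable borel"
    and "\<And>t. \<bar>v t\<bar> \<le> B * indicator K t"
  shows "integrable \<mu> v" "(\<integral>t. \<bar>v t\<bar> \<partial>\<mu>) \<le> B * measure \<mu> K"
proof -
  have iB: "integrable \<mu> (\<lambda>t. B * indicator K t :: real)"
    using integrable_indicator_compact[OF K] by simp
  show i: "integrable \<mu> v"
    by (rule Bochner_Integration.integrable_bound[OF iB])
       (use v assms(3) in \<open>auto simp: order_trans[OF _ abs_ge_self]\<close>)
  have "(\<integral>t. \<bar>v t\<bar> \<partial>\<mu>) \<le> (\<integral>t. B * indicator K t \<partial>\<mu>)"
    using i iB assms(3) by (intro integral_mono) auto
  then show "(\<integral>t. \<bar>v t\<bar> \<partial>\<mu>) \<le> B * measure \<mu> K"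
    by simp
qed

lemma Cc_abs_le_indicator:
  fixes v :: "'g \<Rightarrow> real"
  assumes "\<And>t. \<bar>v t\<bar> \<le> B" "\<And>t. t \<notin> K \<Longrightarrow> v t = 0"
  shows "\<bar>v t\<bar> \<le> B * indicator K t"
  using assms(1)[of t] assms(2)[of t] by (auto simp: indicator_def)

lemma Cc_integrable: 
  fixes v :: "'g \<Rightarrow> real"
  assumes "v \<in> Cc" shows "integrable \<mu> v"
proof -
  obtain K where K: "compact K" "\<And>t. t \<notin> K \<Longrightarrow> v t = 0" using assms by (rule CcE) blast
  obtain B where B: "\<And>t. \<bar>v t\<bar> \<le> B" using assms by (rule Cc_bounded) blast
  show ?thesis
    by (rule integral_abs_le(1)[OF K(1) Cc_measurable[OF assms], of B], rule Cc_abs_le_indicator) (use B K(2) in auto)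
qed

text \<open>Finitely many translates of a nonempty open set cover a given compact set. If the open
  set were null, all compact sets would be null, and by inner regularity so would the group.\<close>

lemma emeasure_open_pos:
  assumes U: "open U" "U \<noteq> {}"
  shows "emeasure \<mu> U \<noteq> 0"
proof
  assume 0: "emeasure \<mu> U = 0"
  obtain u where u: "u \<in> U" using U by blast
  \<comment> \<open>A translate of \<open>U\<close> containing \<open>s\<close>, because
    \<open>u - s + s = u \<in> U\<close>.\<close>
  define T where "T = (\<lambda>s. (+) (u - s) -` U)"
  have T: "open (T s)" "s \<in> T s" "T s \<in> null_sets \<mu>" for s
  proof -
    show "open (T s)"
      unfolding T_def using U(1) by (intro open_vimage continuous_intros)
    show "s \<in> T s" using u by (simp add: T_def)
    have "emeasure (distr \<mu> \<mu> ((+) (u - s))) U = 0"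
      using 0 by (simp add: distr_translate)
    then have "emeasure \<mu> (T s) = 0"
      using U(1) by (subst (asm) emeasure_distr) (auto simp: T_def)
    then show "T s \<in> null_sets \<mu>"
      using \<open>open (T s)\<close> by (auto simp: null_sets_def)
  qed
  have "emeasure \<mu> K = 0" if K: "compact K" for K
  proof -
    obtain F where F: "finite F" "K \<subseteq> (\<Union>s\<in>F. T s)"
      by (rule compactE_image[OF K, of K T]) (use T in auto)
    have "(\<Union>s\<in>F. T s) \<in> null_sets \<mu>"
      using F(1) T(3) by (intro null_sets_UN') (auto intro: countable_finite)
    then have "K \<in> null_sets \<mu>"
      using F(2) by (intro null_sets_subset[of _ _ K]) (simp_all add: borel_compact K)
    then show ?thesis by auto
  qed
  then have "(SUP K\<in>{K. compact K \<and> K \<subseteq> (UNIV :: 'g set)}. emeasure \<mu> K) = 0"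
    by (auto intro!: antisym SUP_least)
  moreover have "emeasure \<mu> UNIV = (SUP K\<in>{K. compact K \<and> K \<subseteq> (UNIV :: 'g set)}. emeasure \<mu> K)"
    using haar unfolding left_haar_measure_def by blast
  ultimately show False
    using haar by (simp add: left_haar_measure_def)
qed

lemma integral_pos:
  fixes v :: "'g \<Rightarrow> real"
  assumes v: "v \<in> Cc" "\<And>t. 0 \<le> v t" "0 < v x"
  shows "0 < (\<integral>t. v t \<partial>\<mu>)"
proof -
  have op: "open {t. 0 < v t}"
    using Cc_continuous[OF v(1)] by (intro open_Collect_less continuous_intros)
  have "(\<integral>t. v t \<partial>\<mu>) \<noteq> 0"
  proof
    assume "(\<integral>t. v t \<partial>\<mu>) = 0"
    then have "AE t in \<mu>. v t = 0"
      using integral_nonneg_eq_0_iff_AE[OF Cc_integrable[OF v(1)]] v(2) by simp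
    then have "emeasure \<mu> {t. 0 < v t} = 0"
      using op by (subst (asm) AE_iff_measurable[of "{t. 0 < v t}"]) (auto simp: less_le v(2))
    then show False
      using emeasure_open_pos[OF op] v(3) by auto
  qed
  moreover have "0 \<le> (\<integral>t. v t \<partial>\<mu>)" using v(2) by simp
  ultimately show ?thesis by simp
qed

text \<open>The comparison is with the step function equal to \<open>c i\<close> on
  \<open>A i\<close>: it is within \<open>e\<close> of \<open>\<phi>\<close> on \<open>K\<close>,
  and both vanish off \<open>K\<close>.\<close>

lemma integral_Riemann_sum:
  fixes \<phi> :: "'g \<Rightarrow> real" and n :: nat
  assumes K: "compact K" and \<phi>: "integrable \<mu> \<phi>" "\<And>x. x \<notin> K \<Longrightarrow> \<phi> x = 0"
    and A: "\<And>i. i < n \<Longrightarrow> A i \<in> sets borel" "disjoint_family_on A {..<n}" "(\<Union>i<n. A i) = K"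
    and c: "\<And>i x. i < n \<Longrightarrow> x \<in> A i \<Longrightarrow> \<bar>\<phi> x - c i\<bar> \<le> e"
  shows "\<bar>(\<integral>x. \<phi> x \<partial>\<mu>) - (\<Sum>i<n. measure \<mu> (A i) * c i)\<bar> \<le> e * measure \<mu> K"
proof -
  define \<psi> where "\<psi> x = (\<Sum>i<n. c i * indicator (A i) x)" for x
  have fin: "emeasure \<mu> (A i) < \<infinity>" if "i < n" for i
  proof -
    have "emeasure \<mu> (A i) \<le> emeasure \<mu> K"
      using A(3) that borel_compact[OF K] by (intro emeasure_mono) auto
    then show ?thesis using emeasure_compact[OF K] by simp
  qed
  have int: "integrable \<mu> (\<lambda>x. c i * indicator (A i) x :: real)" if "i < n" for i
    using A(1)[OF that] fin[OF that] by (intro integrable_mult_right integrable_real_indicator) auto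
  have i\<psi>: "integrable \<mu> \<psi>"
    unfolding \<psi>_def using int by (intro Bochner_Integration.integrable_sum) auto
  have "(\<integral>x. \<psi> x \<partial>\<mu>) = (\<Sum>i<n. measure \<mu> (A i) * c i)"
    unfolding \<psi>_def using int A(1)
    by (subst Bochner_Integration.integral_sum) (auto simp: mult.commute)
  then have "(\<integral>x. \<phi> x \<partial>\<mu>) - (\<Sum>i<n. measure \<mu> (A i) * c i) = (\<integral>x. \<phi> x - \<psi> x \<partial>\<mu>)"
    using \<phi>(1) i\<psi> by simp
  moreover have "\<bar>\<integral>x. \<phi> x - \<psi> x \<partial>\<mu>\<bar> \<le> (\<integral>x. \<bar>\<phi> x - \<psi> x\<bar> \<partial>\<mu>)"
    by (rule integral_abs_bound)
  moreover have "(\<integral>x. \<bar>\<phi> x - \<psi> x\<bar> \<partial>\<mu>) \<le> e * measure \<mu> K"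
  proof (rule integral_abs_le(2)[OF K])
    show "(\<lambda>x. \<phi> x - \<psi> x) \<in> borel_measurable borel"
      using borel_measurable_integrable[OF \<phi>(1)] borel_measurable_integrable[OF i\<psi>] by simp
    show "\<bar>\<phi> x - \<psi> x\<bar> \<le> e * indicator K x" for x
    proof (cases "x \<in> K")
      case True
      then obtain j where j: "j < n" "x \<in> A j" using A(3) by blast
      have "indicator (A i) x = (if i = j then 1 else 0 :: real)" if "i < n" for i
        using A(2) j that by (auto simp: disjoint_family_on_def indicator_def)
      then have "\<psi> x = (\<Sum>i<n. if i = j then c j else 0)"
        unfolding \<psi>_def by (intro sum.cong) auto
      then have "\<psi> x = c j" using j(1) by simp
      then show ?thesis using c[OF j] True by simp
    next
      case False
      then have "\<psi> x = 0"
        unfolding \<psi>_def using A(3) by (intro sum.neutral) (auto simp: indicator_def)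
      then show ?thesis using False \<phi>(2) by simp
    qed
  qed
  ultimately show ?thesis by linarith
qed

lemma continuous_section:
  assumes "continuous_on UNIV (\<lambda>(x, y). F x y)"
  shows "continuous_on UNIV (F x)" "continuous_on UNIV (\<lambda>x. F x y)"
  by (auto intro!: continuous_on_compose2[OF assms, of UNIV "\<lambda>y. (x, y)", simplified]
      continuous_on_compose2[OF assms, of UNIV "\<lambda>x. (x, y)", simplified] continuous_intros)

lemma Cc_integral_parameter:
  fixes F :: "'g \<Rightarrow> 'g \<Rightarrow> real"
  assumes F: "continuous_on UNIV (\<lambda>(x, y). F x y)" and K: "compact K" and L: "compact L"
    and supp: "\<And>x y. x \<notin> K \<or> y \<notin> L \<Longrightarrow> F x y = 0"
  shows "(\<lambda>y. \<integral>x. F x y \<partial>\<mu>) \<in> Cc"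
proof (rule CcI[OF _ L])
  have sec: "(\<lambda>x. F x y) \<in> Cc" for y
    using supp by (intro CcI[OF _ K] continuous_section[OF F]) auto
  have swap: "continuous_on UNIV (\<lambda>(y, x). F x y)"
    using continuous_on_compose2[OF F continuous_on_swap[of UNIV]] by (simp add: split_beta)
  show "continuous_on UNIV (\<lambda>y. \<integral>x. F x y \<partial>\<mu>)"
  proof (rule continuous_realI)
    show "0 \<le> measure \<mu> K" by simp
    fix y0 and e :: real assume e: "0 < e"
    obtain U where U: "open U" "y0 \<in> U" "\<And>y x. y \<in> U \<Longrightarrow> \<bar>F x y - F x y0\<bar> \<le> e"
      by (rule uniformly_small_near[OF swap open_UNIV UNIV_I K _ e, of y0]) (use supp in auto)
    have "\<bar>(\<integral>x. F x y \<partial>\<mu>) - (\<integral>x. F x y0 \<partial>\<mu>)\<bar> \<le> measure \<mu> K * e" if y: "y \<in> U" for y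
    proof -
      have "(\<integral>x. F x y \<partial>\<mu>) - (\<integral>x. F x y0 \<partial>\<mu>) = (\<integral>x. F x y - F x y0 \<partial>\<mu>)"
        using Cc_integrable[OF sec] by simp
      also have "\<bar>\<dots>\<bar> \<le> (\<integral>x. \<bar>F x y - F x y0\<bar> \<partial>\<mu>)" by (rule integral_abs_bound)
      also have "\<dots> \<le> e * measure \<mu> K"
        using U(3)[OF y] supp
        by (intro integral_abs_le(2)[OF K] Cc_measurable Cc_diff sec Cc_abs_le_indicator) auto
      finally show ?thesis by (simp add: mult.commute)
    qed
    then show "\<exists>U. open U \<and> y0 \<in> U \<and> (\<forall>y\<in>U. \<bar>(\<integral>x. F x y \<partial>\<mu>) - (\<integral>x. F x y0 \<partial>\<mu>)\<bar> \<le> measure \<mu> K * e)"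
      using U by blast
  qed
qed (use supp in simp)

text \<open>Interchanging \<open>J\<close> with the integral takes no product measure. Partition
  \<open>K\<close> so finely that \<open>F x\<close> is uniformly close to \<open>F (x i)\<close>
  for \<open>x\<close> in \<open>A i\<close>; both sides are then within
  \<open>C * measure \<mu> K * e\<close> of the same Riemann sum.\<close>

lemma local_functional_Fubini:
  fixes F :: "'g \<Rightarrow> 'g \<Rightarrow> real"
  assumes J: "local_functional J"
    and F: "continuous_on UNIV (\<lambda>(x, y). F x y)" and K: "compact K" and L: "compact L"
    and supp: "\<And>x y. x \<notin> K \<or> y \<notin> L \<Longrightarrow> F x y = 0"
  shows "(\<lambda>x. J (F x)) \<in> Cc" "J (\<lambda>y. \<integral>x. F x y \<partial>\<mu>) = (\<integral>x. J (F x) \<partial>\<mu>)"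
proof -
  obtain C where C: "0 \<le> C" "\<And>u B. continuous_on UNIV u \<Longrightarrow> (\<And>t. t \<notin> L \<Longrightarrow> u t = 0) \<Longrightarrow>
    (\<And>t. \<bar>u t\<bar> \<le> B) \<Longrightarrow> \<bar>J u\<bar> \<le> C * B"
    using local_functional_bound[OF J L] by blast
  have sec: "F x \<in> Cc" for x
    using supp by (intro CcI[OF _ L] continuous_section[OF F]) auto
  have sec': "(\<lambda>x. F x y) \<in> Cc" for y
    using supp by (intro CcI[OF _ K] continuous_section[OF F]) auto
  have Jdiff: "\<bar>J (F x) - J (F x0)\<bar> \<le> C * e" if "\<And>y. \<bar>F x y - F x0 y\<bar> \<le> e" for x x0 e
    using C(2)[of "\<lambda>y. F x y - F x0 y" e] that supp Cc_continuous[OF Cc_diff[OF sec sec]]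
    by (simp add: local_functional_diff[OF J sec sec])
  have unif: "\<exists>U. open U \<and> x0 \<in> U \<and> (\<forall>x\<in>U. \<forall>y. \<bar>F x y - F x0 y\<bar> \<le> e)" if "0 < e" for x0 e
    by (rule uniformly_small_near[OF F open_UNIV UNIV_I L _ that, of x0]) (use supp in auto)
  show JF: "(\<lambda>x. J (F x)) \<in> Cc"
  proof (rule CcI[OF _ K])
    show "continuous_on UNIV (\<lambda>x. J (F x))"
      using unif Jdiff by (intro continuous_realI[OF C(1)]) meson
    show "J (F x) = 0" if "x \<notin> K" for x
      using C(2)[OF Cc_continuous[OF sec], of x 0] that supp by simp
  qed
  define D where "D = \<bar>J (\<lambda>y. \<integral>x. F x y \<partial>\<mu>) - (\<integral>x. J (F x) \<partial>\<mu>)\<bar>"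
  have "D \<le> 2 * C * measure \<mu> K * e" if e: "0 < e" for e
  proof -
    obtain U where U: "\<And>x. open (U x) \<and> x \<in> U x" "\<And>x0 x y. x \<in> U x0 \<Longrightarrow> \<bar>F x y - F x0 y\<bar> \<le> e"
      using unif[OF e] by metis
    obtain n :: nat and x A where A: "\<And>i. i < n \<Longrightarrow> x i \<in> K" "\<And>i. i < n \<Longrightarrow> A i \<in> sets borel"
      "\<And>i. i < n \<Longrightarrow> A i \<subseteq> U (x i)" "disjoint_family_on A {..<n}" "(\<Union>i<n. A i) = K"
      using compact_Borel_partition[OF K, of U] U(1) by metis
    have 1: "\<bar>(\<integral>z. F z y \<partial>\<mu>) - (\<Sum>i<n. measure \<mu> (A i) * F (x i) y)\<bar> \<le> e * measure \<mu> K" for y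
    proof (rule integral_Riemann_sum[OF K Cc_integrable[OF sec'] _ A(2,4,5)])
      show "\<bar>F z y - F (x i) y\<bar> \<le> e" if "i < n" "z \<in> A i" for i z
        using A(3)[OF that(1)] that(2) U(2) by blast
    qed (use supp in auto)
    have 2: "\<bar>(\<integral>z. J (F z) \<partial>\<mu>) - (\<Sum>i<n. measure \<mu> (A i) * J (F (x i)))\<bar> \<le> (C * e) * measure \<mu> K"
    proof (rule integral_Riemann_sum[OF K Cc_integrable[OF JF] _ A(2,4,5)])
      show "\<bar>J (F z) - J (F (x i))\<bar> \<le> C * e" if "i < n" "z \<in> A i" for i z
        using A(3)[OF that(1)] that(2) U(2) by (intro Jdiff) blast
      show "J (F z) = 0" if "z \<notin> K" for z
        using C(2)[OF Cc_continuous[OF sec], of z 0] that supp by simp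
    qed
    have sum_Cc: "(\<lambda>y. \<Sum>i<n. measure \<mu> (A i) * F (x i) y) \<in> Cc"
      by (intro Cc_sum Cc_scale sec)
    have int_Cc: "(\<lambda>y. \<integral>x. F x y \<partial>\<mu>) \<in> Cc"
      by (rule Cc_integral_parameter[OF F K L supp])
    have "\<bar>J (\<lambda>y. (\<integral>z. F z y \<partial>\<mu>) - (\<Sum>i<n. measure \<mu> (A i) * F (x i) y))\<bar> \<le> C * (e * measure \<mu> K)"
      using 1 supp by (intro C(2) Cc_continuous Cc_diff int_Cc sum_Cc) auto
    then have "\<bar>J (\<lambda>y. \<integral>z. F z y \<partial>\<mu>) - (\<Sum>i<n. measure \<mu> (A i) * J (F (x i)))\<bar> \<le> C * (e * measure \<mu> K)"
      using local_functional_diff[OF J int_Cc sum_Cc] local_functional_sum[OF J, of "{..<n}" "\<lambda>i. F (x i)"] sec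
      by simp
    then show ?thesis using 2 unfolding D_def by (simp add: algebra_simps)
  qed
  then have "D = 0"
    by (intro eq_zero_if_abs_le_mult[of D "2 * C * measure \<mu> K"]) (simp add: D_def)
  then show "J (\<lambda>y. \<integral>x. F x y \<partial>\<mu>) = (\<integral>x. J (F x) \<partial>\<mu>)"
    by (simp add: D_def)
qed

text \<open>Local compactness confines the parameter near \<open>s0\<close> to a compact set, hence
  all supports to one compact \<open>L\<close>; uniform closeness on \<open>L\<close> then controls
  the integral.\<close>

lemma L1_continuous:
  fixes F :: "'g \<Rightarrow> 'g \<Rightarrow> real"
  assumes F: "continuous_on UNIV (\<lambda>(s, t). F s t)"
    and supp: "\<And>K. compact K \<Longrightarrow> \<exists>L. compact L \<and> (\<forall>s\<in>K. \<forall>t. t \<notin> L \<longrightarrow> F s t = 0)"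
    and e: "0 < e"
  obtains U where "open U" "s0 \<in> U" "\<And>s. s \<in> U \<Longrightarrow> (\<integral>t. \<bar>F s t - F s0 t\<bar> \<partial>\<mu>) \<le> e"
proof -
  obtain N K where N: "open N" "compact K" "s0 \<in> N" "N \<subseteq> K"
    by (rule locally_compact_nhd[OF locally_compact open_UNIV UNIV_I, of s0])
  obtain L where L: "compact L" "\<And>s t. s \<in> K \<Longrightarrow> t \<notin> L \<Longrightarrow> F s t = 0"
    using supp[OF N(2)] by blast
  define d where "d = e / (measure \<mu> L + 1)"
  have "0 < d" using e by (simp add: d_def add_nonneg_pos)
  have zero: "F s t = 0" if "s \<in> N" "t \<notin> L" for s t using that N(4) L(2) by blast
  obtain U where U: "open U" "s0 \<in> U" "U \<subseteq> N" "\<And>s t. s \<in> U \<Longrightarrow> \<bar>F s t - F s0 t\<bar> \<le> d"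
    using uniformly_small_near[OF F N(1,3) L(1) zero \<open>0 < d\<close>] by blast
  have "(\<integral>t. \<bar>F s t - F s0 t\<bar> \<partial>\<mu>) \<le> e" if s: "s \<in> U" for s
  proof -
    have Cc: "F s \<in> Cc" if "s \<in> N" for s
      using zero that by (intro CcI[OF _ L(1)] continuous_section[OF F]) auto
    have "(\<integral>t. \<bar>F s t - F s0 t\<bar> \<partial>\<mu>) \<le> d * measure \<mu> L"
    proof (rule integral_abs_le(2)[OF L(1)])
      show "(\<lambda>t. F s t - F s0 t) \<in> borel_measurable borel"
        using s U(3) N(3) by (intro Cc_measurable Cc_diff Cc) auto
      show "\<bar>F s t - F s0 t\<bar> \<le> d * indicator L t" for t
        using U(4)[OF s, of t] zero[of s t] zero[of s0 t] s U(3) N(3) by (auto simp: indicator_def)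
    qed
    also have "\<dots> \<le> d * (measure \<mu> L + 1)" using \<open>0 < d\<close> by (intro mult_left_mono) auto
    also have "\<dots> = e" using measure_nonneg[of \<mu> L] by (simp add: d_def add_nonneg_eq_0_iff)
    finally show ?thesis .
  qed
  then show thesis using that U(1,2) by blast
qed

lemma supp_right_translates:
  fixes v :: "'g \<Rightarrow> real"
  assumes "v \<in> Cc" "compact K"
  shows "\<exists>L. compact L \<and> (\<forall>s\<in>K. \<forall>t. t \<notin> L \<longrightarrow> v (t + s) = 0)"
proof -
  obtain S where S: "compact S" "\<And>t. t \<notin> S \<Longrightarrow> v t = 0" using assms(1) by (rule CcE) blast
  define L where "L = (\<lambda>(x, y). x + y) ` (S \<times> uminus ` K)"
  have "compact L"
    unfolding L_def by (intro compact_sum_image compact_uminus_image S assms(2))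
  moreover have "v (t + s) = 0" if "s \<in> K" "t \<notin> L" for s t
  proof (rule S(2), rule notI)
    assume "t + s \<in> S"
    then have "(\<lambda>(x, y). x + y) (t + s, - s) \<in> L"
      unfolding L_def using that(1) by (intro imageI) auto
    then show False using that(2) by (simp add: add.assoc)
  qed
  ultimately show ?thesis by blast
qed

lemma supp_left_translates:
  fixes v :: "'g \<Rightarrow> real"
  assumes "v \<in> Cc" "compact K"
  shows "\<exists>L. compact L \<and> (\<forall>s\<in>K. \<forall>t. t \<notin> L \<longrightarrow> v (s + t) = 0)"
proof -
  obtain S where S: "compact S" "\<And>t. t \<notin> S \<Longrightarrow> v t = 0" using assms(1) by (rule CcE) blast
  define L where "L = (\<lambda>(x, y). x + y) ` (uminus ` K \<times> S)"
  have "compact L"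
    unfolding L_def by (intro compact_sum_image compact_uminus_image S assms(2))
  moreover have "v (s + t) = 0" if "s \<in> K" "t \<notin> L" for s t
  proof (rule S(2), rule notI)
    assume "s + t \<in> S"
    then have "(\<lambda>(x, y). x + y) (- s, s + t) \<in> L"
      unfolding L_def using that(1) by (intro imageI) auto
    then show False using that(2) by (simp add: add.assoc[symmetric])
  qed
  ultimately show ?thesis by blast
qed

text \<open>The difference \<open>f (x + y) - f (y + x)\<close> is jointly continuous and vanishes
  at \<open>x = 0\<close>, and for \<open>x\<close> near \<open>0\<close> both terms live on one
  compact set of \<open>y\<close>. This measures how far left and right translations by small
  elements differ on \<open>f\<close>.\<close>

lemma commutator_small:
  fixes f :: "'g \<Rightarrow> real"
  assumes f: "f \<in> Cc"
  obtains L where "compact L" "\<And>e. 0 < e \<Longrightarrow> \<exists>V. open V \<and> 0 \<in> V \<and>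
    (\<forall>x\<in>V. \<forall>y. \<bar>f (x + y) - f (y + x)\<bar> \<le> e \<and> (y \<notin> L \<longrightarrow> f (x + y) = 0 \<and> f (y + x) = 0))"
proof -
  obtain N K where N: "open N" "compact K" "(0::'g) \<in> N" "N \<subseteq> K"
    by (rule locally_compact_nhd[OF locally_compact open_UNIV UNIV_I, of 0])
  obtain L1 where L1: "compact L1" "\<And>s t. s \<in> K \<Longrightarrow> t \<notin> L1 \<Longrightarrow> f (t + s) = 0"
    using supp_right_translates[OF f N(2)] by blast
  obtain L2 where L2: "compact L2" "\<And>s t. s \<in> K \<Longrightarrow> t \<notin> L2 \<Longrightarrow> f (s + t) = 0"
    using supp_left_translates[OF f N(2)] by blast
  define L where "L = L1 \<union> L2"
  have L: "compact L" using L1 L2 by (auto simp: L_def)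
  have zero: "f (x + y) = 0 \<and> f (y + x) = 0" if "x \<in> N" "y \<notin> L" for x y
    using that N(4) L1(2) L2(2) by (auto simp: L_def)
  have "\<exists>V. open V \<and> 0 \<in> V \<and>
    (\<forall>x\<in>V. \<forall>y. \<bar>f (x + y) - f (y + x)\<bar> \<le> e \<and> (y \<notin> L \<longrightarrow> f (x + y) = 0 \<and> f (y + x) = 0))" if e: "0 < e" for e
  proof -
    have cont: "continuous_on UNIV (\<lambda>(x, y). f (x + y) - f (y + x))"
      by (auto simp: split_beta intro!: continuous_intros continuous_on_compose2[OF Cc_continuous[OF f]])
    obtain V where "open V" "0 \<in> V" "V \<subseteq> N"
      "\<And>x y. x \<in> V \<Longrightarrow> \<bar>(f (x + y) - f (y + x)) - (f (0 + y) - f (y + 0))\<bar> \<le> e"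
      by (rule uniformly_small_near[OF cont N(1,3) L _ e]) (use zero in auto)
    then show ?thesis using zero by (intro exI[of _ V]) auto
  qed
  then show thesis using that L by blast
qed

definition symmetric_bump :: "'g set \<Rightarrow> ('g \<Rightarrow> real) \<Rightarrow> bool"
  where "symmetric_bump V e \<longleftrightarrow> e \<in> Cc \<and> (\<forall>t. 0 \<le> e t) \<and> (\<forall>t. e (- t) = e t) \<and>
    (\<exists>K. compact K \<and> K \<subseteq> V \<and> (\<forall>t. t \<notin> K \<longrightarrow> e t = 0))"

lemma symmetric_bump_mono: "symmetric_bump V e \<Longrightarrow> V \<subseteq> W \<Longrightarrow> symmetric_bump W e"
  unfolding symmetric_bump_def by blast

lemma ex_symmetric_bump:
  assumes "open V" "0 \<in> V"
  obtains e where "symmetric_bump V e" "0 < (\<integral>t. e t \<partial>\<mu>)"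
proof -
  obtain e K where e: "e \<in> Cc" "\<And>t. 0 \<le> e t" "e 0 = 1" "compact K" "K \<subseteq> V" "\<And>t. t \<notin> K \<Longrightarrow> e t = 0"
      "\<And>t. e (- t) = e t"
    by (rule locally_compact_symmetric_bump[OF locally_compact assms]) blast
  have "symmetric_bump V e" unfolding symmetric_bump_def using e by blast
  moreover have "0 < (\<integral>t. e t \<partial>\<mu>)" using e by (intro integral_pos[of e 0]) auto
  ultimately show thesis by (rule that)
qed

text \<open>Since \<mu> is left invariant, replacing \<open>x\<close> by \<open>y + x\<close>
  carries \<open>f x * e (- y + x)\<close> into \<open>e x * f (y + x)\<close> without changing the
  integral over \<open>x\<close>. Applying \<open>J\<close> in \<open>y\<close> to the first gives
  \<open>f x * J e\<close>, by symmetry of \<open>e\<close> and left invariance of \<open>J\<close>.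
  In the second, \<open>x\<close> is small on the support of \<open>e\<close>, so
  \<open>f (y + x)\<close> may be replaced by \<open>f (x + y)\<close>, on which \<open>J\<close>
  takes the value \<open>J f\<close>. The constant \<open>C\<close> depends on \<open>f\<close>
  alone, not on \<epsilon> or the bump.\<close>

lemma functional_approx:
  fixes f :: "'g \<Rightarrow> real"
  assumes J: "local_functional J" and inv: "\<And>v s. v \<in> Cc \<Longrightarrow> J (\<lambda>t. v (s + t)) = J v" and f: "f \<in> Cc"
  shows "\<exists>C. \<forall>\<epsilon>>0. \<exists>V. open V \<and> 0 \<in> V \<and>
    (\<forall>e. symmetric_bump V e \<longrightarrow> \<bar>J f * (\<integral>t. e t \<partial>\<mu>) - J e * (\<integral>t. f t \<partial>\<mu>)\<bar> \<le> C * \<epsilon> * (\<integral>t. e t \<partial>\<mu>))"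
proof -
  obtain L where L: "compact L" "\<And>e. 0 < e \<Longrightarrow> \<exists>V. open V \<and> 0 \<in> V \<and>
    (\<forall>x\<in>V. \<forall>y. \<bar>f (x + y) - f (y + x)\<bar> \<le> e \<and> (y \<notin> L \<longrightarrow> f (x + y) = 0 \<and> f (y + x) = 0))"
    using commutator_small[OF f] by blast
  obtain C where C: "0 \<le> C" "\<And>u B. continuous_on UNIV u \<Longrightarrow> (\<And>t. t \<notin> L \<Longrightarrow> u t = 0) \<Longrightarrow>
    (\<And>t. \<bar>u t\<bar> \<le> B) \<Longrightarrow> \<bar>J u\<bar> \<le> C * B"
    using local_functional_bound[OF J L(1)] by blast
  obtain S where S: "compact S" "\<And>t. t \<notin> S \<Longrightarrow> f t = 0" using f by (rule CcE) blast
  have "\<exists>V. open V \<and> 0 \<in> V \<and>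
    (\<forall>e. symmetric_bump V e \<longrightarrow> \<bar>J f * (\<integral>t. e t \<partial>\<mu>) - J e * (\<integral>t. f t \<partial>\<mu>)\<bar> \<le> C * \<epsilon> * (\<integral>t. e t \<partial>\<mu>))"
    if \<epsilon>: "0 < \<epsilon>" for \<epsilon>
  proof -
    obtain V where V: "open V" "0 \<in> V" "\<And>x y. x \<in> V \<Longrightarrow> \<bar>f (x + y) - f (y + x)\<bar> \<le> \<epsilon>"
      "\<And>x y. x \<in> V \<Longrightarrow> y \<notin> L \<Longrightarrow> f (x + y) = 0 \<and> f (y + x) = 0"
      using L(2)[OF \<epsilon>] by blast
    have "\<bar>J f * (\<integral>t. e t \<partial>\<mu>) - J e * (\<integral>t. f t \<partial>\<mu>)\<bar> \<le> C * \<epsilon> * (\<integral>t. e t \<partial>\<mu>)"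
      if sym: "symmetric_bump V e" for e
    proof -
      obtain K where e: "e \<in> Cc" "\<And>t. 0 \<le> e t" "\<And>t. e (- t) = e t"
        and K: "compact K" "K \<subseteq> V" "\<And>t. t \<notin> K \<Longrightarrow> e t = 0"
        using sym unfolding symmetric_bump_def by blast
      note cont = continuous_on_compose2[OF Cc_continuous[OF f]] continuous_on_compose2[OF Cc_continuous[OF e(1)]]
      define P where "P = (\<lambda>(x, y). x + y) ` (S \<times> uminus ` K)"
      have P: "compact P"
        unfolding P_def by (intro compact_sum_image compact_uminus_image S K)
      have PI: "s - k \<in> P" if "s \<in> S" "k \<in> K" for s k
        using that by (force simp: P_def)
      define F where "F x y = e x * f (y + x)" for x y
      have F: "continuous_on UNIV (\<lambda>(x, y). F x y)"
        unfolding F_def by (auto simp: split_beta intro!: continuous_intros cont)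
      have F0: "F x y = 0" if "x \<notin> K \<or> y \<notin> P" for x y
        using that PI[of "y + x" x] S(2)[of "y + x"] K(3)[of x] by (auto simp: F_def)
      define G where "G x y = f x * e (- y + x)" for x y
      have G: "continuous_on UNIV (\<lambda>(x, y). G x y)"
        unfolding G_def by (auto simp: split_beta intro!: continuous_intros cont)
      have G0: "G x y = 0" if "x \<notin> S \<or> y \<notin> P" for x y
        using that PI[of x "- y + x"] S(2)[of x] K(3)[of "- y + x"] by (auto simp: G_def diff_conv_add_uminus minus_add add.assoc[symmetric] simp del: add_uminus_conv_diff)
      have JF: "J (F x) = e x * J (\<lambda>y. f (y + x))" for x
        unfolding F_def using local_functional_scale[OF J Cc_translate_right[OF f]] .
      have JG: "J (G x) = f x * J e" for x
      proof -
        have "J (G x) = f x * J (\<lambda>y. e (- x + y))"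
          unfolding G_def using e(3)[of "- x + y" for y] 
          by (subst local_functional_scale[OF J, symmetric])
             (auto intro!: Cc_translate_left e arg_cong[of _ _ J] simp: minus_add fun_eq_iff)
        then show ?thesis using inv[OF e(1)] by simp
      qed
      have "(\<integral>x. F x y \<partial>\<mu>) = (\<integral>x. G x y \<partial>\<mu>)" for y
        using integral_translate[of "\<lambda>x. G x y" y] continuous_section(2)[OF G]
        by (simp add: F_def G_def add.assoc[symmetric] mult.commute borel_measurable_continuous_onI)
      then have "(\<integral>x. J (F x) \<partial>\<mu>) = (\<integral>x. J (G x) \<partial>\<mu>)"
        using local_functional_Fubini(2)[OF J F K(1) P F0] local_functional_Fubini(2)[OF J G S(1) P G0] by simp
      then have FG: "(\<integral>x. J (F x) \<partial>\<mu>) = J e * (\<integral>t. f t \<partial>\<mu>)"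
        by (simp add: JG mult.commute)
      have intF: "integrable \<mu> (\<lambda>x. J (F x))"
        by (intro Cc_integrable local_functional_Fubini(1)[OF J F K(1) P F0])
      have "\<bar>J f * e x - J (F x)\<bar> \<le> C * \<epsilon> * e x" for x
      proof (cases "x \<in> K")
        case True
        then have x: "x \<in> V" using K(2) by blast
        have "\<bar>J (\<lambda>y. f (x + y) - f (y + x))\<bar> \<le> C * \<epsilon>"
          using V(3)[OF x] V(4)[OF x]
          by (intro C(2) Cc_continuous Cc_diff Cc_translate_left Cc_translate_right f) auto
        then have "\<bar>J f - J (\<lambda>y. f (y + x))\<bar> \<le> C * \<epsilon>"
          by (simp add: local_functional_diff[OF J] Cc_translate_left Cc_translate_right f inv)
        then have "e x * \<bar>J f - J (\<lambda>y. f (y + x))\<bar> \<le> e x * (C * \<epsilon>)"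
          using e(2) by (intro mult_left_mono)
        moreover have "e x * \<bar>J f - J (\<lambda>y. f (y + x))\<bar> = \<bar>e x * (J f - J (\<lambda>y. f (y + x)))\<bar>"
          using e(2)[of x] by (simp add: abs_mult)
        ultimately show ?thesis
          by (simp add: JF algebra_simps)
      next
        case False
        then show ?thesis using K(3) by (simp add: JF)
      qed
      then have "(\<integral>x. \<bar>J f * e x - J (F x)\<bar> \<partial>\<mu>) \<le> (\<integral>x. C * \<epsilon> * e x \<partial>\<mu>)"
        using intF Cc_integrable[OF e(1)] by (intro integral_mono) auto
      moreover have "\<bar>\<integral>x. J f * e x - J (F x) \<partial>\<mu>\<bar> \<le> (\<integral>x. \<bar>J f * e x - J (F x)\<bar> \<partial>\<mu>)"
        by (rule integral_abs_bound)
      moreover have "(\<integral>x. J f * e x - J (F x) \<partial>\<mu>) = J f * (\<integral>t. e t \<partial>\<mu>) - J e * (\<integral>t. f t \<partial>\<mu>)"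
        using intF Cc_integrable[OF e(1)] FG by simp
      ultimately show ?thesis by simp
    qed
    then show ?thesis using V(1,2) by blast
  qed
  then show ?thesis by blast
qed

text \<open>For a bump \<open>e\<close> concentrated near \<open>0\<close>, \<open>J f\<close> is
  close to the integral of \<open>f\<close> times the ratio of \<open>J e\<close> to the integral of
  \<open>e\<close>. The ratio does not involve \<open>f\<close>, so cross multiplication with the
  same statement for \<open>g\<close> eliminates it.\<close>

theorem left_invariant_functional_unique:
  fixes f g :: "'g \<Rightarrow> real"
  assumes J: "local_functional J" and inv: "\<And>v s. v \<in> Cc \<Longrightarrow> J (\<lambda>t. v (s + t)) = J v"
    and f: "f \<in> Cc" and g: "g \<in> Cc"
  shows "J f * (\<integral>t. g t \<partial>\<mu>) = J g * (\<integral>t. f t \<partial>\<mu>)"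
proof -
  let ?I = "\<lambda>v. \<integral>t. v t \<partial>\<mu>"
  obtain C where C: "\<forall>\<epsilon>>0. \<exists>V. open V \<and> 0 \<in> V \<and>
    (\<forall>e. symmetric_bump V e \<longrightarrow> \<bar>J f * ?I e - J e * ?I f\<bar> \<le> C * \<epsilon> * ?I e)"
    using functional_approx[OF J inv f] by (rule exE)
  obtain D where D: "\<forall>\<epsilon>>0. \<exists>V. open V \<and> 0 \<in> V \<and>
    (\<forall>e. symmetric_bump V e \<longrightarrow> \<bar>J g * ?I e - J e * ?I g\<bar> \<le> D * \<epsilon> * ?I e)"
    using functional_approx[OF J inv g] by (rule exE)
  have "\<bar>J f * ?I g - J g * ?I f\<bar> \<le> (C * \<bar>?I g\<bar> + D * \<bar>?I f\<bar>) * \<epsilon>" if \<epsilon>: "0 < \<epsilon>" for \<epsilon>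
  proof -
    obtain V where V: "open V" "0 \<in> V"
        "\<forall>e. symmetric_bump V e \<longrightarrow> \<bar>J f * ?I e - J e * ?I f\<bar> \<le> C * \<epsilon> * ?I e"
      using C[rule_format, OF \<epsilon>] by (elim exE conjE)
    obtain W where W: "open W" "0 \<in> W"
        "\<forall>e. symmetric_bump W e \<longrightarrow> \<bar>J g * ?I e - J e * ?I g\<bar> \<le> D * \<epsilon> * ?I e"
      using D[rule_format, OF \<epsilon>] by (elim exE conjE)
    obtain e where e: "symmetric_bump (V \<inter> W) e" and pos: "0 < ?I e"
      by (rule ex_symmetric_bump[of "V \<inter> W"]) (use V W in auto)
    have "symmetric_bump V e" "symmetric_bump W e"
      using symmetric_bump_mono[OF e] by auto
    then have 1: "\<bar>J f * ?I e - J e * ?I f\<bar> * \<bar>?I g\<bar> \<le> C * \<epsilon> * ?I e * \<bar>?I g\<bar>"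
      and 2: "\<bar>J g * ?I e - J e * ?I g\<bar> * \<bar>?I f\<bar> \<le> D * \<epsilon> * ?I e * \<bar>?I f\<bar>"
      using V(3) W(3) by (auto intro: mult_right_mono)
    have "?I e * \<bar>J f * ?I g - J g * ?I f\<bar> = \<bar>?I e * (J f * ?I g - J g * ?I f)\<bar>"
      using pos by (simp add: abs_mult)
    also have "?I e * (J f * ?I g - J g * ?I f) = (J f * ?I e - J e * ?I f) * ?I g - (J g * ?I e - J e * ?I g) * ?I f"
      by (simp add: algebra_simps)
    also have "\<bar>\<dots>\<bar> \<le> \<bar>J f * ?I e - J e * ?I f\<bar> * \<bar>?I g\<bar> + \<bar>J g * ?I e - J e * ?I g\<bar> * \<bar>?I f\<bar>"
      by (metis abs_mult abs_triangle_ineq4)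
    also have "\<dots> \<le> ?I e * ((C * \<bar>?I g\<bar> + D * \<bar>?I f\<bar>) * \<epsilon>)"
      using 1 2 by (simp add: algebra_simps)
    finally show ?thesis using pos by simp
  qed
  then have "J f * ?I g - J g * ?I f = 0"
    by (rule eq_zero_if_abs_le_mult)
  then show ?thesis by simp
qed

section \<open>The modular function and averages over right translates\<close>

definition L1_functional :: "(('g \<Rightarrow> real) \<Rightarrow> real) \<Rightarrow> bool"
  where "L1_functional N \<longleftrightarrow>
    (\<forall>u\<in>Cc. \<forall>v\<in>Cc. N (\<lambda>t. u t + v t) = N u + N v) \<and>
    (\<forall>c. \<forall>u\<in>Cc. N (\<lambda>t. c * u t) = c * N u) \<and>
    (\<forall>u\<in>Cc. \<bar>N u\<bar> \<le> (\<integral>t. \<bar>u t\<bar> \<partial>\<mu>))"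

lemma L1_functional_diff:
  assumes "L1_functional N" "u \<in> Cc" "v \<in> Cc"
  shows "N (\<lambda>t. u t - v t) = N u - N v"
proof -
  have "N (\<lambda>t. u t + - 1 * v t) = N u + N (\<lambda>t. - 1 * v t)" "N (\<lambda>t. - 1 * v t) = - 1 * N v"
    using assms Cc_scale[OF assms(3), of "-1"] unfolding L1_functional_def by metis+
  then show ?thesis by simp
qed

lemma L1_functional_integral: "L1_functional (\<lambda>v. \<integral>t. v t \<partial>\<mu>)"
  by (auto simp: L1_functional_def Cc_integrable)

text \<open>This form covers both later uses: right translation with weight 1, and reflection with
  weight \<open>modular\<close>. The left inverse \<open>h\<close> moves the compact set
  \<open>L\<close> to one off which the composite vanishes; the weight is bounded there.\<close>

lemma L1_functional_compose_local:
  fixes g h :: "'g \<Rightarrow> 'g"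
  assumes N: "L1_functional N" and g: "continuous_on UNIV g" "continuous_on UNIV h" "\<And>t. h (g t) = t"
    and w: "continuous_on UNIV w"
  shows "local_functional (\<lambda>v. N (\<lambda>t. v (g t) * w t))"
  unfolding local_functional_def
proof (intro conjI allI ballI impI)
  have Cc: "(\<lambda>t. v (g t) * w t) \<in> Cc" if "v \<in> Cc" for v
    using Cc_mult[OF Cc_compose[OF that g] w] by (simp add: mult.commute)
  show "N (\<lambda>t. (u (g t) + v (g t)) * w t) = N (\<lambda>t. u (g t) * w t) + N (\<lambda>t. v (g t) * w t)"
    if "u \<in> Cc" "v \<in> Cc" for u v
    using N Cc[OF that(1)] Cc[OF that(2)] by (simp add: L1_functional_def distrib_right)
  show "N (\<lambda>t. c * u (g t) * w t) = c * N (\<lambda>t. u (g t) * w t)" if "u \<in> Cc" for u c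
    using N Cc[OF that] by (simp add: L1_functional_def mult.assoc)
  fix L :: "'g set" assume L: "compact L"
  have hL: "compact (h ` L)"
    using L g(2) by (blast intro: compact_continuous_image continuous_on_subset)
  have "compact (w ` (h ` L))"
    using hL w by (blast intro: compact_continuous_image continuous_on_subset)
  then obtain D where D: "0 < D" "\<And>t. t \<in> h ` L \<Longrightarrow> \<bar>w t\<bar> \<le> D"
    using compact_imp_bounded[of "w ` (h ` L)"] by (auto simp: bounded_pos)
  show "\<exists>C\<ge>0. \<forall>u B. continuous_on UNIV u \<longrightarrow> (\<forall>t. t \<notin> L \<longrightarrow> u t = 0) \<longrightarrow> (\<forall>t. \<bar>u t\<bar> \<le> B) \<longrightarrow>
      \<bar>N (\<lambda>t. u (g t) * w t)\<bar> \<le> C * B"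
  proof (intro exI[of _ "D * measure \<mu> (h ` L)"] conjI allI impI)
    show "0 \<le> D * measure \<mu> (h ` L)" using D by simp
    fix u :: "'g \<Rightarrow> real" and B assume u: "continuous_on UNIV u" "\<forall>t. t \<notin> L \<longrightarrow> u t = 0" "\<forall>t. \<bar>u t\<bar> \<le> B"
    then have "u \<in> Cc" using L by (intro CcI[of u L]) auto
    then have uw: "(\<lambda>t. u (g t) * w t) \<in> Cc" by (rule Cc)
    have "\<bar>N (\<lambda>t. u (g t) * w t)\<bar> \<le> (\<integral>t. \<bar>u (g t) * w t\<bar> \<partial>\<mu>)"
      using N uw by (simp add: L1_functional_def)
    also have "\<dots> \<le> (B * D) * measure \<mu> (h ` L)"
    proof (rule integral_abs_le(2)[OF hL Cc_measurable[OF uw]])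
      show "\<bar>u (g t) * w t\<bar> \<le> B * D * indicator (h ` L) t" for t
      proof (cases "t \<in> h ` L")
        case True
        have "0 \<le> B" using u(3) abs_ge_zero order_trans by blast
        then have "\<bar>u (g t)\<bar> * \<bar>w t\<bar> \<le> B * D" using u(3) D(2)[OF True] by (intro mult_mono) auto
        then show ?thesis using True by (simp add: abs_mult)
      next
        case False
        then have "g t \<notin> L" using g(3)[of t] by (metis image_eqI)
        then show ?thesis using u(2) False by simp
      qed
    qed
    finally show "\<bar>N (\<lambda>t. u (g t) * w t)\<bar> \<le> D * measure \<mu> (h ` L) * B"
      by (simp add: mult_ac)
  qed
qed

definition reference :: "'g \<Rightarrow> real"
  where "reference = (SOME b. symmetric_bump UNIV b \<and> 0 < (\<integral>t. b t \<partial>\<mu>))"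

text \<open>With the convention that \<mu> of \<open>A\<close> translated on the right by
  \<open>t\<close> is Delta(t) times \<mu> of \<open>A\<close>, this is Delta at \<open>- t\<close>.
  That the ratio is the same for every function in \<open>Cc\<close> is shown by
  \<open>integral_translate_right\<close>.\<close>

definition modular :: "'g \<Rightarrow> real"
  where "modular t = (\<integral>s. reference (s + t) \<partial>\<mu>) / (\<integral>s. reference s \<partial>\<mu>)"

lemma reference: "reference \<in> Cc" "\<And>t. 0 \<le> reference t" "0 < (\<integral>t. reference t \<partial>\<mu>)"
proof -
  have "\<exists>b. symmetric_bump UNIV b \<and> 0 < (\<integral>t. b t \<partial>\<mu>)"
    using ex_symmetric_bump[OF open_UNIV UNIV_I] by blast
  then have "symmetric_bump UNIV reference \<and> 0 < (\<integral>t. reference t \<partial>\<mu>)"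
    unfolding reference_def by (rule someI_ex)
  then show "reference \<in> Cc" "\<And>t. 0 \<le> reference t" "0 < (\<integral>t. reference t \<partial>\<mu>)"
    by (auto simp: symmetric_bump_def)
qed

text \<open>Right translations commute with left ones, so integrating the right translate by
  \<open>t\<close> is a left invariant functional, hence a multiple of the integral;
  \<open>reference\<close> identifies the multiple.\<close>

lemma integral_translate_right:
  assumes v: "v \<in> Cc"
  shows "(\<integral>s. v (s + t) \<partial>\<mu>) = modular t * (\<integral>s. v s \<partial>\<mu>)"
proof -
  have J: "local_functional (\<lambda>v. \<integral>s. v (s + t) \<partial>\<mu>)"
    using L1_functional_compose_local[OF L1_functional_integral, of "\<lambda>s. s + t" "\<lambda>s. s - t" "\<lambda>_. 1"]
    by (simp add: continuous_intros)
  have "(\<integral>r. v (s + (r + t)) \<partial>\<mu>) = (\<integral>r. v (r + t) \<partial>\<mu>)" if "v \<in> Cc" for v :: "'g \<Rightarrow> real" and s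
    using integral_translate[of "\<lambda>r. v (r + t)" s] Cc_measurable[OF Cc_translate_right[OF that]]
    by (simp add: add.assoc)
  from left_invariant_functional_unique[OF J this v reference(1)]
  have "(\<integral>s. v (s + t) \<partial>\<mu>) * (\<integral>s. reference s \<partial>\<mu>) = (\<integral>s. reference (s + t) \<partial>\<mu>) * (\<integral>s. v s \<partial>\<mu>)"
    by simp
  then show ?thesis
    using reference(3) by (simp add: modular_def field_simps)
qed

lemma ex_reference_pos: obtains x where "0 < reference x"
proof (rule ccontr)
  assume "\<not> thesis"
  then have "reference x = 0" for x using reference(2)[of x] that[of x] by fastforce
  then show False using reference(3) by simp
qed

lemma modular_pos: "0 < modular t"
proof -
  obtain x where "0 < reference x" by (rule ex_reference_pos)
  then have "0 < (\<integral>s. reference (s + t) \<partial>\<mu>)"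
    using reference(2) by (intro integral_pos[of _ "x - t"] Cc_translate_right reference(1)) auto
  then show ?thesis using reference(3) by (simp add: modular_def)
qed

lemma modular_add: "modular (s + t) = modular s * modular t"
proof -
  have "(\<integral>r. reference (r + s + t) \<partial>\<mu>) = modular s * (\<integral>r. reference (r + t) \<partial>\<mu>)"
    by (rule integral_translate_right[OF Cc_translate_right[OF reference(1)]])
  then have "modular (s + t) * (\<integral>r. reference r \<partial>\<mu>) = modular s * modular t * (\<integral>r. reference r \<partial>\<mu>)"
    by (simp add: integral_translate_right[OF reference(1)] add.assoc)
  then show ?thesis using reference(3) by simp
qed

lemma modular_0 [simp]: "modular 0 = 1"
  using reference(3) by (simp add: modular_def)

lemma modular_minus: "modular (- t) = 1 / modular t"
  using modular_add[of "- t" t] modular_pos[of t] by (simp add: field_simps)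

lemma continuous_right_translates:
  assumes v: "v \<in> Cc" and "0 < e"
  obtains U where "open U" "t0 \<in> U" "\<And>t. t \<in> U \<Longrightarrow> (\<integral>s. \<bar>v (s + t) - v (s + t0)\<bar> \<partial>\<mu>) \<le> e"
  by (rule L1_continuous[of "\<lambda>t s. v (s + t)" e t0])
     (use assms supp_right_translates[OF v] in
       \<open>auto simp: split_beta intro!: continuous_intros continuous_on_compose2[OF Cc_continuous[OF v]]\<close>)

lemma continuous_left_translates:
  assumes v: "v \<in> Cc" and "0 < e"
  obtains U where "open U" "s0 \<in> U" "\<And>s. s \<in> U \<Longrightarrow> (\<integral>t. \<bar>v (- s + t) - v (- s0 + t)\<bar> \<partial>\<mu>) \<le> e"
proof (rule L1_continuous[of "\<lambda>s t. v (- s + t)" e s0])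
  show "continuous_on UNIV (\<lambda>(s, t). v (- s + t))"
    by (auto simp: split_beta intro!: continuous_intros continuous_on_compose2[OF Cc_continuous[OF v]])
  show "\<exists>L. compact L \<and> (\<forall>s\<in>K. \<forall>t. t \<notin> L \<longrightarrow> v (- s + t) = 0)" if "compact K" for K
    using supp_left_translates[OF v compact_uminus_image[OF that]] by auto
qed (use assms in auto)

lemma continuous_L1_functional_translates:
  assumes N: "L1_functional N" and v: "v \<in> Cc"
  shows "continuous_on UNIV (\<lambda>t. N (\<lambda>s. v (s + t)))"
proof (rule continuous_realI[of 1])
  fix t0 and e :: real assume "0 < e"
  then obtain U where U: "open U" "t0 \<in> U" "\<And>t. t \<in> U \<Longrightarrow> (\<integral>s. \<bar>v (s + t) - v (s + t0)\<bar> \<partial>\<mu>) \<le> e"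
    by (rule continuous_right_translates[OF v]) blast
  have "\<bar>N (\<lambda>s. v (s + t)) - N (\<lambda>s. v (s + t0))\<bar> \<le> 1 * e" if "t \<in> U" for t
  proof -
    note Cc = Cc_translate_right[OF v]
    have "\<bar>N (\<lambda>s. v (s + t)) - N (\<lambda>s. v (s + t0))\<bar> \<le> (\<integral>s. \<bar>v (s + t) - v (s + t0)\<bar> \<partial>\<mu>)"
      using N Cc_diff[OF Cc[of t] Cc[of t0]]
      by (simp add: L1_functional_diff[OF N Cc Cc, symmetric] L1_functional_def)
    then show ?thesis using U(3)[OF that] by simp
  qed
  then show "\<exists>U. open U \<and> t0 \<in> U \<and> (\<forall>t\<in>U. \<bar>N (\<lambda>s. v (s + t)) - N (\<lambda>s. v (s + t0))\<bar> \<le> 1 * e)"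
    using U(1,2) by blast
qed simp

lemma continuous_modular: "continuous_on UNIV modular"
  unfolding modular_def
  by (intro continuous_intros continuous_L1_functional_translates L1_functional_integral reference)
     (use reference(3) in auto)

text \<open>The reflection \<open>v (- t) * modular t\<close> turns right translations into left ones, so that
  \<open>left_invariant_functional_unique\<close> applies.\<close>

lemma right_covariant_functional_unique:
  fixes u v :: "'g \<Rightarrow> real"
  assumes N: "L1_functional N" and cov: "\<And>v r. v \<in> Cc \<Longrightarrow> N (\<lambda>s. v (s + r)) = modular r * N v"
    and u: "u \<in> Cc" and v: "v \<in> Cc" and eq: "(\<integral>t. u t \<partial>\<mu>) = (\<integral>t. v t \<partial>\<mu>)"
  shows "N u = N v"
proof -
  define R where "R v = (\<lambda>t. v (- t) * modular t)" for v :: "'g \<Rightarrow> real"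
  let ?I = "\<lambda>v. \<integral>t. v t \<partial>\<mu>"
  have R_Cc: "R v \<in> Cc" if "v \<in> Cc" for v
    unfolding R_def using Cc_mult[OF Cc_reflect[OF that] continuous_modular] by (simp add: mult.commute)
  have R_R: "R (R v) = v" for v
    using modular_pos by (simp add: R_def modular_minus fun_eq_iff less_imp_neq[symmetric])
  \<comment> \<open>Stated for any covariant functional because it is applied twice, to
    \<open>N\<close> and to the integral itself; comparing the two results eliminates the integral
    of \<open>R w\<close>.\<close>
  have uniq: "N (R f) * ?I g = N (R g) * ?I f"
    if N: "L1_functional N" and cov: "\<And>v r. v \<in> Cc \<Longrightarrow> N (\<lambda>s. v (s + r)) = modular r * N v"
      and fg: "f \<in> Cc" "g \<in> Cc" for N f g
  proof (rule left_invariant_functional_unique[where J = "\<lambda>v. N (R v)", OF _ _ fg])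
    show "local_functional (\<lambda>v. N (R v))"
      unfolding R_def
      by (rule L1_functional_compose_local[OF N, where h = uminus])
         (auto intro!: continuous_intros continuous_modular)
    fix v :: "'g \<Rightarrow> real" and s assume v: "v \<in> Cc"
    have "R (\<lambda>t. v (s + t)) = (\<lambda>t. modular s * R v (t + - s))"
    proof
      fix t
      have "modular (t + - s) = modular t / modular s"
        by (simp only: modular_add modular_minus) simp
      moreover have "- (t + - s) = s + - t" by simp
      ultimately show "R (\<lambda>t. v (s + t)) t = modular s * R v (t + - s)"
        using modular_pos[of s] by (simp only: R_def) (simp add: field_simps)
    qed
    then have "N (R (\<lambda>t. v (s + t))) = modular s * N (\<lambda>t. R v (t + - s))"
      using N Cc_translate_right[OF R_Cc[OF v]] by (simp add: L1_functional_def del: add_uminus_conv_diff)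
    also have "\<dots> = modular s * (modular (- s) * N (R v))"
      using cov[OF R_Cc[OF v], of "- s"] by simp
    finally show "N (R (\<lambda>t. v (s + t))) = N (R v)"
      using modular_pos[of s] by (simp add: modular_minus)
  qed
  have I: "?I (R f) * ?I g = ?I (R g) * ?I f" if "f \<in> Cc" "g \<in> Cc" for f g
    by (rule uniq[OF L1_functional_integral integral_translate_right that])
  have pos: "0 < ?I (R reference)"
  proof -
    obtain x where "0 < reference x" by (rule ex_reference_pos)
    then show ?thesis
      using reference(2) modular_pos by (intro integral_pos[of _ "- x"] R_Cc reference(1)) (auto simp: R_def less_imp_le)
  qed
  have "N w * ?I (R reference) = N (R reference) * ?I w" if w: "w \<in> Cc" for w
  proof -
    have "N w * ?I reference = N (R reference) * ?I (R w)"
      using uniq[OF N cov R_Cc[OF w] reference(1)] by (simp add: R_R)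
    moreover have "?I w * ?I reference = ?I (R reference) * ?I (R w)"
      using I[OF R_Cc[OF w] reference(1)] by (simp add: R_R)
    ultimately have "?I reference * (N w * ?I (R reference)) = ?I reference * (N (R reference) * ?I w)"
      by (metis mult.assoc mult.commute)
    then show ?thesis using reference(3) by simp
  qed
  from this[OF u] this[OF v] eq have "N u * ?I (R reference) = N v * ?I (R reference)" by simp
  then show ?thesis using pos by simp
qed

section \<open>Bounded functions, invariant means and averages\<close>

lemma Linfty_continuous: "continuous_on UNIV \<phi> \<Longrightarrow> (\<And>t. \<bar>\<phi> t\<bar> \<le> B) \<Longrightarrow> \<phi> \<in> Linfty \<mu>"
  by (auto simp: Linfty_def locally_AE_def intro!: borel_measurable_continuous_onI exI[of _ B])

lemma Linfty_const: "(\<lambda>_. c) \<in> Linfty \<mu>"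
  by (rule Linfty_continuous[of _ "\<bar>c\<bar>"]) auto

lemma Linfty_scale:
  assumes "\<phi> \<in> Linfty \<mu>"
  shows "(\<lambda>t. c * \<phi> t) \<in> Linfty \<mu>"
proof -
  obtain B where B: "locally_AE \<mu> (\<lambda>t. \<bar>\<phi> t\<bar> \<le> B)" using assms by (auto simp: Linfty_def)
  have "locally_AE \<mu> (\<lambda>t. \<bar>c * \<phi> t\<bar> \<le> \<bar>c\<bar> * B)"
    unfolding locally_AE_def
  proof (intro allI impI)
    fix K :: "'g set" assume "compact K"
    then have "AE t in \<mu>. t \<in> K \<longrightarrow> \<bar>\<phi> t\<bar> \<le> B" using B by (simp add: locally_AE_def)
    then show "AE t in \<mu>. t \<in> K \<longrightarrow> \<bar>c * \<phi> t\<bar> \<le> \<bar>c\<bar> * B"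
      by eventually_elim (auto simp: abs_mult mult_left_mono)
  qed
  then show ?thesis using assms by (auto simp: Linfty_def)
qed

lemma Linfty_add:
  assumes "\<phi> \<in> Linfty \<mu>" "\<psi> \<in> Linfty \<mu>"
  shows "(\<lambda>t. \<phi> t + \<psi> t) \<in> Linfty \<mu>"
proof -
  obtain B where B: "locally_AE \<mu> (\<lambda>t. \<bar>\<phi> t\<bar> \<le> B)" using assms by (auto simp: Linfty_def)
  obtain D where D: "locally_AE \<mu> (\<lambda>t. \<bar>\<psi> t\<bar> \<le> D)" using assms by (auto simp: Linfty_def)
  have "locally_AE \<mu> (\<lambda>t. \<bar>\<phi> t + \<psi> t\<bar> \<le> B + D)"
    unfolding locally_AE_def
  proof (intro allI impI)
    fix K :: "'g set" assume "compact K"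
    then have "AE t in \<mu>. t \<in> K \<longrightarrow> \<bar>\<phi> t\<bar> \<le> B" "AE t in \<mu>. t \<in> K \<longrightarrow> \<bar>\<psi> t\<bar> \<le> D"
      using B D by (simp_all add: locally_AE_def)
    then show "AE t in \<mu>. t \<in> K \<longrightarrow> \<bar>\<phi> t + \<psi> t\<bar> \<le> B + D"
      by eventually_elim auto
  qed
  then show ?thesis using assms by (auto simp: Linfty_def)
qed

lemma mean_add: "left_invariant_mean \<mu> m \<Longrightarrow> \<phi> \<in> Linfty \<mu> \<Longrightarrow> \<psi> \<in> Linfty \<mu> \<Longrightarrow>
    m (\<lambda>t. \<phi> t + \<psi> t) = m \<phi> + m \<psi>"
  and mean_scale: "left_invariant_mean \<mu> m \<Longrightarrow> \<phi> \<in> Linfty \<mu> \<Longrightarrow> m (\<lambda>t. c * \<phi> t) = c * m \<phi>"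
  by (simp_all add: left_invariant_mean_def)

lemma mean_const: "left_invariant_mean \<mu> m \<Longrightarrow> m (\<lambda>_. c) = c"
  using mean_scale[OF _ Linfty_const[of 1], of m c] by (simp add: left_invariant_mean_def)

lemma mean_le_const:
  assumes m: "left_invariant_mean \<mu> m" and \<phi>: "\<phi> \<in> Linfty \<mu>" "\<And>t. \<phi> t \<le> c"
  shows "m \<phi> \<le> c"
proof -
  note Linf = Linfty_const[of c] Linfty_scale[OF \<phi>(1), of "- 1"]
  have "locally_AE \<mu> (\<lambda>t. 0 \<le> c + - 1 * \<phi> t)"
    using \<phi>(2) by (simp add: locally_AE_def)
  then have "0 \<le> m (\<lambda>t. c + - 1 * \<phi> t)"
    using m Linfty_add[OF Linf] unfolding left_invariant_mean_def by metis
  then show ?thesis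
    using mean_add[OF m Linf] mean_scale[OF m \<phi>(1), of "- 1"] mean_const[OF m] by simp
qed

text \<open>The translation is by \<open>- t\<close> so that translating \<open>v\<close> on the
  right by \<open>r\<close> amounts, up to the factor \<open>modular r\<close>, to translating the
  average on the left, which a left invariant mean does not see.\<close>

definition right_average :: "(('g \<Rightarrow> real) \<Rightarrow> real) \<Rightarrow> ('g \<Rightarrow> real) \<Rightarrow> 'g \<Rightarrow> real"
  where "right_average N v t = N (\<lambda>s. v (s + - t)) / modular (- t)"

text \<open>Translation by \<open>- t\<close> multiplies the L^1 norm by
  \<open>modular (- t)\<close>, which the denominator cancels. Continuity in \<open>t\<close> is
  that of right translation in L^1.\<close>

lemma right_average_Linfty:
  assumes N: "L1_functional N" and v: "v \<in> Cc"
  shows "\<bar>right_average N v t\<bar> \<le> (\<integral>t. \<bar>v t\<bar> \<partial>\<mu>)" "right_average N v \<in> Linfty \<mu>"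
proof -
  show bd: "\<bar>right_average N v t\<bar> \<le> (\<integral>t. \<bar>v t\<bar> \<partial>\<mu>)" for t
  proof -
    have "\<bar>N (\<lambda>s. v (s + - t))\<bar> \<le> (\<integral>s. \<bar>v (s + - t)\<bar> \<partial>\<mu>)"
      using N Cc_translate_right[OF v] by (simp add: L1_functional_def del: add_uminus_conv_diff)
    also have "\<dots> = modular (- t) * (\<integral>t. \<bar>v t\<bar> \<partial>\<mu>)"
      by (rule integral_translate_right[OF Cc_abs[OF v]])
    finally show ?thesis
      using modular_pos[of "- t"] by (simp add: right_average_def field_simps)
  qed
  have "continuous_on UNIV (right_average N v)"
    unfolding right_average_def
    by (intro continuous_on_divide continuous_on_compose2[OF continuous_L1_functional_translates[OF N v]]
        continuous_on_compose2[OF continuous_modular] continuous_intros)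
       (use modular_pos in \<open>auto simp: less_imp_neq[symmetric]\<close>)
  then show "right_average N v \<in> Linfty \<mu>" using bd by (rule Linfty_continuous)
qed

text \<open>As a function of \<open>v\<close>, the mean of the average is again bounded by the L^1
  norm, and under right translation by \<open>r\<close> it acquires the factor
  \<open>modular r\<close>, exactly as the integral does; uniqueness of such functionals
  applies.\<close>

lemma mean_right_average_eq:
  assumes m: "left_invariant_mean \<mu> m" and N: "L1_functional N"
    and uv: "u \<in> Cc" "v \<in> Cc" "(\<integral>t. u t \<partial>\<mu>) = (\<integral>t. v t \<partial>\<mu>)"
  shows "m (right_average N u) = m (right_average N v)"
proof (rule right_covariant_functional_unique[where N = "\<lambda>v. m (right_average N v)", OF _ _ uv])
  note Linf = right_average_Linfty(2)[OF N]
  note add = mean_add[OF m] and scale = mean_scale[OF m] and le = mean_le_const[OF m]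
  show "L1_functional (\<lambda>v. m (right_average N v))"
    unfolding L1_functional_def
  proof (intro conjI ballI allI)
    fix u v :: "'g \<Rightarrow> real" assume uv: "u \<in> Cc" "v \<in> Cc"
    have "right_average N (\<lambda>t. u t + v t) = (\<lambda>t. right_average N u t + right_average N v t)"
      using N Cc_translate_right[OF uv(1)] Cc_translate_right[OF uv(2)]
      by (simp add: right_average_def fun_eq_iff L1_functional_def add_divide_distrib del: add_uminus_conv_diff)
    then show "m (right_average N (\<lambda>t. u t + v t)) = m (right_average N u) + m (right_average N v)"
      using add Linf uv by simp
  next
    fix c and u :: "'g \<Rightarrow> real" assume u: "u \<in> Cc"
    have "right_average N (\<lambda>t. c * u t) = (\<lambda>t. c * right_average N u t)"
      using N Cc_translate_right[OF u]
      by (simp add: right_average_def fun_eq_iff L1_functional_def del: add_uminus_conv_diff)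
    then show "m (right_average N (\<lambda>t. c * u t)) = c * m (right_average N u)"
      using scale Linf u by simp
  next
    fix u :: "'g \<Rightarrow> real" assume u: "u \<in> Cc"
    have "m (right_average N u) \<le> (\<integral>t. \<bar>u t\<bar> \<partial>\<mu>)"
      using right_average_Linfty[OF N u] by (intro le) (auto simp: abs_le_iff)
    moreover have "m (\<lambda>t. - 1 * right_average N u t) \<le> (\<integral>t. \<bar>u t\<bar> \<partial>\<mu>)"
      using right_average_Linfty[OF N u] by (intro le Linfty_scale) (auto simp: abs_le_iff)
    ultimately show "\<bar>m (right_average N u)\<bar> \<le> (\<integral>t. \<bar>u t\<bar> \<partial>\<mu>)"
      using scale[OF Linf[OF u], of "- 1"] by (simp add: abs_le_iff)
  qed
  fix v :: "'g \<Rightarrow> real" and r assume v: "v \<in> Cc"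
  have "right_average N (\<lambda>s. v (s + r)) = (\<lambda>t. modular r * right_average N v (- r + t))"
  proof
    fix t
    have "modular (- (- r + t)) = modular (- t) * modular r"
      by (simp add: minus_add modular_add)
    moreover have "s + - (- r + t) = s + - t + r" for s
      by (simp only: minus_add add.assoc minus_minus)
    ultimately show "right_average N (\<lambda>s. v (s + r)) t = modular r * right_average N v (- r + t)"
      using modular_pos[of r] by (simp add: right_average_def del: add_uminus_conv_diff)
  qed
  moreover have "m (\<lambda>t. right_average N v (- r + t)) = m (right_average N v)"
    using m Linf[OF v] unfolding left_invariant_mean_def by blast
  moreover have "(\<lambda>t. right_average N v (- r + t)) \<in> Linfty \<mu>"
  proof -
    have "right_average N v \<in> borel_measurable borel"
      using Linf[OF v] by (simp add: Linfty_def)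
    then have "(\<lambda>t. right_average N v (- r + t)) \<in> borel_measurable borel"
      by measurable
    then show ?thesis
      using right_average_Linfty(1)[OF N v] by (auto simp: Linfty_def locally_AE_def)
  qed
  ultimately show "m (right_average N (\<lambda>s. v (s + r))) = modular r * m (right_average N v)"
    using scale by simp
qed

section \<open>Reiter's condition\<close>

definition left_diff :: "('g \<Rightarrow> real) \<Rightarrow> 'g \<Rightarrow> 'g \<Rightarrow> real"
  where "left_diff h s = (\<lambda>t. h (- s + t) - h t)"

lemma left_diff_Cc: "h \<in> Cc \<Longrightarrow> left_diff h s \<in> Cc"
  unfolding left_diff_def by (intro Cc_diff Cc_translate_left)

text \<open>The last clause gives every density the L^1 modulus of continuity of \<open>u\<close>
  under left translation. It passes to convex combinations, and it later extends almost invariance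
  from a finite net to a compact set.\<close>

definition dominated_densities :: "('g \<Rightarrow> real) \<Rightarrow> ('g \<Rightarrow> real) set"
  where "dominated_densities u = {h \<in> Cc. (\<forall>t. 0 \<le> h t) \<and> (\<integral>t. h t \<partial>\<mu>) = 1 \<and>
    (\<forall>s s'. (\<integral>t. \<bar>h (- s + t) - h (- s' + t)\<bar> \<partial>\<mu>) \<le> (\<integral>t. \<bar>u (- s + t) - u (- s' + t)\<bar> \<partial>\<mu>))}"

lemma dominated_densities_convex:
  assumes h: "h \<in> dominated_densities u" "k \<in> dominated_densities u" and ab: "0 \<le> a" "0 \<le> b" "a + b = 1"
  shows "(\<lambda>t. a * h t + b * k t) \<in> dominated_densities u"
proof -
  have Cc: "h \<in> Cc" "k \<in> Cc" and int: "(\<integral>t. h t \<partial>\<mu>) = 1" "(\<integral>t. k t \<partial>\<mu>) = 1"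
    using h by (auto simp: dominated_densities_def)
  have "(\<integral>t. \<bar>(a * h (- s + t) + b * k (- s + t)) - (a * h (- s' + t) + b * k (- s' + t))\<bar> \<partial>\<mu>)
      \<le> (\<integral>t. \<bar>u (- s + t) - u (- s' + t)\<bar> \<partial>\<mu>)" (is "?L \<le> ?R") for s s'
  proof -
    have i: "integrable \<mu> (\<lambda>t. h (- s + t) - h (- s' + t))" "integrable \<mu> (\<lambda>t. k (- s + t) - k (- s' + t))"
      by (intro Cc_integrable Cc_diff Cc_translate_left Cc)+
    have "?L \<le> (\<integral>t. a * \<bar>h (- s + t) - h (- s' + t)\<bar> + b * \<bar>k (- s + t) - k (- s' + t)\<bar> \<partial>\<mu>)"
    proof (rule integral_mono)
      show "integrable \<mu> (\<lambda>t. \<bar>(a * h (- s + t) + b * k (- s + t)) - (a * h (- s' + t) + b * k (- s' + t))\<bar>)"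
        by (intro Cc_integrable Cc_abs Cc_diff Cc_add Cc_scale Cc_translate_left Cc)
      show "\<bar>(a * h (- s + t) + b * k (- s + t)) - (a * h (- s' + t) + b * k (- s' + t))\<bar>
          \<le> a * \<bar>h (- s + t) - h (- s' + t)\<bar> + b * \<bar>k (- s + t) - k (- s' + t)\<bar>" for t
      proof -
        have "(a * h (- s + t) + b * k (- s + t)) - (a * h (- s' + t) + b * k (- s' + t))
            = a * (h (- s + t) - h (- s' + t)) + b * (k (- s + t) - k (- s' + t))"
          by (simp add: algebra_simps)
        also have "\<bar>\<dots>\<bar> \<le> \<bar>a * (h (- s + t) - h (- s' + t))\<bar> + \<bar>b * (k (- s + t) - k (- s' + t))\<bar>"
          by (rule abs_triangle_ineq)
        finally show ?thesis using ab by (simp add: abs_mult)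
      qed
    qed (use i in simp)
    also have "\<dots> = a * (\<integral>t. \<bar>h (- s + t) - h (- s' + t)\<bar> \<partial>\<mu>) + b * (\<integral>t. \<bar>k (- s + t) - k (- s' + t)\<bar> \<partial>\<mu>)"
      using i by simp
    also have "\<dots> \<le> a * ?R + b * ?R"
      using h ab by (intro add_mono mult_left_mono) (auto simp: dominated_densities_def)
    also have "\<dots> = ?R" using ab(3) by (simp flip: distrib_right)
    finally show ?thesis .
  qed
  moreover have "(\<integral>t. a * h t + b * k t \<partial>\<mu>) = 1"
    using Cc_integrable[OF Cc(1)] Cc_integrable[OF Cc(2)] int ab(3) by simp
  ultimately show ?thesis
    using h ab by (auto simp: dominated_densities_def intro!: Cc_add Cc_scale)
qed

text \<open>Right translation commutes with the left translations in the domination clause and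
  scales every L^1 norm by \<open>modular r\<close>, which the division removes.\<close>

lemma dominated_densities_translate:
  assumes u: "u \<in> Cc" "\<And>t. 0 \<le> u t" "(\<integral>t. u t \<partial>\<mu>) = 1"
  shows "(\<lambda>t. u (t + r) / modular r) \<in> dominated_densities u"
proof -
  have "(\<integral>t. \<bar>u (- s + t + r) / modular r - u (- s' + t + r) / modular r\<bar> \<partial>\<mu>)
      = (\<integral>t. \<bar>u (- s + t) - u (- s' + t)\<bar> \<partial>\<mu>)" for s s'
  proof -
    have "(\<integral>t. \<bar>u (- s + t + r) / modular r - u (- s' + t + r) / modular r\<bar> \<partial>\<mu>)
      = (\<integral>t. \<bar>u (- s + (t + r)) - u (- s' + (t + r))\<bar> / modular r \<partial>\<mu>)"
      using modular_pos[of r] by (intro Bochner_Integration.integral_cong) (auto simp: add.assoc simp flip: diff_divide_distrib)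
    also have "\<dots> = (\<integral>t. \<bar>u (- s + (t + r)) - u (- s' + (t + r))\<bar> \<partial>\<mu>) / modular r"
      by simp
    also have "(\<integral>t. \<bar>u (- s + (t + r)) - u (- s' + (t + r))\<bar> \<partial>\<mu>) = modular r * (\<integral>t. \<bar>u (- s + t) - u (- s' + t)\<bar> \<partial>\<mu>)"
      by (rule integral_translate_right) (intro Cc_abs Cc_diff Cc_translate_left u)
    finally show ?thesis using modular_pos[of r] by simp
  qed
  moreover have "(\<lambda>t. u (t + r) / modular r) \<in> Cc"
    using Cc_scale[OF Cc_translate_right[OF u(1), of r], of "1 / modular r"] by simp
  moreover have "(\<integral>t. u (t + r) / modular r \<partial>\<mu>) = 1"
    using integral_translate_right[OF u(1), of r] u(3) modular_pos[of r] by simp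
  ultimately show ?thesis
    using u(2) modular_pos[of r] by (auto simp: dominated_densities_def less_imp_le)
qed

text \<open>Families are indexed by the whole group, which makes them one subspace of a function
  type; the finite index set enters only through the seminorm.\<close>

definition Cc_families :: "('g \<Rightarrow> 'g \<Rightarrow> real) set"
  where "Cc_families = {F. \<forall>s. F s \<in> Cc}"

lemma subspace_Cc_families: "subspace Cc_families"
  by (auto simp: subspace_def Cc_families_def zero_fun_def plus_fun_def scaleR_fun_def Cc_zero Cc_add Cc_scale)

text \<open>A form on a finite product is the sum of its coordinate forms, obtained by placing
  \<open>v\<close> in slot \<open>s\<close> and zero elsewhere. On such a family the bound reduces
  to one L^1 norm, so each coordinate is an \<open>L1_functional\<close>.\<close>

lemma linear_form_families:
  assumes S: "finite S" and l: "linear_form_on Cc_families l"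
    and bd: "\<forall>F\<in>Cc_families. \<bar>l F\<bar> \<le> (\<Sum>s\<in>S. \<integral>t. \<bar>F s t\<bar> \<partial>\<mu>)"
  shows "\<And>s. s \<in> S \<Longrightarrow> L1_functional (\<lambda>v. l (\<lambda>s'. if s' = s then v else (\<lambda>_. 0)))"
    and "F \<in> Cc_families \<Longrightarrow> l (\<lambda>s. if s \<in> S then F s else (\<lambda>_. 0)) =
      (\<Sum>s\<in>S. l (\<lambda>s'. if s' = s then F s else (\<lambda>_. 0)))"
proof -
  have ladd: "l (\<lambda>s t. F s t + G s t) = l F + l G" if "F \<in> Cc_families" "G \<in> Cc_families" for F G
    using l that by (simp add: linear_form_on_def plus_fun_def)
  have lscale: "l (\<lambda>s t. c * F s t) = c * l F" if "F \<in> Cc_families" for c F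
    using l that by (simp add: linear_form_on_def scaleR_fun_def)
  have single: "(\<lambda>s'. if s' = s then v else (\<lambda>_. 0)) \<in> Cc_families" if "v \<in> Cc" for v s
    using that by (simp add: Cc_families_def Cc_zero)
  show "L1_functional (\<lambda>v. l (\<lambda>s'. if s' = s then v else (\<lambda>_. 0)))" if s: "s \<in> S" for s
    unfolding L1_functional_def
  proof (intro conjI ballI allI)
    fix u v :: "'g \<Rightarrow> real" assume uv: "u \<in> Cc" "v \<in> Cc"
    have "(\<lambda>s'. if s' = s then \<lambda>t. u t + v t else (\<lambda>_. 0)) =
      (\<lambda>s' t. (if s' = s then u else (\<lambda>_. 0)) t + (if s' = s then v else (\<lambda>_. 0)) t)"
      by (auto simp: fun_eq_iff)
    then show "l (\<lambda>s'. if s' = s then \<lambda>t. u t + v t else (\<lambda>_. 0)) =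
      l (\<lambda>s'. if s' = s then u else (\<lambda>_. 0)) + l (\<lambda>s'. if s' = s then v else (\<lambda>_. 0))"
      using ladd[OF single[OF uv(1)] single[OF uv(2)]] by simp
  next
    fix c and u :: "'g \<Rightarrow> real" assume u: "u \<in> Cc"
    have "(\<lambda>s'. if s' = s then \<lambda>t. c * u t else (\<lambda>_. 0)) =
      (\<lambda>s' t. c * (if s' = s then u else (\<lambda>_. 0)) t)"
      by (auto simp: fun_eq_iff)
    then show "l (\<lambda>s'. if s' = s then \<lambda>t. c * u t else (\<lambda>_. 0)) = c * l (\<lambda>s'. if s' = s then u else (\<lambda>_. 0))"
      using lscale[OF single[OF u]] by simp
  next
    fix u :: "'g \<Rightarrow> real" assume u: "u \<in> Cc"
    have "(\<Sum>r\<in>S. \<integral>t. \<bar>(if r = s then u else (\<lambda>_. 0)) t\<bar> \<partial>\<mu>) = (\<Sum>r\<in>S. if r = s then \<integral>t. \<bar>u t\<bar> \<partial>\<mu> else 0)"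
      by (intro sum.cong) auto
    then show "\<bar>l (\<lambda>s'. if s' = s then u else (\<lambda>_. 0))\<bar> \<le> (\<integral>t. \<bar>u t\<bar> \<partial>\<mu>)"
      using bspec[OF bd single[OF u, of s]] S s by simp
  qed
  show "l (\<lambda>s. if s \<in> S then F s else (\<lambda>_. 0)) = (\<Sum>s\<in>S. l (\<lambda>s'. if s' = s then F s else (\<lambda>_. 0)))"
    if F: "F \<in> Cc_families"
    using S
  proof (induction S)
    case empty
    show ?case using lscale[OF F, of 0] by simp
  next
    case (insert r T)
    have "(\<lambda>s. if s \<in> insert r T then F s else (\<lambda>_. 0)) =
      (\<lambda>s t. (if s = r then F r else (\<lambda>_. 0)) t + (if s \<in> T then F s else (\<lambda>_. 0)) t)"
      using insert.hyps by (auto simp: fun_eq_iff)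
    moreover have "(\<lambda>s. if s \<in> T then F s else (\<lambda>_. 0)) \<in> Cc_families" "F r \<in> Cc"
      using F by (auto simp: Cc_families_def Cc_zero)
    ultimately show ?case
      using insert ladd[OF single, of "F r" _ r] by simp
  qed
qed

text \<open>Day's convexity argument: if no density in the convex set \<open>dominated_densities u\<close> were
  almost invariant, a separating functional, averaged by the mean over the right translates
  of \<open>u\<close>, would contradict \<open>mean_right_average_eq\<close>.\<close>

lemma Reiter_finite:
  assumes am: "amenable \<mu>" and S: "finite S" and u: "u \<in> Cc" "\<And>t. 0 \<le> u t" "(\<integral>t. u t \<partial>\<mu>) = 1"
    and e: "0 < e"
  shows "\<exists>h\<in>dominated_densities u. \<forall>s\<in>S. (\<integral>t. \<bar>left_diff h s t\<bar> \<partial>\<mu>) < e"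
proof (rule ccontr)
  assume contra: "\<not> ?thesis"
  obtain m where m: "left_invariant_mean \<mu> m" using am by (auto simp: amenable_def)
  define q where "q F = (\<Sum>s\<in>S. \<integral>t. \<bar>F s t\<bar> \<partial>\<mu>)" for F :: "'g \<Rightarrow> 'g \<Rightarrow> real"
  define D where "D h = (\<lambda>s. if s \<in> S then left_diff h s else (\<lambda>_. 0))" for h :: "'g \<Rightarrow> real"
  have H_Cc: "h \<in> Cc" if "h \<in> dominated_densities u" for h
    using that by (simp add: dominated_densities_def)
  have D_V: "D h \<in> Cc_families" if "h \<in> Cc" for h
    using left_diff_Cc[OF that] by (simp add: D_def Cc_families_def Cc_zero)
  have q: "sublinear_on Cc_families q"
    unfolding sublinear_on_def
  proof (intro conjI ballI allI impI)
    fix F G assume FG: "F \<in> Cc_families" "G \<in> Cc_families"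
    have "(\<integral>t. \<bar>(F + G) s t\<bar> \<partial>\<mu>) \<le> (\<integral>t. \<bar>F s t\<bar> \<partial>\<mu>) + (\<integral>t. \<bar>G s t\<bar> \<partial>\<mu>)" for s
    proof -
      have FG': "F s \<in> Cc" "G s \<in> Cc" using FG by (auto simp: Cc_families_def)
      then have "(\<integral>t. \<bar>(F + G) s t\<bar> \<partial>\<mu>) \<le> (\<integral>t. \<bar>F s t\<bar> + \<bar>G s t\<bar> \<partial>\<mu>)"
        by (intro integral_mono Cc_integrable Cc_abs Cc_add) (auto simp: plus_fun_def Cc_add Cc_abs intro!: Cc_abs Cc_integrable)
      then show ?thesis using FG' by (simp add: Cc_integrable)
    qed
    then show "q (F + G) \<le> q F + q G"
      unfolding q_def by (simp add: sum_mono flip: sum.distrib)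
  next
    fix c :: real and F :: "'g \<Rightarrow> 'g \<Rightarrow> real" assume "0 < c"
    then show "q (c *\<^sub>R F) \<le> c * q F"
      by (simp add: q_def sum_distrib_left abs_mult)
  qed
  have qe: "e \<le> q F" if F: "F \<in> D ` dominated_densities u" for F
  proof -
    obtain h where h: "h \<in> dominated_densities u" "F = D h" using F by blast
    then obtain s where s: "s \<in> S" "e \<le> (\<integral>t. \<bar>left_diff h s t\<bar> \<partial>\<mu>)"
      using contra by fastforce
    note s(2)
    also have "(\<integral>t. \<bar>left_diff h s t\<bar> \<partial>\<mu>) \<le> (\<Sum>s\<in>S. \<integral>t. \<bar>left_diff h s t\<bar> \<partial>\<mu>)"
      using S s(1) by (intro member_le_sum[of s]) auto
    also have "\<dots> = q F" by (simp add: q_def h D_def)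
    finally show ?thesis .
  qed
  have conv: "convex (D ` dominated_densities u)"
    unfolding convex_def
  proof (intro ballI allI impI)
    fix F G and a b :: real
    assume FG: "F \<in> D ` dominated_densities u" "G \<in> D ` dominated_densities u" and ab: "0 \<le> a" "0 \<le> b" "a + b = 1"
    then obtain h k where hk: "h \<in> dominated_densities u" "F = D h" "k \<in> dominated_densities u" "G = D k" by blast
    have "a *\<^sub>R F + b *\<^sub>R G = D (\<lambda>t. a * h t + b * k t)"
      by (auto simp: hk D_def left_diff_def fun_eq_iff algebra_simps)
    then show "a *\<^sub>R F + b *\<^sub>R G \<in> D ` dominated_densities u"
      using dominated_densities_convex[OF hk(1,3) ab] by blast
  qed
  have ne: "D ` dominated_densities u \<noteq> {}"
    using dominated_densities_translate[OF u, of 0] by blast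
  have sub: "D ` dominated_densities u \<subseteq> Cc_families" using D_V H_Cc by blast
  have q_neg: "q (- F) = q F" for F by (simp add: q_def)
  obtain l where l: "linear_form_on Cc_families l" "\<And>F. F \<in> Cc_families \<Longrightarrow> \<bar>l F\<bar> \<le> q F"
      "\<And>F. F \<in> D ` dominated_densities u \<Longrightarrow> e \<le> l F"
    using Hahn_Banach_separation[OF subspace_Cc_families q q_neg conv sub ne qe] by blast
  define \<Lambda> where "\<Lambda> s v = l (\<lambda>s'. if s' = s then v else (\<lambda>_. 0))" for s v
  have "\<forall>F\<in>Cc_families. \<bar>l F\<bar> \<le> (\<Sum>s\<in>S. \<integral>t. \<bar>F s t\<bar> \<partial>\<mu>)" using l(2) by (simp add: q_def)
  note fam = linear_form_families[OF S l(1) this, folded \<Lambda>_def]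
  have \<Lambda>: "L1_functional (\<Lambda> s)" if "s \<in> S" for s
    using fam(1)[OF that] by (simp add: \<Lambda>_def[abs_def])
  define w where "w s = (\<lambda>t. u (- s + t))" for s
  have w: "w s \<in> Cc" for s unfolding w_def by (rule Cc_translate_left[OF u(1)])
  have wint: "(\<integral>t. w s t \<partial>\<mu>) = (\<integral>t. u t \<partial>\<mu>)" for s
    unfolding w_def by (rule integral_translate[OF Cc_measurable[OF u(1)]])
  \<comment> \<open>This is the value of \<open>\<Lambda> s\<close> at the left difference by
    \<open>s\<close> of the normalized right translate of \<open>u\<close> by \<open>- t\<close>.
    Its mean over \<open>t\<close> vanishes because \<open>w s\<close> and \<open>u\<close> have
    equal integrals.\<close>
  define \<phi> where "\<phi> s t = right_average (\<Lambda> s) (w s) t + - 1 * right_average (\<Lambda> s) u t" for s t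
  have \<phi>: "\<phi> s \<in> Linfty \<mu>" "m (\<phi> s) = 0" if s: "s \<in> S" for s
  proof -
    note L = right_average_Linfty(2)[OF \<Lambda>[OF s] w[of s]] right_average_Linfty(2)[OF \<Lambda>[OF s] u(1)]
    show "\<phi> s \<in> Linfty \<mu>"
      unfolding \<phi>_def[abs_def] by (intro Linfty_add Linfty_scale L)
    have "m (\<phi> s) = m (right_average (\<Lambda> s) (w s)) + - 1 * m (right_average (\<Lambda> s) u)"
      unfolding \<phi>_def[abs_def] using mean_add[OF m L(1) Linfty_scale[OF L(2), of "- 1"]] mean_scale[OF m L(2), of "- 1"] by simp
    then show "m (\<phi> s) = 0"
      using mean_right_average_eq[OF m \<Lambda>[OF s] w[of s] u(1) wint] by simp
  qed
  \<comment> \<open>For each \<open>t\<close> the sum is \<open>l\<close> evaluated on a member of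
    the separated convex set.\<close>
  have ge: "e \<le> (\<Sum>s\<in>S. \<phi> s t)" for t
  proof -
    define h where "h = (\<lambda>r. u (r + - t) / modular (- t))"
    have h: "h \<in> dominated_densities u"
      unfolding h_def by (rule dominated_densities_translate[OF u])
    then have "e \<le> l (D h)" by (intro l(3) imageI)
    also have "\<dots> = (\<Sum>s\<in>S. \<Lambda> s (left_diff h s))"
      unfolding D_def using left_diff_Cc[OF H_Cc[OF h]] by (intro fam(2)) (simp add: Cc_families_def)
    also have "\<dots> = (\<Sum>s\<in>S. \<phi> s t)"
    proof (rule sum.cong)
      fix s assume s: "s \<in> S"
      let ?c = "1 / modular (- t)"
      have eq: "left_diff h s = (\<lambda>r. ?c * w s (r + - t) - ?c * u (r + - t))"
        by (auto simp: left_diff_def h_def w_def add.assoc fun_eq_iff simp del: add_uminus_conv_diff)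
      have tr: "(\<lambda>r. w s (r + - t)) \<in> Cc" "(\<lambda>r. u (r + - t)) \<in> Cc"
        by (intro Cc_translate_right w u)+
      have scale: "\<Lambda> s (\<lambda>r. ?c * v r) = ?c * \<Lambda> s v" if "v \<in> Cc" for v
        using \<Lambda>[OF s] that unfolding L1_functional_def by metis
      have "\<Lambda> s (left_diff h s) = ?c * \<Lambda> s (\<lambda>r. w s (r + - t)) - ?c * \<Lambda> s (\<lambda>r. u (r + - t))"
        unfolding eq L1_functional_diff[OF \<Lambda>[OF s] Cc_scale[OF tr(1)] Cc_scale[OF tr(2)]]
        by (simp only: scale[OF tr(1)] scale[OF tr(2)])
      then show "\<Lambda> s (left_diff h s) = \<phi> s t"
        by (simp add: \<phi>_def right_average_def)
    qed simp
    finally show ?thesis .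
  qed
  have "(\<lambda>t. \<Sum>s\<in>T. \<phi> s t) \<in> Linfty \<mu> \<and> m (\<lambda>t. \<Sum>s\<in>T. \<phi> s t) = 0" if "T \<subseteq> S" for T
    using finite_subset[OF that S] that
  proof (induction T)
    case empty
    then show ?case using Linfty_const mean_const[OF m] by simp
  next
    case (insert s T)
    then show ?case using \<phi>[of s] by (simp add: Linfty_add mean_add[OF m])
  qed
  then have sum: "(\<lambda>t. \<Sum>s\<in>S. \<phi> s t) \<in> Linfty \<mu>" "m (\<lambda>t. \<Sum>s\<in>S. \<phi> s t) = 0" by auto
  \<comment> \<open>A function that is everywhere at least \<open>e\<close> cannot have mean zero.
    The sign is changed because \<open>mean_le_const\<close> bounds means from above.\<close>
  have "m (\<lambda>t. - 1 * (\<Sum>s\<in>S. \<phi> s t)) \<le> - e"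
    using ge by (intro mean_le_const[OF m] Linfty_scale sum) (simp add: le_minus_iff)
  then show False
    using mean_scale[OF m sum(1), of "- 1"] sum(2) e by simp
qed

text \<open>Cover \<open>K\<close> by finitely many sets on which left translation moves
  \<open>u\<close> by at most \<open>e / 2\<close> in L^1. By domination it moves \<open>h\<close>
  no more, and at the centres \<open>Reiter_finite\<close> supplies the other half.\<close>

theorem Reiter_compact:
  assumes am: "amenable \<mu>" and K: "compact K" and e: "0 < e"
  obtains h where "h \<in> Cc" "\<And>t. 0 \<le> h t" "(\<integral>t. h t \<partial>\<mu>) = 1" "\<And>s. s \<in> K \<Longrightarrow> (\<integral>t. \<bar>h (- s + t) - h t\<bar> \<partial>\<mu>) \<le> e"
proof -
  define u where "u = (\<lambda>t. (1 / (\<integral>t. reference t \<partial>\<mu>)) * reference t)"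
  have u: "u \<in> Cc" "\<And>t. 0 \<le> u t" "(\<integral>t. u t \<partial>\<mu>) = 1"
    using reference by (auto simp: u_def intro!: Cc_scale[of reference "1 / (\<integral>t. reference t \<partial>\<mu>)", simplified])
  have "\<exists>U. open U \<and> s0 \<in> U \<and> (\<forall>s\<in>U. (\<integral>t. \<bar>u (- s + t) - u (- s0 + t)\<bar> \<partial>\<mu>) \<le> e / 2)" for s0
    by (rule continuous_left_translates[OF u(1), of "e / 2" s0]) (use e in auto)
  then obtain U where U: "\<And>s0. open (U s0)" "\<And>s0. s0 \<in> U s0"
      "\<And>s0 s. s \<in> U s0 \<Longrightarrow> (\<integral>t. \<bar>u (- s + t) - u (- s0 + t)\<bar> \<partial>\<mu>) \<le> e / 2"
    by metis
  obtain S where S: "finite S" "K \<subseteq> (\<Union>s\<in>S. U s)"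
    by (rule compactE_image[OF K, of K U]) (use U in auto)
  obtain h where h: "h \<in> dominated_densities u" "\<And>s. s \<in> S \<Longrightarrow> (\<integral>t. \<bar>left_diff h s t\<bar> \<partial>\<mu>) < e / 2"
    using Reiter_finite[OF am S(1) u, of "e / 2"] e by auto
  have Cc: "h \<in> Cc" using h(1) by (simp add: dominated_densities_def)
  have "(\<integral>t. \<bar>h (- s + t) - h t\<bar> \<partial>\<mu>) \<le> e" if s: "s \<in> K" for s
  proof -
    obtain s0 where s0: "s0 \<in> S" "s \<in> U s0" using S(2) s by blast
    have "(\<integral>t. \<bar>h (- s + t) - h t\<bar> \<partial>\<mu>) \<le> (\<integral>t. \<bar>h (- s + t) - h (- s0 + t)\<bar> + \<bar>left_diff h s0 t\<bar> \<partial>\<mu>)"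
      by (intro integral_mono Cc_integrable Cc_add Cc_abs Cc_diff Cc_translate_left left_diff_Cc Cc) (simp add: left_diff_def)
    also have "\<dots> = (\<integral>t. \<bar>h (- s + t) - h (- s0 + t)\<bar> \<partial>\<mu>) + (\<integral>t. \<bar>left_diff h s0 t\<bar> \<partial>\<mu>)"
      by (intro Bochner_Integration.integral_add Cc_integrable Cc_abs Cc_diff Cc_translate_left left_diff_Cc Cc)
    also have "\<dots> \<le> e / 2 + e / 2"
    proof (rule add_mono)
      have "(\<integral>t. \<bar>h (- s + t) - h (- s0 + t)\<bar> \<partial>\<mu>) \<le> (\<integral>t. \<bar>u (- s + t) - u (- s0 + t)\<bar> \<partial>\<mu>)"
        using h(1) unfolding dominated_densities_def by blast
      then show "(\<integral>t. \<bar>h (- s + t) - h (- s0 + t)\<bar> \<partial>\<mu>) \<le> e / 2"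
        using U(3)[OF s0(2)] by simp
    qed (use h(2)[OF s0(1)] in simp)
    finally show ?thesis by simp
  qed
  then show thesis
    using that[of h] h(1) by (auto simp: dominated_densities_def)
qed

section \<open>Integration against \<open>f\<close> beyond the sigma-finite case\<close>

text \<open>Each set where \<open>f\<close> is at least \<open>1 / Suc n\<close> has finite measure
  by Markov's inequality, so outer regularity encloses it in an open set of finite measure, which
  inner regularity exhausts by compact sets up to a null set. Finiteness is what allows the measures
  to be subtracted.\<close>

lemma sigma_compact_support:
  fixes f :: "'g \<Rightarrow> real"
  assumes f: "integrable \<mu> f" "\<And>s. 0 \<le> f s"
  obtains Z :: "nat \<Rightarrow> 'g set" where "\<And>n. compact (Z n)" "incseq Z" "AE s in \<mu>. s \<notin> (\<Union>n. Z n) \<longrightarrow> f s = 0"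
proof -
  have "\<exists>K :: nat \<Rightarrow> 'g set. (\<forall>m. compact (K m)) \<and> {s. f s \<ge> 1 / Suc n} - (\<Union>m. K m) \<in> null_sets \<mu>" for n :: nat
  proof -
    let ?A = "{s. f s \<ge> 1 / Suc n}"
    have A: "?A \<in> sets borel"
      using borel_measurable_integrable[OF f(1)] by simp
    have "emeasure \<mu> {s \<in> space \<mu>. f s \<ge> 1 / Suc n} \<le> ennreal (1 / (1 / Suc n) * (\<integral>s. f s \<partial>\<mu>))"
      by (rule integral_Markov_inequality[OF f(1)]) (use f(2) in auto)
    then have "emeasure \<mu> ?A < \<infinity>"
      by (simp add: le_less_trans[OF _ ennreal_less_top])
    moreover have "emeasure \<mu> ?A = (INF U\<in>{U. open U \<and> ?A \<subseteq> U}. emeasure \<mu> U)"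
      using haar A unfolding left_haar_measure_def by blast
    ultimately obtain U where U: "open U" "?A \<subseteq> U" "emeasure \<mu> U < \<infinity>"
      by (auto simp: INF_less_iff)
    have SUP: "emeasure \<mu> U = (SUP K\<in>{K. compact K \<and> K \<subseteq> U}. emeasure \<mu> K)"
      using haar U(1) unfolding left_haar_measure_def by blast
    have "{} \<in> {K. compact K \<and> K \<subseteq> U}" by simp
    then have "{K. compact K \<and> K \<subseteq> U} \<noteq> {}" by blast
    from ennreal_SUP_countable_SUP[OF this, of "emeasure \<mu>"]
    obtain g :: "nat \<Rightarrow> ennreal" where g: "range g \<subseteq> emeasure \<mu> ` {K. compact K \<and> K \<subseteq> U}"
      "(SUP K\<in>{K. compact K \<and> K \<subseteq> U}. emeasure \<mu> K) = (SUP m. g m)" by auto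
    have "\<exists>K. compact K \<and> K \<subseteq> U \<and> emeasure \<mu> K = g m" for m
    proof -
      have "g m \<in> emeasure \<mu> ` {K. compact K \<and> K \<subseteq> U}" using g(1) by blast
      then show ?thesis by auto
    qed
    then obtain K where K: "\<And>m. compact (K m)" "\<And>m. K m \<subseteq> U" "\<And>m. emeasure \<mu> (K m) = g m" by metis
    have Kb: "(\<Union>m. K m) \<in> sets borel" using K(1) borel_compact by blast
    have "emeasure \<mu> U \<le> emeasure \<mu> (\<Union>m. K m)"
      unfolding SUP g(2) using Kb by (intro SUP_least) (auto simp flip: K(3) intro!: emeasure_mono)
    moreover have "emeasure \<mu> (U - (\<Union>m. K m)) = emeasure \<mu> U - emeasure \<mu> (\<Union>m. K m)"
    proof (rule emeasure_Diff)
      show sub: "(\<Union>m. K m) \<subseteq> U" using K(2) by blast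
      then have "emeasure \<mu> (\<Union>m. K m) \<le> emeasure \<mu> U" using U(1) by (intro emeasure_mono) auto
      then show "emeasure \<mu> (\<Union>m. K m) \<noteq> \<infinity>" using U(3) by (auto simp: top_unique)
    qed (use Kb U(1) in auto)
    ultimately have "emeasure \<mu> (U - (\<Union>m. K m)) = 0"
      by (simp add: diff_eq_0_iff_ennreal) (metis U(3) diff_eq_0_iff_ennreal infinity_ennreal_def)
    then have "U - (\<Union>m. K m) \<in> null_sets \<mu>" using U(1) Kb by (auto simp: null_sets_def)
    moreover have "?A - (\<Union>m. K m) \<in> sets \<mu>" using A Kb by auto
    ultimately have "?A - (\<Union>m. K m) \<in> null_sets \<mu>"
      by (rule null_sets_subset) (use U(2) in blast)
    then show ?thesis using K(1) by (intro exI[of _ K] conjI allI)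
  qed
  then obtain K :: "nat \<Rightarrow> nat \<Rightarrow> 'g set" where K: "\<And>n m. compact (K n m)"
      "\<And>n. {s. f s \<ge> 1 / Suc n} - (\<Union>m. K n m) \<in> null_sets \<mu>"
    by metis
  \<comment> \<open>The double sequence is enumerated through \<open>prod_decode\<close>, and
    initial unions make it increasing.\<close>
  define Z where "Z j = (\<Union>i\<le>j. case prod_decode i of (n, m) \<Rightarrow> K n m)" for j
  have Z: "K n m \<subseteq> (\<Union>j. Z j)" for n m
  proof -
    have "K n m \<subseteq> Z (prod_encode (n, m))"
      unfolding Z_def by (rule order_trans[OF _ UN_upper[of "prod_encode (n, m)"]]) auto
    then show ?thesis by blast
  qed
  have "(\<Union>n. {s. f s \<ge> 1 / Suc n} - (\<Union>m. K n m)) \<in> null_sets \<mu>"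
    using K(2) by (intro null_sets_UN) auto
  then have "AE s in \<mu>. s \<notin> (\<Union>n. {s. f s \<ge> 1 / Suc n} - (\<Union>m. K n m))"
    by (rule AE_not_in)
  then have "AE s in \<mu>. s \<notin> (\<Union>n. Z n) \<longrightarrow> f s = 0"
  proof eventually_elim
    case (elim s)
    show ?case
    proof
      assume s: "s \<notin> (\<Union>n. Z n)"
      then have "f s < 1 / Suc n" for n using elim Z by (force simp: not_le)
      then have "f s \<le> 0"
        by (meson nat_approx_posE not_le order_less_asym)
      then show "f s = 0" using f(2)[of s] by simp
    qed
  qed
  moreover have "compact (Z n)" for n
    unfolding Z_def using K(1) by (intro compact_UN) (auto split: prod.split)
  moreover have "incseq Z"
    unfolding incseq_def Z_def by (intro allI impI UN_mono) auto
  ultimately show thesis using that by blast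
qed

text \<open>For \<open>s\<close> in a small piece of \<open>K\<close>, \<open>F s\<close> is
  uniformly close to a fixed section, so the function is a uniform limit of finite sums of products
  of one-variable Borel functions. Joint continuity alone gives Borel sets of the product topology,
  which may lie outside the product sigma-algebra.\<close>

lemma product_measurable:
  fixes F :: "'g \<Rightarrow> 'g \<Rightarrow> real"
  assumes F: "continuous_on UNIV (\<lambda>(s, t). F s t)"
    and supp: "\<And>K. compact K \<Longrightarrow> \<exists>L. compact L \<and> (\<forall>s\<in>K. \<forall>t. t \<notin> L \<longrightarrow> F s t = 0)"
    and K: "compact K"
  shows "(\<lambda>(s, t). indicator K s * F s t) \<in> borel_measurable (borel \<Otimes>\<^sub>M borel)"
proof -
  have "\<exists>U. open U \<and> s0 \<in> U \<and> (\<forall>s\<in>U. \<forall>t. \<bar>F s t - F s0 t\<bar> \<le> e)" if e: "0 < e" for s0 e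
  proof -
    obtain N C where N: "open N" "compact C" "s0 \<in> N" "N \<subseteq> C"
      by (rule locally_compact_nhd[OF locally_compact open_UNIV UNIV_I, of s0])
    obtain L where L: "compact L" "\<And>s t. s \<in> C \<Longrightarrow> t \<notin> L \<Longrightarrow> F s t = 0" using supp[OF N(2)] by blast
    show ?thesis
      by (rule uniformly_small_near[OF F N(1,3) L(1) _ e]) (use L(2) N(4) in blast)+
  qed
  note unif = this
  have "\<exists>G. G \<in> borel_measurable (borel \<Otimes>\<^sub>M borel) \<and> (\<forall>s t. \<bar>indicator K s * F s t - G (s, t)\<bar> \<le> 1 / Suc k)" for k :: nat
  proof -
    define e where "e = 1 / real (Suc k)"
    have e: "0 < e" by (simp add: e_def)
    obtain U where U: "\<And>x. open (U x) \<and> x \<in> U x" "\<And>x0 x y. x \<in> U x0 \<Longrightarrow> \<bar>F x y - F x0 y\<bar> \<le> e"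
      using unif[OF e] by metis
    obtain n :: nat and x A where A: "\<And>i. i < n \<Longrightarrow> x i \<in> K" "\<And>i. i < n \<Longrightarrow> A i \<in> sets borel"
      "\<And>i. i < n \<Longrightarrow> A i \<subseteq> U (x i)" "disjoint_family_on A {..<n}" "(\<Union>i<n. A i) = K"
      using compact_Borel_partition[OF K, of U] U(1) by metis
    define G where "G = (\<lambda>(s, t). \<Sum>i<n. indicator (A i) s * F (x i) t)"
    have [measurable]: "F s \<in> borel_measurable borel" for s
      by (intro borel_measurable_continuous_onI continuous_section(1)[OF F])
    have "G \<in> borel_measurable (borel \<Otimes>\<^sub>M borel)"
      unfolding G_def split_beta
    proof (intro borel_measurable_sum borel_measurable_times)
      fix i assume "i \<in> {..<n}"
      then have [measurable]: "A i \<in> sets borel" using A(2) by simp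
      show "(\<lambda>p. indicator (A i) (fst p) :: real) \<in> borel_measurable (borel \<Otimes>\<^sub>M borel)" by measurable
      show "(\<lambda>p. F (x i) (snd p)) \<in> borel_measurable (borel \<Otimes>\<^sub>M borel)" by measurable
    qed
    moreover have "\<bar>indicator K s * F s t - G (s, t)\<bar> \<le> 1 / Suc k" for s t
    proof (cases "s \<in> K")
      case True
      then obtain j where j: "j < n" "s \<in> A j" using A(5) by blast
      have "indicator (A i) s = (if i = j then 1 else 0 :: real)" if "i < n" for i
        using A(4) j that by (auto simp: disjoint_family_on_def indicator_def)
      then have "G (s, t) = (\<Sum>i<n. if i = j then F (x j) t else 0)"
        unfolding G_def prod.case by (intro sum.cong) auto
      then have "G (s, t) = F (x j) t" using j(1) by simp
      then show ?thesis using U(2)[of s "x j" t] A(3)[OF j(1)] j(2) True by (auto simp: e_def)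
    next
      case False
      then have "G (s, t) = 0"
        unfolding G_def using A(5) by (auto intro!: sum.neutral simp: indicator_def)
      then show ?thesis using False by simp
    qed
    ultimately show ?thesis by blast
  qed
  then obtain G where G: "\<And>k. G k \<in> borel_measurable (borel \<Otimes>\<^sub>M borel)"
      "\<And>k s t. \<bar>indicator K s * F s t - G k (s, t)\<bar> \<le> 1 / Suc k"
    by metis
  show ?thesis
  proof (rule borel_measurable_LIMSEQ_real[where u = G])
    fix p :: "'g \<times> 'g"
    obtain s t where p: "p = (s, t)" by fastforce
    show "(\<lambda>k. G k p) \<longlonglongrightarrow> (case p of (s, t) \<Rightarrow> indicator K s * F s t)"
    proof (rule LIMSEQ_I)
      fix r :: real assume "0 < r"
      then obtain N :: nat where N: "1 / Suc N < r" using nat_approx_posE by blast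
      have "norm (G k p - (case p of (s, t) \<Rightarrow> indicator K s * F s t)) < r" if "N \<le> k" for k
      proof -
        have "1 / Suc k \<le> 1 / Suc N" using that by (simp add: frac_le)
        then show ?thesis using G(2)[of s t k] N by (simp add: p abs_minus_commute)
      qed
      then show "\<exists>N. \<forall>k\<ge>N. norm (G k p - (case p of (s, t) \<Rightarrow> indicator K s * F s t)) < r" by blast
    qed
  qed (rule G(1))
qed

text \<open>The library's Tonelli theorem does not apply directly: \<open>\<mu>\<close> need not be \<open>\<sigma>\<close>-finite and \<open>F\<close>
  need not be measurable for the product \<open>\<sigma>\<close>-algebra. Both hold after restriction to
  \<open>\<sigma>\<close>-compact sets.\<close>

lemma Tonelli_weighted:
  fixes F :: "'g \<Rightarrow> 'g \<Rightarrow> real" and f :: "'g \<Rightarrow> real"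
  assumes F: "continuous_on UNIV (\<lambda>(s, t). F s t)" "\<And>s t. 0 \<le> F s t"
    and supp: "\<And>K. compact K \<Longrightarrow> \<exists>L. compact L \<and> (\<forall>s\<in>K. \<forall>t. t \<notin> L \<longrightarrow> F s t = 0)"
    and f: "integrable \<mu> f" "\<And>s. 0 \<le> f s"
  shows "(\<integral>\<^sup>+t. (\<integral>\<^sup>+s. ennreal (f s * F s t) \<partial>\<mu>) \<partial>\<mu>) \<le> (\<integral>\<^sup>+s. ennreal (f s) * (\<integral>\<^sup>+t. ennreal (F s t) \<partial>\<mu>) \<partial>\<mu>)"
proof -
  obtain Z :: "nat \<Rightarrow> 'g set" where Z: "\<And>n. compact (Z n)" "incseq Z" "AE s in \<mu>. s \<notin> (\<Union>n. Z n) \<longrightarrow> f s = 0"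
    by (rule sigma_compact_support[OF f]) blast
  obtain L where L: "\<And>n. compact (L n)" "\<And>n s t. s \<in> Z n \<Longrightarrow> t \<notin> L n \<Longrightarrow> F s t = 0"
    using supp[OF Z(1)] by metis
  define T where "T = (\<Union>n. L n)"
  have T[measurable]: "T \<in> sets borel" unfolding T_def using L(1) borel_compact by blast
  define W where "W = (\<Union>n. Z n)"
  have W[measurable]: "W \<in> sets borel" unfolding W_def using Z(1) borel_compact by blast
  have FT: "F s t = 0" if "s \<in> W" "t \<notin> T" for s t using that L(2) by (auto simp: W_def T_def)
  have [measurable]: "f \<in> borel_measurable borel" using borel_measurable_integrable[OF f(1)] by simp
  define G where "G s t = indicator W s * F s t" for s t
  have G: "(\<lambda>(s, t). G s t) \<in> borel_measurable (borel \<Otimes>\<^sub>M borel)"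
  proof (rule borel_measurable_LIMSEQ_real)
    show "(\<lambda>(s, t). indicator (Z n) s * F s t) \<in> borel_measurable (borel \<Otimes>\<^sub>M borel)" for n
      by (rule product_measurable[OF F(1) supp Z(1)])
    fix p :: "'g \<times> 'g"
    obtain s t where p: "p = (s, t)" by fastforce
    have "(\<lambda>n. indicator (Z n) s :: real) \<longlonglongrightarrow> indicator W s"
      unfolding W_def by (rule LIMSEQ_indicator_incseq[OF Z(2)])
    then show "(\<lambda>n. case p of (s, t) \<Rightarrow> indicator (Z n) s * F s t) \<longlonglongrightarrow> (case p of (s, t) \<Rightarrow> G s t)"
      by (simp add: p G_def tendsto_mult_right)
  qed
  \<comment> \<open>Taking \<open>f\<close> as a density makes the first measure finite. The second
    is \<mu> restricted to \<open>T\<close>, a countable union of compact sets off which every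
    \<open>F s\<close> with \<open>s \<in> W\<close> vanishes.\<close>
  define M1 where "M1 = density \<mu> (\<lambda>s. ennreal (f s))"
  define M2 where "M2 = density \<mu> (indicator T)"
  have sets1 [measurable_cong, simp]: "sets M1 = sets borel" and sets2 [measurable_cong, simp]: "sets M2 = sets borel"
    by (simp_all add: M1_def M2_def)
  have "emeasure M1 (space M1) = (\<integral>\<^sup>+s. ennreal (f s) \<partial>\<mu>)"
    unfolding M1_def by (subst emeasure_density) (auto intro!: nn_integral_cong)
  also have "\<dots> < \<infinity>" using f by (simp add: nn_integral_eq_integral)
  finally interpret M1: finite_measure M1 by (intro finite_measureI) auto
  interpret M2: sigma_finite_measure M2
  proof
    have fin: "emeasure M2 (L n) \<noteq> \<infinity>" for n
    proof -
      have "emeasure M2 (L n) = (\<integral>\<^sup>+t. indicator T t * indicator (L n) t \<partial>\<mu>)"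
        unfolding M2_def using borel_compact[OF L(1)] by (subst emeasure_density) auto
      also have "\<dots> \<le> (\<integral>\<^sup>+t. indicator (L n) t \<partial>\<mu>)"
        by (intro nn_integral_mono) (auto simp: indicator_def)
      also have "\<dots> < \<infinity>" using borel_compact[OF L(1)] emeasure_compact[OF L(1)] by simp
      finally show ?thesis by simp
    qed
    have "emeasure M2 (- T) = (\<integral>\<^sup>+t. indicator T t * indicator (- T) t \<partial>\<mu>)"
      unfolding M2_def by (subst emeasure_density) auto
    also have "\<dots> = 0" by (auto simp: indicator_def nn_integral_0_iff_AE)
    finally have "emeasure M2 (- T) = 0" .
    then show "\<exists>A. countable A \<and> A \<subseteq> sets M2 \<and> \<Union>A = space M2 \<and> (\<forall>a\<in>A. emeasure M2 a \<noteq> \<infinity>)"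
      using fin borel_compact[OF L(1)] sets_eq_imp_space_eq[OF sets2]
      by (intro exI[of _ "insert (- T) (range L)"]) (auto simp: T_def)
  qed
  interpret pair_sigma_finite M1 M2 ..
  have Gm: "(\<lambda>(s, t). ennreal (G s t)) \<in> borel_measurable (M1 \<Otimes>\<^sub>M M2)"
    using measurable_compose[OF G measurable_ennreal] by (simp add: split_beta cong: measurable_cong_sets)
  have Gs: "(\<lambda>s. G s t) \<in> borel_measurable borel" "(\<lambda>t. G s t) \<in> borel_measurable borel" for s t
    using measurable_compose[OF measurable_Pair2' G] measurable_compose[OF measurable_Pair1' G] by auto
  have "(\<integral>\<^sup>+t. (\<integral>\<^sup>+s. ennreal (f s * F s t) \<partial>\<mu>) \<partial>\<mu>) = (\<integral>\<^sup>+t. indicator T t * (\<integral>\<^sup>+s. ennreal (G s t) \<partial>M1) \<partial>\<mu>)"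
  proof (rule nn_integral_cong)
    fix t
    have "(\<integral>\<^sup>+s. ennreal (f s * F s t) \<partial>\<mu>) = (\<integral>\<^sup>+s. ennreal (f s) * ennreal (G s t) \<partial>\<mu>)"
      using Z(3) by (intro nn_integral_cong_AE, eventually_elim)
        (auto simp: G_def W_def f(2) F(2) ennreal_mult indicator_def)
    also have "\<dots> = (\<integral>\<^sup>+s. ennreal (G s t) \<partial>M1)"
      unfolding M1_def using Gs by (subst nn_integral_density) auto
    also have "\<dots> = indicator T t * \<dots>"
    proof (cases "t \<in> T")
      case False
      then have "G s t = 0" for s using FT[of s t] by (auto simp: G_def indicator_def)
      then show ?thesis by simp
    qed simp
    finally show "(\<integral>\<^sup>+s. ennreal (f s * F s t) \<partial>\<mu>) = indicator T t * (\<integral>\<^sup>+s. ennreal (G s t) \<partial>M1)" .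
  qed
  also have "\<dots> = (\<integral>\<^sup>+t. (\<integral>\<^sup>+s. ennreal (G s t) \<partial>M1) \<partial>M2)"
  proof -
    have "(\<lambda>t. \<integral>\<^sup>+s. ennreal (G s t) \<partial>M1) \<in> borel_measurable borel"
      using M1.borel_measurable_nn_integral[of "\<lambda>t s. ennreal (G s t)" borel] Gm
      by (subst (asm) measurable_pair_swap_iff) (simp add: split_beta cong: measurable_cong_sets)
    then show ?thesis unfolding M2_def by (subst nn_integral_density) auto
  qed
  also have "\<dots> = (\<integral>\<^sup>+s. (\<integral>\<^sup>+t. ennreal (G s t) \<partial>M2) \<partial>M1)"
    by (rule Fubini'[OF Gm])
  also have "\<dots> = (\<integral>\<^sup>+s. ennreal (f s) * (\<integral>\<^sup>+t. ennreal (G s t) \<partial>M2) \<partial>\<mu>)"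
  proof -
    have "(\<lambda>s. \<integral>\<^sup>+t. ennreal (G s t) \<partial>M2) \<in> borel_measurable borel"
      using M2.borel_measurable_nn_integral[of "\<lambda>s t. ennreal (G s t)" borel] Gm
      by (simp cong: measurable_cong_sets)
    then show ?thesis unfolding M1_def by (subst nn_integral_density) auto
  qed
  \<comment> \<open>Removing the restrictions to \<open>W\<close> and \<open>T\<close> can only
    increase the integral.\<close>
  also have "\<dots> \<le> (\<integral>\<^sup>+s. ennreal (f s) * (\<integral>\<^sup>+t. ennreal (F s t) \<partial>\<mu>) \<partial>\<mu>)"
  proof (intro nn_integral_mono mult_left_mono)
    fix s
    have "(\<integral>\<^sup>+t. ennreal (G s t) \<partial>M2) = (\<integral>\<^sup>+t. indicator T t * ennreal (G s t) \<partial>\<mu>)"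
      unfolding M2_def using Gs by (subst nn_integral_density) auto
    also have "\<dots> \<le> (\<integral>\<^sup>+t. ennreal (F s t) \<partial>\<mu>)"
      using F(2) by (intro nn_integral_mono) (auto simp: G_def indicator_def)
    finally show "(\<integral>\<^sup>+t. ennreal (G s t) \<partial>M2) \<le> (\<integral>\<^sup>+t. ennreal (F s t) \<partial>\<mu>)" .
  qed simp
  finally show ?thesis .
qed

text \<open>After interchanging the integrals, the inner one is at most \<open>d\<close> for
  \<open>s\<close> in a large compact \<open>Z n\<close>, by \<open>Reiter_compact\<close>.
  Elsewhere it is at most 2, as \<open>h\<close> and its left translate both have integral one, and
  there the remaining mass of \<open>f\<close> is below \<open>d\<close>.\<close>

theorem Reiter_weighted:
  fixes f :: "'g \<Rightarrow> real"
  assumes am: "amenable \<mu>" and f: "integrable \<mu> f" "\<And>s. 0 \<le> f s" and e: "0 < e"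
  obtains h where "h \<in> Cc" "\<And>t. 0 \<le> h t" "(\<integral>t. h t \<partial>\<mu>) = 1"
    "(\<integral>\<^sup>+t. (\<integral>\<^sup>+s. ennreal (f s * \<bar>h (- s + t) - h t\<bar>) \<partial>\<mu>) \<partial>\<mu>) \<le> ennreal e"
proof -
  obtain Z :: "nat \<Rightarrow> 'g set" where Z: "\<And>n. compact (Z n)" "incseq Z" "AE s in \<mu>. s \<notin> (\<Union>n. Z n) \<longrightarrow> f s = 0"
    by (rule sigma_compact_support[OF f]) blast
  have [measurable]: "f \<in> borel_measurable borel" using borel_measurable_integrable[OF f(1)] by simp
  have [measurable]: "Z n \<in> sets borel" for n using Z(1) borel_compact by blast
  have "(\<lambda>n. \<integral>s. f s * indicator (- Z n) s \<partial>\<mu>) \<longlonglongrightarrow> (\<integral>s. f s * indicator (- (\<Union>n. Z n)) s \<partial>\<mu>)"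
  proof (rule integral_dominated_convergence[where w = f])
    show "AE s in \<mu>. (\<lambda>n. f s * indicator (- Z n) s) \<longlonglongrightarrow> f s * indicator (- (\<Union>n. Z n)) s"
    proof (rule AE_I2)
      fix s
      have "(\<lambda>n. 1 - indicator (Z n) s :: real) \<longlonglongrightarrow> 1 - indicator (\<Union>n. Z n) s"
        by (intro tendsto_intros LIMSEQ_indicator_incseq[OF Z(2)])
      then have "(\<lambda>n. f s * (1 - indicator (Z n) s)) \<longlonglongrightarrow> f s * (1 - indicator (\<Union>n. Z n) s)"
        by (rule tendsto_mult_left)
      then show "(\<lambda>n. f s * indicator (- Z n) s) \<longlonglongrightarrow> f s * indicator (- (\<Union>n. Z n)) s"
        by (simp only: indicator_compl)
    qed
  qed (use f in \<open>auto simp: indicator_def\<close>)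
  moreover have "(\<integral>s. f s * indicator (- (\<Union>n. Z n)) s \<partial>\<mu>) = (\<integral>s. 0 \<partial>\<mu>)"
    by (rule integral_cong_AE) (use Z(3) in \<open>auto simp: indicator_def\<close>)
  ultimately have tail: "(\<lambda>n. \<integral>s. f s * indicator (- Z n) s \<partial>\<mu>) \<longlonglongrightarrow> 0" by simp
  have If: "0 \<le> (\<integral>s. f s \<partial>\<mu>)" using f(2) by simp
  \<comment> \<open>Chosen so that \<open>d\<close> times the integral of \<open>f\<close>, plus
    \<open>2 * d\<close> for the tail, equals \<open>e\<close>.\<close>
  define d where "d = e / ((\<integral>s. f s \<partial>\<mu>) + 2)"
  have d: "0 < d" using e If by (simp add: d_def)
  obtain n where n: "(\<integral>s. f s * indicator (- Z n) s \<partial>\<mu>) < d"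
    using order_tendstoD(2)[OF tail d] by (auto simp: eventually_sequentially)
  obtain h where h: "h \<in> Cc" "\<And>t. 0 \<le> h t" "(\<integral>t. h t \<partial>\<mu>) = 1" "\<And>s. s \<in> Z n \<Longrightarrow> (\<integral>t. \<bar>h (- s + t) - h t\<bar> \<partial>\<mu>) \<le> d"
    using Reiter_compact[OF am Z(1) d] by blast
  define F where "F s t = \<bar>h (- s + t) - h t\<bar>" for s t
  have F_Cc: "F s \<in> Cc" for s
    unfolding F_def by (intro Cc_abs Cc_diff Cc_translate_left h)
  have F_cont: "continuous_on UNIV (\<lambda>(s, t). F s t)"
    unfolding F_def by (auto simp: split_beta intro!: continuous_intros continuous_on_compose2[OF Cc_continuous[OF h(1)]])
  have F_supp: "\<exists>L. compact L \<and> (\<forall>s\<in>K. \<forall>t. t \<notin> L \<longrightarrow> F s t = 0)" if K: "compact K" for K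
  proof -
    obtain L where L: "compact L" "\<And>s t. s \<in> uminus ` K \<Longrightarrow> t \<notin> L \<Longrightarrow> h (s + t) = 0"
      using supp_left_translates[OF h(1) compact_uminus_image[OF K]] by blast
    obtain S where S: "compact S" "\<And>t. t \<notin> S \<Longrightarrow> h t = 0" using h(1) by (rule CcE) blast
    show ?thesis
      using L S by (intro exI[of _ "L \<union> S"]) (auto simp: F_def)
  qed
  have F_int: "(\<integral>\<^sup>+t. ennreal (F s t) \<partial>\<mu>) = ennreal (\<integral>t. F s t \<partial>\<mu>)" for s
    by (intro nn_integral_eq_integral Cc_integrable F_Cc) (simp add: F_def)
  have F2: "(\<integral>t. F s t \<partial>\<mu>) \<le> 2" for s
  proof -
    have tr: "(\<integral>t. h (- s + t) \<partial>\<mu>) = 1"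
      using integral_translate[OF Cc_measurable[OF h(1)], of "- s"] h(3) by simp
    have "(\<integral>t. F s t \<partial>\<mu>) \<le> (\<integral>t. h (- s + t) + h t \<partial>\<mu>)"
      using h(2) by (intro integral_mono Cc_integrable F_Cc Cc_add Cc_translate_left h(1)) (auto simp: F_def abs_le_iff add_increasing add_increasing2)
    also have "\<dots> = (\<integral>t. h (- s + t) \<partial>\<mu>) + (\<integral>t. h t \<partial>\<mu>)"
      by (intro Bochner_Integration.integral_add Cc_integrable Cc_translate_left h(1))
    finally show ?thesis using tr h(3) by simp
  qed
  have iZ: "integrable \<mu> (\<lambda>s. f s * indicator (- Z n) s)"
    by (rule integrable_real_mult_indicator[OF _ f(1)]) simp
  have bound: "(\<integral>t. F s t \<partial>\<mu>) \<le> d + 2 * indicator (- Z n) s" for s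
    using F2[of s] h(4)[of s] d by (cases "s \<in> Z n") (auto simp: F_def)
  have "(\<integral>\<^sup>+t. (\<integral>\<^sup>+s. ennreal (f s * F s t) \<partial>\<mu>) \<partial>\<mu>) \<le> (\<integral>\<^sup>+s. ennreal (f s) * (\<integral>\<^sup>+t. ennreal (F s t) \<partial>\<mu>) \<partial>\<mu>)"
    by (rule Tonelli_weighted[OF F_cont _ F_supp f]) (auto simp: F_def)
  also have "\<dots> \<le> (\<integral>\<^sup>+s. ennreal (d * f s + 2 * (f s * indicator (- Z n) s)) \<partial>\<mu>)"
  proof (rule nn_integral_mono)
    fix s
    have "f s * (\<integral>t. F s t \<partial>\<mu>) \<le> f s * (d + 2 * indicator (- Z n) s)"
      using bound f(2) by (intro mult_left_mono)
    then show "ennreal (f s) * (\<integral>\<^sup>+t. ennreal (F s t) \<partial>\<mu>) \<le> ennreal (d * f s + 2 * (f s * indicator (- Z n) s))"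
      unfolding F_int using f(2) by (simp add: ennreal_mult'[symmetric] ennreal_leI algebra_simps)
  qed
  also have "\<dots> = ennreal (\<integral>s. d * f s + 2 * (f s * indicator (- Z n) s) \<partial>\<mu>)"
    using iZ f d by (intro nn_integral_eq_integral) auto
  also have "(\<integral>s. d * f s + 2 * (f s * indicator (- Z n) s) \<partial>\<mu>) = d * (\<integral>s. f s \<partial>\<mu>) + 2 * (\<integral>s. f s * indicator (- Z n) s \<partial>\<mu>)"
    using iZ f by simp
  also have "\<dots> \<le> d * (\<integral>s. f s \<partial>\<mu>) + 2 * d" using n by simp
  also have "\<dots> = d * ((\<integral>s. f s \<partial>\<mu>) + 2)" by (simp add: algebra_simps)
  also have "\<dots> = e" using If by (simp add: d_def)
  finally show thesis
    using that[OF h(1-3)] by (simp add: F_def ennreal_leI)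
qed

end

section \<open>Power inequalities and weak integrals\<close>

text \<open>The tangent of a convex power lies below its graph. Both the splitting of
  \<open>(a + b) powr p\<close> and Jensen's inequality are derived from this form.\<close>

lemma powr_tangent:
  fixes a b p :: real
  assumes "0 \<le> a" "0 \<le> b" "1 \<le> p"
  shows "a powr p + p * a powr (p - 1) * (b - a) \<le> b powr p"
proof (cases "a = 0")
  case False
  then have a: "0 < a" using assms(1) by simp
  show ?thesis
  proof (cases "b = 0")
    case True
    have eq: "a powr (p - 1) * a = a powr p" using a by (simp add: powr_diff)
    have "p * a powr (p - 1) * (b - a) = - (p * (a powr (p - 1) * a))" using True by simp
    also have "\<dots> = - (p * a powr p)" by (simp only: eq)
    finally have "p * a powr (p - 1) * (b - a) = - (p * a powr p)" .
    moreover have "1 * a powr p \<le> p * a powr p" using assms(3) by (intro mult_right_mono) auto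
    moreover have "b powr p = 0" using True by simp
    ultimately show ?thesis by linarith
  next
    case False
    define x where "x = b / a"
    have x: "0 < x" using False a assms(2) by (simp add: x_def)
    \<comment> \<open>Young's inequality with second factor 1 is Bernoulli's inequality for the
      ratio \<open>x = b / a\<close>.\<close>
    have "(x powr p) powr (1 / p) * 1 powr (1 - 1 / p) \<le> (1 / p) * x powr p + (1 - 1 / p) * 1"
      using assms(3) x by (intro Youngs_inequality_0) auto
    then have "p * x \<le> p * ((1 / p) * x powr p + (1 - 1 / p))"
      using assms(3) x by (intro mult_left_mono) (auto simp: powr_powr)
    then have "1 + p * (x - 1) \<le> x powr p"
      using assms(3) by (simp add: algebra_simps)
    then have "a powr p * (1 + p * (x - 1)) \<le> a powr p * x powr p"
      by (intro mult_left_mono) auto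
    also have "a powr p * x powr p = b powr p"
      using a by (simp add: x_def powr_divide)
    also have "a powr p * (1 + p * (x - 1)) = a powr p + p * a powr (p - 1) * (b - a)"
      using a by (simp add: x_def powr_diff field_simps)
    finally show ?thesis .
  qed
\<comment> \<open>At \<open>a = 0\<close> the value \<open>0 powr (p - 1)\<close> is 0 even for
  \<open>p = 1\<close>, so the claim reads \<open>0 \<le> b powr p\<close>.\<close>
qed (use assms in simp)

text \<open>Here \<open>a + b\<close> is the convex combination of \<open>a / (1 - \<eta>)\<close>
  and \<open>b / \<eta>\<close> with weights \<open>1 - \<eta>\<close> and \<eta>; in the weighted
  sum of the tangent inequalities at \<open>a + b\<close> the linear terms cancel. The coefficient
  of \<open>a powr p\<close> tends to 1 with \<eta>, so a small \<open>b\<close> costs nothing in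
  the limit.\<close>

lemma powr_add_le_convex:
  fixes a b p \<eta> :: real
  assumes "0 \<le> a" "0 \<le> b" "1 \<le> p" "0 < \<eta>" "\<eta> < 1"
  shows "(a + b) powr p \<le> (1 - \<eta>) powr (1 - p) * a powr p + \<eta> powr (1 - p) * b powr p"
proof -
  define c where "c = a + b"
  have c: "0 \<le> c" using assms by (simp add: c_def)
  have "(1 - \<eta>) * (c powr p + p * c powr (p - 1) * (a / (1 - \<eta>) - c)) \<le> (1 - \<eta>) * (a / (1 - \<eta>)) powr p"
    using assms by (intro mult_left_mono powr_tangent c) auto
  moreover have "\<eta> * (c powr p + p * c powr (p - 1) * (b / \<eta> - c)) \<le> \<eta> * (b / \<eta>) powr p"
    using assms by (intro mult_left_mono powr_tangent c) auto
  moreover have "(1 - \<eta>) * (c powr p + p * c powr (p - 1) * (a / (1 - \<eta>) - c))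
      + \<eta> * (c powr p + p * c powr (p - 1) * (b / \<eta> - c)) = c powr p"
  proof -
    have "(1 - \<eta>) * (a / (1 - \<eta>) - c) = a - (1 - \<eta>) * c" "\<eta> * (b / \<eta> - c) = b - \<eta> * c"
      using assms by (simp_all add: right_diff_distrib)
    then have "(1 - \<eta>) * (p * c powr (p - 1) * (a / (1 - \<eta>) - c)) = p * c powr (p - 1) * (a - (1 - \<eta>) * c)"
      "\<eta> * (p * c powr (p - 1) * (b / \<eta> - c)) = p * c powr (p - 1) * (b - \<eta> * c)"
      by (metis mult.left_commute)+
    then show ?thesis
      unfolding distrib_left c_def by (simp add: algebra_simps)
  qed
  ultimately have "c powr p \<le> (1 - \<eta>) * (a / (1 - \<eta>)) powr p + \<eta> * (b / \<eta>) powr p" by linarith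
  also have "(1 - \<eta>) * (a / (1 - \<eta>)) powr p = (1 - \<eta>) powr (1 - p) * a powr p"
    using assms by (simp add: powr_divide powr_diff)
  also have "\<eta> * (b / \<eta>) powr p = \<eta> powr (1 - p) * b powr p"
    using assms by (simp add: powr_divide powr_diff)
  finally show ?thesis by (simp add: c_def)
qed

text \<open>After division by \<open>a + b\<close> both numbers lie between 0 and 1, where raising
  to the power \<open>p\<close> does not increase them.\<close>

lemma powr_superadditive:
  fixes a b p :: real
  assumes "0 \<le> a" "0 \<le> b" "1 \<le> p"
  shows "a powr p + b powr p \<le> (a + b) powr p"
proof (cases "a + b = 0")
  case True
  then show ?thesis using assms by (simp add: add_nonneg_eq_0_iff)
next
  case False
  define c where "c = a + b"
  have c: "0 < c" using False assms by (simp add: c_def)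
  have "(a / c) powr p \<le> (a / c) powr 1" "(b / c) powr p \<le> (b / c) powr 1"
    using assms c by (intro powr_mono'; simp add: c_def)+
  then have "(a / c) powr p + (b / c) powr p \<le> a / c + b / c"
    using assms c by simp
  also have "\<dots> = 1" using c by (simp add: c_def flip: add_divide_distrib)
  finally have "(a powr p + b powr p) / c powr p \<le> 1"
    by (simp add: powr_divide add_divide_distrib)
  then show ?thesis using c by (simp add: c_def pos_divide_le_eq)
qed

text \<open>Superadditivity applied to \<open>a powr (1 / p) - b powr (1 / p)\<close> and
  \<open>b powr (1 / p)\<close> when \<open>b \<le> a\<close>. It transfers almost invariance in L^1
  of a density to its p-th root in L^p.\<close>

lemma root_diff_powr_le:
  fixes a b p :: real
  assumes "0 \<le> a" "0 \<le> b" "1 \<le> p"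
  shows "\<bar>a powr (1 / p) - b powr (1 / p)\<bar> powr p \<le> \<bar>a - b\<bar>"
proof -
  have *: "(a powr (1 / p) - b powr (1 / p)) powr p \<le> a - b" if "b \<le> a" "0 \<le> b" for a b :: real
  proof -
    have "b powr (1 / p) \<le> a powr (1 / p)" using that assms(3) by (intro powr_mono2) auto
    then have "(a powr (1 / p) - b powr (1 / p)) powr p + (b powr (1 / p)) powr p \<le> (a powr (1 / p)) powr p"
      using powr_superadditive[of "a powr (1 / p) - b powr (1 / p)" "b powr (1 / p)" p] assms(3) by simp
    then show ?thesis using that assms(3) by (simp add: powr_powr)
  qed
  show ?thesis
  proof (cases "b \<le> a")
    case True
    then show ?thesis using *[OF True assms(2)] powr_mono2[of "1 / p" b a] assms by (simp add: abs_of_nonneg)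
  next
    case False
    then have ab: "a \<le> b" by simp
    show ?thesis using *[OF ab assms(1)] powr_mono2[of "1 / p" a b] assms ab by (simp add: abs_of_nonpos)
  qed
qed

text \<open>Integrate the tangent inequality at the weighted mean \<open>A\<close> of
  \<open>b\<close>: the linear term drops out. The power \<open>p - 1\<close> of the total mass
  appears because \<open>f\<close> is not normalized.\<close>

lemma Jensen_powr:
  fixes f b :: "'a \<Rightarrow> real"
  assumes f: "integrable M f" "\<And>s. 0 \<le> f s" and b: "\<And>s. 0 \<le> b s" and p: "1 \<le> p"
    and int: "integrable M (\<lambda>s. f s * b s)" "integrable M (\<lambda>s. f s * b s powr p)"
  shows "(\<integral>s. f s * b s \<partial>M) powr p \<le> (\<integral>s. f s \<partial>M) powr (p - 1) * (\<integral>s. f s * b s powr p \<partial>M)"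
proof (cases "(\<integral>s. f s \<partial>M) = 0")
  case True
  then have "AE s in M. f s = 0"
    using integral_nonneg_eq_0_iff_AE[OF f(1)] f(2) by simp
  then have "(\<integral>s. f s * b s \<partial>M) = (\<integral>s. 0 \<partial>M)"
    using int by (intro integral_cong_AE) auto
  then show ?thesis using True by simp
next
  case False
  define N where "N = (\<integral>s. f s \<partial>M)"
  have N: "0 < N" using False f(2) by (simp add: N_def less_le)
  define A where "A = (\<integral>s. f s * b s \<partial>M) / N"
  have A: "0 \<le> A" using N f(2) b by (simp add: A_def)
  have "(\<integral>s. (A powr p - p * A powr (p - 1) * A) * f s + p * A powr (p - 1) * (f s * b s) \<partial>M) \<le> (\<integral>s. f s * b s powr p \<partial>M)"
  proof (rule integral_mono)
    fix s
    have "f s * (A powr p + p * A powr (p - 1) * (b s - A)) \<le> f s * b s powr p"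
      using f(2) b p A by (intro mult_left_mono powr_tangent)
    then show "(A powr p - p * A powr (p - 1) * A) * f s + p * A powr (p - 1) * (f s * b s) \<le> f s * b s powr p"
      by (simp add: algebra_simps)
  qed (use f int in auto)
  also have "(\<integral>s. (A powr p - p * A powr (p - 1) * A) * f s + p * A powr (p - 1) * (f s * b s) \<partial>M)
      = (A powr p - p * A powr (p - 1) * A) * N + p * A powr (p - 1) * (A * N)"
    using f int N by (simp add: N_def A_def)
  finally have "A powr p * N \<le> (\<integral>s. f s * b s powr p \<partial>M)" by (simp add: algebra_simps)
  then have "N powr (p - 1) * (A powr p * N) \<le> N powr (p - 1) * (\<integral>s. f s * b s powr p \<partial>M)"
    by (intro mult_left_mono) auto
  moreover have "N powr (p - 1) * (A powr p * N) = (\<integral>s. f s * b s \<partial>M) powr p"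
    using N by (simp add: A_def powr_divide powr_diff)
  ultimately show ?thesis by (simp add: N_def)
qed

section \<open>Complex scaling and identification of the weak integral\<close>

lemma bounded_linear_scaleC: "bounded_linear (\<lambda>x::'x::complex_banach. c *\<^sub>C x)"
  by (rule bounded_linear_intro[where K = "cmod c"])
     (auto simp: scaleC_add_right scaleC_scaleR_commute norm_scaleC mult.commute)

lemma scaleC_measurable:
  fixes h :: "'a \<Rightarrow> 'x::{complex_banach, second_countable_topology}"
  assumes [measurable]: "f \<in> borel_measurable M" "h \<in> borel_measurable M"
  shows "(\<lambda>s. f s *\<^sub>C h s) \<in> borel_measurable M"
proof -
  have [measurable]: "(\<lambda>s. \<i> *\<^sub>C h s) \<in> borel_measurable M"
    by (rule borel_measurable_continuous_on[OF linear_continuous_on[OF bounded_linear_scaleC] assms(2)])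
  have "(\<lambda>s. Re (f s) *\<^sub>R h s + Im (f s) *\<^sub>R \<i> *\<^sub>C h s) \<in> borel_measurable M"
    by measurable
  then show ?thesis by (simp flip: scaleC_Re_Im)
qed

text \<open>Bounded functionals commute with the Bochner integral, which gives existence; the
  description by \<open>THE\<close> also demands uniqueness, and that follows because complex
  functionals separate points.\<close>

lemma weak_integral_eq_integral:
  fixes h :: "'a \<Rightarrow> 'x::{complex_banach, second_countable_topology}"
  assumes h: "integrable M h"
  shows "weak_integral M h = (\<integral>s. h s \<partial>M)"
  unfolding weak_integral_def
proof (rule the_equality)
  show weak: "has_weak_integral M h (\<integral>s. h s \<partial>M)"
    unfolding has_weak_integral_def
  proof (intro allI impI conjI)
    fix \<phi> :: "'x \<Rightarrow> complex" assume "bounded_clinear \<phi>"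
    then have \<phi>: "bounded_linear \<phi>" by (simp add: bounded_clinear_def)
    show "integrable M (\<lambda>s. \<phi> (h s))" by (rule integrable_bounded_linear[OF \<phi> h])
    show "\<phi> (\<integral>s. h s \<partial>M) = (\<integral>s. \<phi> (h s) \<partial>M)"
      by (rule integral_bounded_linear[OF \<phi> h, symmetric])
  qed
  fix y assume y: "has_weak_integral M h y"
  show "y = (\<integral>s. h s \<partial>M)"
  proof (rule ccontr)
    assume "y \<noteq> (\<integral>s. h s \<partial>M)"
    then have "y - (\<integral>s. h s \<partial>M) \<noteq> 0" by simp
    then obtain \<phi> :: "'x \<Rightarrow> complex" where \<phi>: "bounded_clinear \<phi>" "\<phi> (y - (\<integral>s. h s \<partial>M)) \<noteq> 0"
      by (rule complex_separation)
    have "\<phi> y = \<phi> (\<integral>s. h s \<partial>M)"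
      using y weak \<phi>(1) unfolding has_weak_integral_def by metis
    then show False
      using \<phi> by (simp add: bounded_clinear_def bounded_linear.linear linear_diff)
  qed
qed

section \<open>Transference\<close>

text \<open>Here \<open>M\<close> is any positive uniform bound, so that it can be divided by; the
  case of a vanishing supremum is treated in the final theorem.\<close>

locale projective_representation = haar_measure \<mu>
  for \<mu> :: "'g::{topological_group_add, t2_space} measure" +
  fixes \<sigma> :: "'g \<Rightarrow> 'g \<Rightarrow> complex"
    and \<pi> :: "'g \<Rightarrow> 'x::{complex_banach, second_countable_topology} \<Rightarrow> 'x"
    and f :: "'g \<Rightarrow> complex" and M :: real
  assumes cocycle: "borel_cocycle \<sigma>" and normalized: "normalized_cocycle \<sigma>"
    and rep: "continuous_projective_rep \<sigma> \<pi>"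
    and bounded: "\<And>s x. norm (\<pi> s x) \<le> M * norm x" and M_pos: "0 < M"
    and f_integrable: "integrable \<mu> f"
begin

lemma cocycle_eq: "\<sigma> s t * \<sigma> (s + t) r = \<sigma> s (t + r) * \<sigma> t r"
  using cocycle by (simp add: borel_cocycle_def)

lemma cocycle_inverse [simp]: "\<sigma> s (- s) = 1" "\<sigma> (- s) s = 1"
  using normalized unfolding normalized_cocycle_def by (simp, metis minus_minus)

text \<open>The cocycle identity for the triple \<open>- t\<close>, \<open>s\<close>,
  \<open>- s + t\<close>. Its other two factors are \<sigma> at a pair of mutually inverse elements,
  hence 1.\<close>

lemma cocycle_translate: "\<sigma> (- t) s = \<sigma> s (- s + t)"
  using cocycle_eq[of "- t" s "- s + t"] cocycle_inverse(1)[of "- t + s"]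
  by (simp add: minus_add add.assoc[symmetric])

text \<open>The identity for \<open>0\<close>, \<open>0\<close>, \<open>s\<close> allows
  cancellation of the nonzero value \<open>\<sigma> 0 s\<close>, leaving
  \<open>\<sigma> 0 0\<close>, which normalization sets to 1.\<close>

lemma cocycle_zero [simp]: "\<sigma> 0 s = 1"
proof -
  have "\<sigma> 0 s \<noteq> 0" using cocycle unfolding borel_cocycle_def by (metis norm_zero zero_neq_one)
  then show ?thesis using cocycle_eq[of 0 0 s] cocycle_inverse(1)[of 0] by simp
qed

lemma rep_linear: "bounded_linear (\<pi> s)" and rep_scaleC: "\<pi> s (c *\<^sub>C x) = c *\<^sub>C \<pi> s x"
  and rep_continuous: "continuous_on UNIV (\<lambda>s. \<pi> s x)"
  and rep_mult: "\<pi> s (\<pi> t x) = \<sigma> s t *\<^sub>C \<pi> (s + t) x"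
  using rep by (simp_all add: continuous_projective_rep_def bounded_clinear_def)

definition orbit :: "'x \<Rightarrow> 'g \<Rightarrow> 'x"
  where "orbit x s = f s *\<^sub>C \<pi> s x"

lemma f_measurable [measurable]: "f \<in> borel_measurable borel"
  using borel_measurable_integrable[OF f_integrable] by simp

lemma orbit_measurable [measurable]: "orbit x \<in> borel_measurable borel"
  unfolding orbit_def
  by (intro scaleC_measurable f_measurable borel_measurable_continuous_onI rep_continuous)

lemma norm_orbit: "norm (orbit x s) \<le> cmod (f s) * (M * norm x)"
  unfolding orbit_def norm_scaleC by (intro mult_left_mono bounded) auto

lemma norm_f_integrable: "integrable \<mu> (\<lambda>s. cmod (f s))"
  by (rule integrable_norm[OF f_integrable])

lemma weighted_integrable:
  fixes b :: "'g \<Rightarrow> real" and h :: "'g \<Rightarrow> 'b::{banach, second_countable_topology}"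
  assumes "b \<in> borel_measurable borel" "\<And>s. \<bar>b s\<bar> \<le> B" "h \<in> borel_measurable borel"
    "\<And>s. norm (h s) \<le> cmod (f s) * C"
  shows "integrable \<mu> (\<lambda>s. b s *\<^sub>R h s)"
proof (rule Bochner_Integration.integrable_bound[OF integrable_mult_left[OF norm_f_integrable, of "B * C"]])
  show "(\<lambda>s. b s *\<^sub>R h s) \<in> borel_measurable \<mu>" using assms(1,3) by simp
  have "norm (b s *\<^sub>R h s) \<le> norm (cmod (f s) * (B * C))" for s
  proof -
    have "norm (b s *\<^sub>R h s) \<le> B * (cmod (f s) * C)"
      using assms(2)[of s] assms(4)[of s] by (auto intro!: mult_mono)
    then show ?thesis by (simp add: mult_ac order_trans[OF _ abs_ge_self])
  qed
  then show "AE s in \<mu>. norm (b s *\<^sub>R h s) \<le> norm (cmod (f s) * (B * C))" by simp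
qed

lemma orbit_integrable: "integrable \<mu> (orbit x)"
proof -
  have "integrable \<mu> (\<lambda>s. 1 *\<^sub>R orbit x s)"
    by (rule weighted_integrable[OF _ _ orbit_measurable norm_orbit, where B = 1]) auto
  then show ?thesis by simp
qed

lemma integrated_rep_eq: "integrated_rep \<mu> \<pi> f x = (\<integral>s. orbit x s \<partial>\<mu>)"
proof -
  have "orbit x = (\<lambda>s. f s *\<^sub>C \<pi> s x)" by (simp add: orbit_def fun_eq_iff)
  then show ?thesis
    using weak_integral_eq_integral[OF orbit_integrable[of x]] by (simp add: integrated_rep_def)
qed

text \<open>\<open>\<pi> 0\<close> is only a projection, but it fixes the range of the integrated representation.\<close>

lemma norm_integrated_rep_le: "norm (\<integral>s. orbit x s \<partial>\<mu>) \<le> M * norm (\<pi> (- t) (\<integral>s. orbit x s \<partial>\<mu>))"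
proof -
  let ?y = "\<integral>s. orbit x s \<partial>\<mu>"
  have "\<pi> t (\<pi> (- t) ?y) = \<pi> 0 ?y"
    by (simp add: rep_mult)
  also have "\<dots> = (\<integral>s. \<pi> 0 (orbit x s) \<partial>\<mu>)"
    by (rule integral_bounded_linear[OF rep_linear orbit_integrable, symmetric])
  also have "\<dots> = ?y"
    by (simp add: orbit_def rep_scaleC rep_mult)
  finally show ?thesis using bounded[of t "\<pi> (- t) ?y"] by simp
qed

text \<open>The twist equals the factor produced by composing \<open>\<pi> (- t)\<close> with
  \<open>\<pi> s\<close>, so the cocycle is absorbed. What remains differs from the integrand of
  \<open>w t *\<^sub>R \<pi> (- t)\<close> applied to the integrated orbit only in the weight,
  \<open>w (- s + t)\<close> in place of \<open>w t\<close>.\<close>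

lemma twisted_convolution_orbit:
  "twisted_convolution \<mu> \<sigma> f (\<lambda>r. w r *\<^sub>R \<pi> (- r) x) t = (\<integral>s. w (- s + t) *\<^sub>R \<pi> (- t) (orbit x s) \<partial>\<mu>)"
  unfolding twisted_convolution_def
proof (rule Bochner_Integration.integral_cong)
  fix s
  have "\<pi> (- t) (orbit x s) = f s *\<^sub>C \<sigma> s (- s + t) *\<^sub>C \<pi> (- t + s) x"
    by (simp add: orbit_def rep_scaleC rep_mult cocycle_translate)
  also have "- t + s = - (- s + t)" by (simp add: minus_add)
  finally show "(\<sigma> s (- s + t) * f s) *\<^sub>C w (- s + t) *\<^sub>R \<pi> (- (- s + t)) x = w (- s + t) *\<^sub>R \<pi> (- t) (orbit x s)"
    by (simp add: scaleC_scaleC mult.commute scaleC_scaleR_commute)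
qed simp

text \<open>The difference is the integral of \<open>w t - w (- s + t)\<close> against
  \<open>\<pi> (- t) (orbit x s)\<close>. The factor \<open>M\<^sup>2\<close> comes from
  \<open>\<pi> (- t)\<close> and \<open>\<pi> s\<close>; Jensen's inequality moves the power inside,
  and \<open>root_diff_powr_le\<close> replaces the roots by \<open>h\<close>. The nonnegative
  integral on the right is the inner integral of \<open>Reiter_weighted\<close>.\<close>

lemma approximate_invariance:
  assumes h: "h \<in> Cc" "\<And>t. 0 \<le> h t" and p: "1 \<le> p"
  defines "w \<equiv> \<lambda>t. h t powr (1 / p)"
  shows "ennreal (norm (w t *\<^sub>R \<pi> (- t) (\<integral>s. orbit x s \<partial>\<mu>)
        - twisted_convolution \<mu> \<sigma> f (\<lambda>r. w r *\<^sub>R \<pi> (- r) x) t) powr p)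
    \<le> ennreal ((M\<^sup>2 * norm x) powr p * (\<integral>s. cmod (f s) \<partial>\<mu>) powr (p - 1))
      * (\<integral>\<^sup>+s. ennreal (cmod (f s) * \<bar>h (- s + t) - h t\<bar>) \<partial>\<mu>)"
proof -
  obtain B where B: "0 < B" "\<And>t. \<bar>h t\<bar> \<le> B" using h(1) by (rule Cc_bounded) blast
  have [measurable]: "h \<in> borel_measurable borel" by (rule Cc_measurable[OF h(1)])
  have [measurable]: "(\<lambda>s. - s + t) \<in> borel_measurable borel"
    by (intro borel_measurable_continuous_onI continuous_intros)
  have wm[measurable]: "(\<lambda>s. w (- s + t)) \<in> borel_measurable borel" unfolding w_def by measurable
  have w0: "0 \<le> w t" for t by (simp add: w_def)
  have wB: "w t \<le> B powr (1 / p)" for t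
    unfolding w_def using B(2)[of t] h(2) p by (intro powr_mono2) auto
  define b where "b s = \<bar>w (- s + t) - w t\<bar>" for s
  have bm[measurable]: "b \<in> borel_measurable borel" unfolding b_def by measurable
  have bB: "\<bar>b s\<bar> \<le> B powr (1 / p)" for s
    using w0[of t] w0[of "- s + t"] wB[of t] wB[of "- s + t"] by (auto simp: b_def)
  define P where "P s = \<pi> (- t) (orbit x s)" for s
  have P: "integrable \<mu> P"
    unfolding P_def by (rule integrable_bounded_linear[OF rep_linear orbit_integrable])
  have Pm[measurable]: "P \<in> borel_measurable borel" using borel_measurable_integrable[OF P] by simp
  have Pn: "norm (P s) \<le> cmod (f s) * (M\<^sup>2 * norm x)" for s
  proof -
    have "norm (P s) \<le> M * (cmod (f s) * (M * norm x))"
      unfolding P_def using bounded[of "- t" "orbit x s"] norm_orbit[of x s] M_pos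
      by (meson less_imp_le mult_left_mono order_trans)
    then show ?thesis by (simp add: power2_eq_square mult_ac)
  qed
  have wP: "integrable \<mu> (\<lambda>s. w (- s + t) *\<^sub>R P s)"
    by (rule weighted_integrable[OF wm _ Pm Pn]) (use w0 wB in simp)
  have fb: "integrable \<mu> (\<lambda>s. cmod (f s) * b s)"
    using weighted_integrable[of b "B powr (1 / p)" "\<lambda>s. cmod (f s)" 1] bB by (simp add: mult.commute)
  have bp: "b s powr p \<le> \<bar>h (- s + t) - h t\<bar>" for s
    unfolding b_def w_def by (rule root_diff_powr_le[OF h(2) h(2) p])
  have hB: "\<bar>h (- s + t) - h t\<bar> \<le> B" for s
    using B(2)[of t] B(2)[of "- s + t"] h(2)[of t] h(2)[of "- s + t"] by (auto simp: abs_le_iff)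
  have fbp: "integrable \<mu> (\<lambda>s. cmod (f s) * b s powr p)"
    using weighted_integrable[of "\<lambda>s. b s powr p" B "\<lambda>s. cmod (f s)" 1] order_trans[OF bp hB] by (simp add: mult.commute)
  have fh: "integrable \<mu> (\<lambda>s. cmod (f s) * \<bar>h (- s + t) - h t\<bar>)"
    using weighted_integrable[of "\<lambda>s. \<bar>h (- s + t) - h t\<bar>" B "\<lambda>s. cmod (f s)" 1] hB by (simp add: mult.commute)
  have "w t *\<^sub>R \<pi> (- t) (\<integral>s. orbit x s \<partial>\<mu>) - twisted_convolution \<mu> \<sigma> f (\<lambda>r. w r *\<^sub>R \<pi> (- r) x) t
      = (\<integral>s. w t *\<^sub>R P s - w (- s + t) *\<^sub>R P s \<partial>\<mu>)"
    unfolding twisted_convolution_orbit integral_bounded_linear[OF rep_linear orbit_integrable, symmetric] P_def[symmetric]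
    using P wP by simp
  also have "norm \<dots> \<le> (\<integral>s. norm (w t *\<^sub>R P s - w (- s + t) *\<^sub>R P s) \<partial>\<mu>)"
    by (rule integral_norm_bound)
  also have "\<dots> \<le> (\<integral>s. (M\<^sup>2 * norm x) * (cmod (f s) * b s) \<partial>\<mu>)"
  proof (rule integral_mono)
    show "norm (w t *\<^sub>R P s - w (- s + t) *\<^sub>R P s) \<le> (M\<^sup>2 * norm x) * (cmod (f s) * b s)" for s
    proof -
      have "norm (w t *\<^sub>R P s - w (- s + t) *\<^sub>R P s) = b s * norm (P s)"
        by (simp add: b_def abs_minus_commute flip: scaleR_diff_left)
      also have "\<dots> \<le> b s * (cmod (f s) * (M\<^sup>2 * norm x))"
        by (intro mult_left_mono Pn) (simp add: b_def)
      finally show ?thesis by (simp add: mult_ac)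
    qed
  qed (use P wP fb in auto)
  also have "\<dots> = (M\<^sup>2 * norm x) * (\<integral>s. cmod (f s) * b s \<partial>\<mu>)" by simp
  finally have "norm (w t *\<^sub>R \<pi> (- t) (\<integral>s. orbit x s \<partial>\<mu>) - twisted_convolution \<mu> \<sigma> f (\<lambda>r. w r *\<^sub>R \<pi> (- r) x) t) powr p
      \<le> ((M\<^sup>2 * norm x) * (\<integral>s. cmod (f s) * b s \<partial>\<mu>)) powr p"
    using p by (intro powr_mono2) auto
  also have "\<dots> = (M\<^sup>2 * norm x) powr p * (\<integral>s. cmod (f s) * b s \<partial>\<mu>) powr p"
    by (rule powr_mult)
  also have "\<dots> \<le> (M\<^sup>2 * norm x) powr p * ((\<integral>s. cmod (f s) \<partial>\<mu>) powr (p - 1) * (\<integral>s. cmod (f s) * b s powr p \<partial>\<mu>))"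
    using norm_f_integrable fb fbp p by (intro mult_left_mono Jensen_powr) (auto simp: b_def)
  also have "\<dots> \<le> (M\<^sup>2 * norm x) powr p * ((\<integral>s. cmod (f s) \<partial>\<mu>) powr (p - 1) * (\<integral>s. cmod (f s) * \<bar>h (- s + t) - h t\<bar> \<partial>\<mu>))"
    using bp fbp fh by (intro mult_left_mono integral_mono) auto
  finally have "norm (w t *\<^sub>R \<pi> (- t) (\<integral>s. orbit x s \<partial>\<mu>) - twisted_convolution \<mu> \<sigma> f (\<lambda>r. w r *\<^sub>R \<pi> (- r) x) t) powr p
    \<le> (M\<^sup>2 * norm x) powr p * (\<integral>s. cmod (f s) \<partial>\<mu>) powr (p - 1) * (\<integral>s. cmod (f s) * \<bar>h (- s + t) - h t\<bar> \<partial>\<mu>)"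
    by (simp add: mult.assoc)
  moreover have "(\<integral>\<^sup>+s. ennreal (cmod (f s) * \<bar>h (- s + t) - h t\<bar>) \<partial>\<mu>) = ennreal (\<integral>s. cmod (f s) * \<bar>h (- s + t) - h t\<bar> \<partial>\<mu>)"
    by (rule nn_integral_eq_integral[OF fh]) simp
  ultimately show ?thesis
    by (simp add: ennreal_mult'[symmetric] ennreal_leI)
qed

text \<open>For every \<open>t\<close>, \<open>norm (\<pi> (- t) y)\<close> is at least
  \<open>norm y / M\<close>, where \<open>y\<close> is the integrated orbit. Multiplying by
  \<open>w t\<close>, splitting into convolution and error, and integrating p-th powers yields the
  claim, as \<open>h\<close> has integral one.\<close>

lemma transference_estimate:
  assumes am: "amenable \<mu>" and p: "1 \<le> p" and K: "0 \<le> K"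
    and C: "\<And>g. g \<in> Lp_space \<mu> p \<Longrightarrow> twisted_convolution \<mu> \<sigma> f g \<in> Lp_space \<mu> p \<and>
      Lp_norm \<mu> p (twisted_convolution \<mu> \<sigma> f g :: 'g \<Rightarrow> 'x) \<le> K * Lp_norm \<mu> p g"
    and \<eta>: "0 < \<eta>" "\<eta> < 1" and e: "0 < e"
  shows "(norm (\<integral>s. orbit x s \<partial>\<mu>) / M) powr p \<le> (1 - \<eta>) powr (1 - p) * (K * (M * norm x)) powr p + e"
proof -
  let ?y = "\<integral>s. orbit x s \<partial>\<mu>"
  \<comment> \<open>The constant of \<open>approximate_invariance\<close>, increased by 1 so that it
    can be divided by even when \<open>x\<close> or \<open>f\<close> vanishes. With
    \<open>d = e / (k * c)\<close> the final error \<open>k * (c * d)\<close> is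
    \<open>e\<close>.\<close>
  define c where "c = (M\<^sup>2 * norm x) powr p * (\<integral>s. cmod (f s) \<partial>\<mu>) powr (p - 1) + 1"
  have c: "0 < c" by (simp add: c_def add_nonneg_pos)
  define k where "k = \<eta> powr (1 - p)"
  have k: "0 < k" using \<eta> by (simp add: k_def)
  define d where "d = e / (k * c)"
  have d: "0 < d" using e k c by (simp add: d_def)
  obtain h where h: "h \<in> Cc" "\<And>t. 0 \<le> h t" "(\<integral>t. h t \<partial>\<mu>) = 1"
    "(\<integral>\<^sup>+t. (\<integral>\<^sup>+s. ennreal (cmod (f s) * \<bar>h (- s + t) - h t\<bar>) \<partial>\<mu>) \<partial>\<mu>) \<le> ennreal d"
    by (rule Reiter_weighted[OF am norm_f_integrable _ d]) auto
  define w where "w t = h t powr (1 / p)" for t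
  have wp: "w t powr p = h t" for t using h(2) p by (simp add: w_def powr_powr)
  define g where "g r = w r *\<^sub>R \<pi> (- r) x" for r
  define v where "v = twisted_convolution \<mu> \<sigma> f g"
  define D where "D t = w t *\<^sub>R \<pi> (- t) ?y - v t" for t
  have cont_w: "continuous_on UNIV w"
    unfolding w_def using p by (intro continuous_on_powr' Cc_continuous[OF h(1)] continuous_intros) (use h(2) in auto)
  have cont_\<pi>: "continuous_on UNIV (\<lambda>t. \<pi> (- t) z)" for z
    by (rule continuous_on_compose2[OF rep_continuous]) (auto intro!: continuous_intros)
  have gm: "g \<in> borel_measurable borel"
    unfolding g_def by (intro borel_measurable_continuous_onI continuous_intros cont_w cont_\<pi>)
  have gp: "norm (g t) powr p \<le> (M * norm x) powr p * h t" for t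
  proof -
    have "norm (g t) \<le> w t * (M * norm x)"
      unfolding g_def using bounded[of "- t" x] by (simp add: w_def mult_left_mono)
    then have "norm (g t) powr p \<le> (w t * (M * norm x)) powr p"
      using p by (intro powr_mono2) auto
    then show ?thesis by (simp add: powr_mult wp mult.commute)
  qed
  have gi: "integrable \<mu> (\<lambda>t. norm (g t) powr p)"
  proof (rule Bochner_Integration.integrable_bound)
    show "integrable \<mu> (\<lambda>t. (M * norm x) powr p * h t)" by (intro integrable_mult_right Cc_integrable h(1))
    show "(\<lambda>t. norm (g t) powr p) \<in> borel_measurable \<mu>" using gm by simp
    show "AE t in \<mu>. norm (norm (g t) powr p) \<le> norm ((M * norm x) powr p * h t)"
      using gp h(2) by simp
  qed
  have g_Lp: "g \<in> Lp_space \<mu> p" using gm gi by (simp add: Lp_space_def)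
  have v_Lp: "v \<in> Lp_space \<mu> p" "Lp_norm \<mu> p v \<le> K * Lp_norm \<mu> p g"
    using C[OF g_Lp] by (simp_all add: v_def)
  have vm[measurable]: "v \<in> borel_measurable borel" and vi: "integrable \<mu> (\<lambda>t. norm (v t) powr p)"
    using v_Lp(1) by (simp_all add: Lp_space_def)
  have Dm[measurable]: "D \<in> borel_measurable borel"
    unfolding D_def by (intro borel_measurable_diff vm borel_measurable_continuous_onI continuous_intros cont_w cont_\<pi>)
  have vK: "(\<integral>t. norm (v t) powr p \<partial>\<mu>) \<le> (K * (M * norm x)) powr p"
  proof -
    let ?I = "\<integral>t. norm (v t) powr p \<partial>\<mu>" and ?J = "\<integral>t. norm (g t) powr p \<partial>\<mu>"
    have "(?I powr (1 / p)) powr p \<le> (K * ?J powr (1 / p)) powr p"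
      using v_Lp(2) p unfolding Lp_norm_def by (intro powr_mono2) auto
    then have "?I \<le> K powr p * ?J" using p by (simp add: powr_powr powr_mult)
    also have "?J \<le> (\<integral>t. (M * norm x) powr p * h t \<partial>\<mu>)"
      using gp gi Cc_integrable[OF h(1)] by (intro integral_mono) auto
    also have "\<dots> = (M * norm x) powr p" using h(3) by simp
    finally show ?thesis by (simp add: powr_mult mult_left_mono)
  qed
  have Dd: "(\<integral>\<^sup>+t. ennreal (norm (D t) powr p) \<partial>\<mu>) \<le> ennreal (c * d)"
  proof -
    \<comment> \<open>The constant is moved to the side of \<open>D\<close>, whose measurability is
      known, so that it can be taken out of the integral over \<open>t\<close>.\<close>
    have le: "ennreal (norm (D t) powr p / c) \<le> (\<integral>\<^sup>+s. ennreal (cmod (f s) * \<bar>h (- s + t) - h t\<bar>) \<partial>\<mu>)" for t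
    proof -
      have "ennreal (norm (D t) powr p) \<le> ennreal (c - 1) * (\<integral>\<^sup>+s. ennreal (cmod (f s) * \<bar>h (- s + t) - h t\<bar>) \<partial>\<mu>)"
        using approximate_invariance[OF h(1,2) p, of t x] unfolding D_def v_def g_def w_def c_def by simp
      also have "\<dots> \<le> ennreal c * (\<integral>\<^sup>+s. ennreal (cmod (f s) * \<bar>h (- s + t) - h t\<bar>) \<partial>\<mu>)"
        using c by (intro mult_right_mono ennreal_leI) auto
      finally have "ennreal (1 / c) * ennreal (norm (D t) powr p)
          \<le> ennreal (1 / c) * (ennreal c * (\<integral>\<^sup>+s. ennreal (cmod (f s) * \<bar>h (- s + t) - h t\<bar>) \<partial>\<mu>))"
        by (intro mult_left_mono) auto
      also have "\<dots> = (\<integral>\<^sup>+s. ennreal (cmod (f s) * \<bar>h (- s + t) - h t\<bar>) \<partial>\<mu>)"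
        using c by (simp add: mult.assoc[symmetric] ennreal_mult[symmetric])
      finally show ?thesis using c by (simp add: ennreal_mult[symmetric])
    qed
    have "(\<integral>\<^sup>+t. ennreal (norm (D t) powr p) \<partial>\<mu>) = (\<integral>\<^sup>+t. ennreal c * ennreal (norm (D t) powr p / c) \<partial>\<mu>)"
      using c by (intro nn_integral_cong) (simp add: ennreal_mult[symmetric])
    also have "\<dots> = ennreal c * (\<integral>\<^sup>+t. ennreal (norm (D t) powr p / c) \<partial>\<mu>)"
      by (rule nn_integral_cmult) simp
    also have "\<dots> \<le> ennreal c * ennreal d"
      using order_trans[OF nn_integral_mono[OF le] h(4)] by (intro mult_left_mono) auto
    finally show ?thesis using c d by (simp add: ennreal_mult)
  qed
  have point: "(norm ?y / M) powr p * h t \<le> (1 - \<eta>) powr (1 - p) * norm (v t) powr p + k * norm (D t) powr p" for t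
  proof -
    have "norm ?y / M \<le> norm (\<pi> (- t) ?y)"
      using norm_integrated_rep_le[of x t] M_pos by (simp add: field_simps)
    then have "w t * (norm ?y / M) \<le> w t * norm (\<pi> (- t) ?y)"
      by (intro mult_left_mono) (simp_all add: w_def)
    also have "\<dots> = norm (w t *\<^sub>R \<pi> (- t) ?y)" by (simp add: w_def)
    also have "\<dots> \<le> norm (v t) + norm (D t)"
      using norm_triangle_ineq[of "v t" "D t"] by (simp add: D_def)
    finally have "(w t * (norm ?y / M)) powr p \<le> (norm (v t) + norm (D t)) powr p"
      using p M_pos by (intro powr_mono2) (auto simp: w_def)
    also have "\<dots> \<le> (1 - \<eta>) powr (1 - p) * norm (v t) powr p + k * norm (D t) powr p"
      unfolding k_def by (rule powr_add_le_convex[OF _ _ p \<eta>]) auto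
    also have "(w t * (norm ?y / M)) powr p = (norm ?y / M) powr p * h t"
      by (simp only: powr_mult wp mult.commute)
    finally show ?thesis .
  qed
  have "ennreal ((norm ?y / M) powr p) = (\<integral>\<^sup>+t. ennreal ((norm ?y / M) powr p * h t) \<partial>\<mu>)"
    using h Cc_integrable[OF h(1)] by (subst nn_integral_eq_integral) auto
  also have "\<dots> \<le> (\<integral>\<^sup>+t. ennreal ((1 - \<eta>) powr (1 - p) * norm (v t) powr p) + ennreal (k * norm (D t) powr p) \<partial>\<mu>)"
    using point k by (intro nn_integral_mono) (simp add: ennreal_leI flip: ennreal_plus)
  also have "\<dots> = (\<integral>\<^sup>+t. ennreal ((1 - \<eta>) powr (1 - p) * norm (v t) powr p) \<partial>\<mu>) + (\<integral>\<^sup>+t. ennreal (k * norm (D t) powr p) \<partial>\<mu>)"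
    by (rule nn_integral_add) simp_all
  also have "(\<integral>\<^sup>+t. ennreal ((1 - \<eta>) powr (1 - p) * norm (v t) powr p) \<partial>\<mu>)
      = ennreal ((1 - \<eta>) powr (1 - p) * (\<integral>t. norm (v t) powr p \<partial>\<mu>))"
    using vi by (subst nn_integral_eq_integral) auto
  also have "(\<integral>\<^sup>+t. ennreal (k * norm (D t) powr p) \<partial>\<mu>) = ennreal k * (\<integral>\<^sup>+t. ennreal (norm (D t) powr p) \<partial>\<mu>)"
    using k by (subst nn_integral_cmult[symmetric]) (auto simp: ennreal_mult)
  also have "ennreal ((1 - \<eta>) powr (1 - p) * (\<integral>t. norm (v t) powr p \<partial>\<mu>)) + ennreal k * (\<integral>\<^sup>+t. ennreal (norm (D t) powr p) \<partial>\<mu>)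
     \<le> ennreal ((1 - \<eta>) powr (1 - p) * (K * (M * norm x)) powr p) + ennreal k * ennreal (c * d)"
    using vK Dd by (intro add_mono ennreal_leI mult_left_mono) auto
  also have "ennreal k * ennreal (c * d) = ennreal e"
    using k c e by (simp add: d_def flip: ennreal_mult)
  also have "ennreal ((1 - \<eta>) powr (1 - p) * (K * (M * norm x)) powr p) + ennreal e
      = ennreal ((1 - \<eta>) powr (1 - p) * (K * (M * norm x)) powr p + e)"
    using e by (intro ennreal_plus[symmetric]) auto
  finally show ?thesis using e by (subst (asm) ennreal_le_iff) (auto intro!: add_nonneg_nonneg)
qed

text \<open>Both small parameters are removed, \<open>e\<close> before \<eta>. After taking p-th
  roots, the \<open>M\<close> dividing the left side and the \<open>M\<close> from the norm of
  \<open>g\<close> combine to \<open>M\<^sup>2\<close>.\<close>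

theorem transference:
  assumes am: "amenable \<mu>" and p: "1 \<le> p" and K: "0 \<le> K"
    and C: "\<And>g. g \<in> Lp_space \<mu> p \<Longrightarrow> twisted_convolution \<mu> \<sigma> f g \<in> Lp_space \<mu> p \<and>
      Lp_norm \<mu> p (twisted_convolution \<mu> \<sigma> f g :: 'g \<Rightarrow> 'x) \<le> K * Lp_norm \<mu> p g"
  shows "norm (integrated_rep \<mu> \<pi> f x) \<le> M\<^sup>2 * K * norm x"
proof -
  let ?y = "\<integral>s. orbit x s \<partial>\<mu>"
  have "(norm ?y / M) powr p \<le> (1 - \<eta>) powr (1 - p) * (K * (M * norm x)) powr p" if "0 < \<eta>" "\<eta> < 1" for \<eta>
    by (rule field_le_epsilon) (rule transference_estimate[OF am p K C that])
  moreover have "((\<lambda>\<eta>. (1 - \<eta>) powr (1 - p) * (K * (M * norm x)) powr p) \<longlongrightarrow> (1 - 0) powr (1 - p) * (K * (M * norm x)) powr p) (at_right 0)"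
    by (intro tendsto_intros) auto
  ultimately have "(norm ?y / M) powr p \<le> (1 - 0) powr (1 - p) * (K * (M * norm x)) powr p"
    by (intro tendsto_lowerbound[of _ _ "at_right (0::real)"])
       (auto simp: eventually_at_right_field intro!: exI[of _ 1])
  then have "(norm ?y / M) powr p \<le> (K * (M * norm x)) powr p" by simp
  then have "((norm ?y / M) powr p) powr (1 / p) \<le> ((K * (M * norm x)) powr p) powr (1 / p)"
    by (rule powr_mono2[rotated 2]) (use p in auto)
  moreover have "0 \<le> norm ?y / M" "0 \<le> K * (M * norm x)" using K M_pos by simp_all
  ultimately have "norm ?y / M \<le> K * (M * norm x)"
    using p M_pos by (simp add: powr_powr)
  then show ?thesis
    using M_pos by (simp add: integrated_rep_eq field_simps power2_eq_square)
qed

end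

theorem proposition2p2p6:
  fixes \<mu> :: "'g::{topological_group_add, t2_space} measure"
    and \<sigma> :: "'g \<Rightarrow> 'g \<Rightarrow> complex"
    and \<pi> :: "'g \<Rightarrow> 'x::{complex_banach, second_countable_topology} \<Rightarrow> 'x"
    and f :: "'g \<Rightarrow> complex"
    and M p :: real
  assumes "locally_compact_space (euclidean :: 'g topology)"
    and "left_haar_measure \<mu>"
    and "amenable \<mu>"
    and "borel_cocycle \<sigma>" and "normalized_cocycle \<sigma>"
    and "continuous_projective_rep \<sigma> \<pi>"
    and "bdd_above (range (\<lambda>s. onorm (\<pi> s)))"
    and "M = (SUP s. onorm (\<pi> s))"
    and "1 \<le> p"
    and "integrable \<mu> f"
  shows "ennreal (onorm (integrated_rep \<mu> \<pi> f))
    \<le> ennreal (M\<^sup>2) *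
      Lp_operator_norm \<mu> p
        (twisted_convolution \<mu> \<sigma> f :: ('g \<Rightarrow> 'x) \<Rightarrow> ('g \<Rightarrow> 'x))"
proof -
  have lin: "bounded_linear (\<pi> s)" for s
    using assms(6) by (simp add: continuous_projective_rep_def bounded_clinear_def)
  have onorm_le: "onorm (\<pi> s) \<le> M" for s
    unfolding assms(8) by (rule cSUP_upper[OF UNIV_I assms(7)])
  have bounded: "norm (\<pi> s x) \<le> M * norm x" for s x
    using onorm[OF lin, of s x] onorm_le[of s] by (meson mult_right_mono norm_ge_zero order_trans)
  have M: "0 \<le> M"
    using onorm_pos_le[OF lin] onorm_le order_trans by blast
  show ?thesis
  proof (cases "M = 0")
    \<comment> \<open>In \<open>ennreal\<close> the right side is 0 here even if the operator norm
      is infinite, so the left side is shown to vanish directly.\<close>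
    case True
    then have zero: "\<pi> s x = 0" for s x using bounded[of s x] by simp
    have "integrated_rep \<mu> \<pi> f x = 0" for x
    proof -
      have "f s *\<^sub>C (0::'x) = 0" for s
        using norm_scaleC[of "f s" "0::'x"] by simp
      then have "integrated_rep \<mu> \<pi> f x = (\<integral>s. 0 \<partial>\<mu>)"
        unfolding integrated_rep_def zero by (simp add: weak_integral_eq_integral)
      then show ?thesis by simp
    qed
    then have "onorm (integrated_rep \<mu> \<pi> f) \<le> 0" by (intro onorm_bound) auto
    then show ?thesis by (simp add: ennreal_neg)
  next
    case False
    then interpret projective_representation \<mu> \<sigma> \<pi> f M
      by unfold_locales (use assms bounded M in auto)
    have pos: "0 < M\<^sup>2" using False by simp
    have "ennreal (onorm (integrated_rep \<mu> \<pi> f)) \<le> ennreal (M\<^sup>2) * ennreal K"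
      if "0 \<le> K" and C: "\<forall>g\<in>Lp_space \<mu> p. twisted_convolution \<mu> \<sigma> f g \<in> Lp_space \<mu> p \<and>
        Lp_norm \<mu> p (twisted_convolution \<mu> \<sigma> f g :: 'g \<Rightarrow> 'x) \<le> K * Lp_norm \<mu> p g" for K
    proof -
      have "onorm (integrated_rep \<mu> \<pi> f) \<le> M\<^sup>2 * K"
        using \<open>0 \<le> K\<close> transference[OF assms(3,9) \<open>0 \<le> K\<close>] C by (intro onorm_bound) auto
      then show ?thesis
        using \<open>0 \<le> K\<close> by (simp add: ennreal_leI flip: ennreal_mult)
    qed
    note le = this
    \<comment> \<open>Dividing by \<open>M\<^sup>2\<close> isolates the infimum, so that it suffices
      to bound each admissible \<open>K\<close>. If there is none, the infimum is infinite and the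
      claim holds vacuously.\<close>
    have "ennreal (1 / M\<^sup>2) * ennreal (onorm (integrated_rep \<mu> \<pi> f))
        \<le> Lp_operator_norm \<mu> p (twisted_convolution \<mu> \<sigma> f :: ('g \<Rightarrow> 'x) \<Rightarrow> ('g \<Rightarrow> 'x))"
      unfolding Lp_operator_norm_def
    proof (rule Inf_greatest, safe)
      fix K :: real
      assume "0 \<le> K" "\<forall>g\<in>Lp_space \<mu> p. twisted_convolution \<mu> \<sigma> f g \<in> Lp_space \<mu> p \<and>
        Lp_norm \<mu> p (twisted_convolution \<mu> \<sigma> f g :: 'g \<Rightarrow> 'x) \<le> K * Lp_norm \<mu> p g"
      from mult_left_mono[OF le[OF this], of "ennreal (1 / M\<^sup>2)"]
      show "ennreal (1 / M\<^sup>2) * ennreal (onorm (integrated_rep \<mu> \<pi> f)) \<le> ennreal K"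
        using pos by (simp add: mult.assoc[symmetric] flip: ennreal_mult)
    qed
    then have "ennreal (M\<^sup>2) * (ennreal (1 / M\<^sup>2) * ennreal (onorm (integrated_rep \<mu> \<pi> f)))
        \<le> ennreal (M\<^sup>2) * Lp_operator_norm \<mu> p (twisted_convolution \<mu> \<sigma> f :: ('g \<Rightarrow> 'x) \<Rightarrow> ('g \<Rightarrow> 'x))"
      by (rule mult_left_mono) simp
    then show ?thesis
      using pos by (simp add: mult.assoc[symmetric] flip: ennreal_mult)
  qed
qed

end
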